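(* For each $n\ge1$, the canonical join complex of the lattice $\operatorname{tors} RA_n$ is isomorphic (as a simplicial complex) to the noncrossing arc complex on $n+1$ nodes.
   Context: Let $k$ be a field. $Q$ is the quiver with vertex set $\{1,\dots,n\}$ and arrows $a_i:i\to i+1$, $a_i^*:i+1\to i$ for $1\le i\le n-1$; $I$ is the two-sided ideal of $kQ$ generated by all two-cycles $a_ia_i^*$, $a_i^*a_i$; $RA_n=kQ/I$. A torsion class is a class of finite-dimensional modules closed under factors, isomorphisms and extensions; $\operatorname{tors} RA_n$ is the lattice of torsion classes ordered by containment. In a complete lattice $L$, a join representation of $w$ is an expression $w=\bigvee A$, $A\subseteq L$. It is irredundant if $\bigvee A'<\bigvee A$ for each proper subset $A'\subsetneq A$. $A$ is lower than (or equal to) $B$ if for each $a\in A$ there is $b\in B$ with $a\le b$. The canonical join representation of $w$ is the unique lowest irredundant join representation of $w$ (lower than all others), when it exists. The canonical join complex $\Gamma(L)$ is the collection of subsets $A\subseteq L$ such that $\bigvee A$ is a canonical join representation; it is a simplicial complex on the join-irreducible elements. Arcs: place $n+1$ nodes in a vertical column, labeled $0,\dots,n$ from bottom to top. An arc $\alpha$ is a curve travelling monotonically up from its bottom endpoint $b(\alpha)$ to its top endpoint $t(\alpha)$ (two distinct nodes), passing to the left or to the right of each node strictly in between. Arcs are considered up to combinatorial equivalence: an arc is determined by its endpoints and by which side it passes of each node strictly between them. Two arcs are compatible if (C1) they do not share a bottom endpoint and do not share a top endpoint, and (C2) they can be drawn so as not to cross in their interiors. A noncrossing arc diagram is a set of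 arcs drawn together such that each pair satisfies (C1) and (C2); a set of arcs is compatible if some noncrossing arc diagram contains all of them. The noncrossing arc complex on $n+1$ nodes is the simplicial complex whose vertices are the arcs and whose faces are the compatible sets of arcs (equivalently, the pairwise compatible sets). *)

theory Defs
  imports
    Complex_Main
    "HOL-Algebra.QuotRing"
    "HOL-Algebra.Module"
    "HOL-Algebra.Complete_Lattice"
    "Graph_Theory.Arc_Walk"
begin

section \<open>Path algebras\<close>

text \<open>
  A quiver is a \<^typ>\<open>('v, 'a) pre_digraph\<close>.  A path from \<open>u\<close> to \<open>v\<close> is a triple \<open>(u, p, v)\<close>; the
  endpoints are recorded so that every vertex \<open>v\<close> has its own trivial path \<open>(v, [], v)\<close>.
\<close>

type_synonym ('v, 'a) path = "'v \<times> 'a list \<times> 'v"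

definition quiver_paths :: "('v, 'a) pre_digraph \<Rightarrow> ('v, 'a) path set" where
  "quiver_paths G = {(u, p, v). pre_digraph.awalk G u p v}"

text \<open>
  Products are written like compositions of maps: \<open>f \<otimes> g\<close> runs first through the paths of \<open>g\<close>, then
  through those of \<open>f\<close>, so that an arrow \<open>u \<rightarrow> v\<close> acts on a left module as a map from the part at
  \<open>u\<close> to the part at \<open>v\<close>.  The sum ranges over the finitely many factorisations of a path.  The unit
  is the sum of the trivial paths and lies in the carrier because the quivers used have finitely
  many vertices.
\<close>

definition path_algebra :: "('v, 'a) pre_digraph \<Rightarrow> (('v, 'a) path \<Rightarrow> 'k::field) ring" where
  "path_algebra G =
    \<lparr> carrier = {f. finite {x. f x \<noteq> 0} \<and> {x. f x \<noteq> 0} \<subseteq> quiver_paths G},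
      mult = (\<lambda>f g (u, r, w).
        \<Sum>(p, v, q) \<in> {(p, v, q). p @ q = r \<and> (u, p, v) \<in> quiver_paths G \<and> (v, q, w) \<in> quiver_paths G}.
          f (v, q, w) * g (u, p, v)),
      one = (\<lambda>(u, p, v). if u \<in> verts G \<and> p = [] \<and> u = v then 1 else 0),
      zero = (\<lambda>_. 0),
      add = (\<lambda>f g x. f x + g x) \<rparr>"

definition path_elem :: "('v, 'a) path \<Rightarrow> ('v, 'a) path \<Rightarrow> 'k::field" where
  "path_elem x = (\<lambda>y. if y = x then 1 else 0)"


section \<open>The algebra $RA_n$\<close>

text \<open>\<open>Fwd i\<close> is $a_i : i \to i+1$ and \<open>Bwd i\<close> is $a_i^* : i+1 \to i$.\<close>

datatype arrow = Fwd nat | Bwd nat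

definition RA_quiver :: "nat \<Rightarrow> (nat, arrow) pre_digraph" where
  "RA_quiver n =
    \<lparr> verts = {1..n},
      arcs = Fwd ` {1..<n} \<union> Bwd ` {1..<n},
      tail = (\<lambda>a. case a of Fwd i \<Rightarrow> i | Bwd i \<Rightarrow> i + 1),
      head = (\<lambda>a. case a of Fwd i \<Rightarrow> i + 1 | Bwd i \<Rightarrow> i) \<rparr>"

type_synonym 'k kQ_elt = "(nat, arrow) path \<Rightarrow> 'k"

abbreviation kQ :: "nat \<Rightarrow> 'k::field kQ_elt ring" where
  "kQ n \<equiv> path_algebra (RA_quiver n)"

definition two_cycles :: "nat \<Rightarrow> 'k::field kQ_elt set" where
  "two_cycles n =
    (\<lambda>i. path_elem (i, [Fwd i, Bwd i], i)) ` {1..<n} \<union>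
    (\<lambda>i. path_elem (i + 1, [Bwd i, Fwd i], i + 1)) ` {1..<n}"

definition RA_ideal :: "nat \<Rightarrow> 'k::field kQ_elt set" where
  "RA_ideal n = genideal (kQ n) (two_cycles n)"

definition RA :: "nat \<Rightarrow> 'k::field kQ_elt set ring" where
  "RA n = kQ n Quot RA_ideal n"

definition RA_scalar :: "nat \<Rightarrow> 'k::field \<Rightarrow> 'k kQ_elt set" where
  "RA_scalar n c = RA_ideal n +>\<^bsub>kQ n\<^esub> (\<lambda>x. c * \<one>\<^bsub>kQ n\<^esub> x)"


section \<open>Modules\<close>

text \<open>
  The locale \<^locale>\<open>module\<close> requires a commutative ring.  As there, the multiplicative components
  of the record \<open>M\<close> are irrelevant.
\<close>

locale left_module = R?: ring R + M?: abelian_group M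
  for R (structure) and M :: "('a, 'v, 'z) module_scheme" (structure) +
  assumes smult_closed: "a \<in> carrier R \<Longrightarrow> x \<in> carrier M \<Longrightarrow> a \<odot>\<^bsub>M\<^esub> x \<in> carrier M"
    and smult_l_distr: "a \<in> carrier R \<Longrightarrow> b \<in> carrier R \<Longrightarrow> x \<in> carrier M \<Longrightarrow>
      (a \<oplus>\<^bsub>R\<^esub> b) \<odot>\<^bsub>M\<^esub> x = a \<odot>\<^bsub>M\<^esub> x \<oplus>\<^bsub>M\<^esub> b \<odot>\<^bsub>M\<^esub> x"
    and smult_r_distr: "a \<in> carrier R \<Longrightarrow> x \<in> carrier M \<Longrightarrow> y \<in> carrier M \<Longrightarrow>
      a \<odot>\<^bsub>M\<^esub> (x \<oplus>\<^bsub>M\<^esub> y) = a \<odot>\<^bsub>M\<^esub> x \<oplus>\<^bsub>M\<^esub> a \<odot>\<^bsub>M\<^esub> y"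
    and smult_assoc: "a \<in> carrier R \<Longrightarrow> b \<in> carrier R \<Longrightarrow> x \<in> carrier M \<Longrightarrow>
      (a \<otimes>\<^bsub>R\<^esub> b) \<odot>\<^bsub>M\<^esub> x = a \<odot>\<^bsub>M\<^esub> (b \<odot>\<^bsub>M\<^esub> x)"
    and smult_one: "x \<in> carrier M \<Longrightarrow> \<one>\<^bsub>R\<^esub> \<odot>\<^bsub>M\<^esub> x = x"

definition left_module_hom ::
    "('a, 'r) ring_scheme \<Rightarrow> ('a, 'v, 'y) module_scheme \<Rightarrow> ('a, 'w, 'z) module_scheme \<Rightarrow> ('v \<Rightarrow> 'w) set"
  where
  "left_module_hom R M N = {h \<in> carrier M \<rightarrow> carrier N.
    (\<forall>x \<in> carrier M. \<forall>y \<in> carrier M. h (x \<oplus>\<^bsub>M\<^esub> y) = h x \<oplus>\<^bsub>N\<^esub> h y) \<and>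
    (\<forall>a \<in> carrier R. \<forall>x \<in> carrier M. h (a \<odot>\<^bsub>M\<^esub> x) = a \<odot>\<^bsub>N\<^esub> h x)}"

definition module_isomorphic ::
    "('a, 'r) ring_scheme \<Rightarrow> ('a, 'v, 'y) module_scheme \<Rightarrow> ('a, 'w, 'z) module_scheme \<Rightarrow> bool" where
  "module_isomorphic R M N \<longleftrightarrow> (\<exists>h \<in> left_module_hom R M N. bij_betw h (carrier M) (carrier N))"

definition is_factor_module ::
    "('a, 'r) ring_scheme \<Rightarrow> ('a, 'v, 'y) module_scheme \<Rightarrow> ('a, 'w, 'z) module_scheme \<Rightarrow> bool" where
  "is_factor_module R N M \<longleftrightarrow> (\<exists>h \<in> left_module_hom R M N. h ` carrier M = carrier N)"

text \<open>There is a short exact sequence $0 \to L \to M \to N \to 0$.\<close>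

definition is_extension ::
    "('a, 'r) ring_scheme \<Rightarrow> ('a, 'u, 'x) module_scheme \<Rightarrow> ('a, 'v, 'y) module_scheme \<Rightarrow>
      ('a, 'w, 'z) module_scheme \<Rightarrow> bool" where
  "is_extension R L M N \<longleftrightarrow> (\<exists>f \<in> left_module_hom R L M. \<exists>g \<in> left_module_hom R M N.
    inj_on f (carrier L) \<and> g ` carrier M = carrier N \<and>
    f ` carrier L = {x \<in> carrier M. g x = \<zero>\<^bsub>N\<^esub>})"

definition finite_dim :: "nat \<Rightarrow> ('k::field kQ_elt set, 'v, 'z) module_scheme \<Rightarrow> bool" where
  "finite_dim n M \<longleftrightarrow> (\<exists>B. finite B \<and> B \<subseteq> carrier M \<and>
    (\<forall>x \<in> carrier M. \<exists>c :: 'v \<Rightarrow> 'k. x = (\<Oplus>\<^bsub>M\<^esub>b \<in> B. RA_scalar n (c b) \<odot>\<^bsub>M\<^esub> b)))"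

text \<open>
  The modules are those whose elements are taken from the type \<^typ>\<open>nat \<Rightarrow> 'k\<close>, the operations
  being arbitrary.  Every finite-dimensional module has such an isomorphic copy (see
  \<open>ex_iso_fd_module\<close> below), so a class of finite-dimensional modules closed under isomorphism
  amounts to an isomorphism-closed subset of \<open>fd_modules n\<close>.
\<close>

type_synonym 'k RA_module = "('k kQ_elt set, nat \<Rightarrow> 'k) module"

definition fd_modules :: "nat \<Rightarrow> 'k::field RA_module set" where
  "fd_modules n = {M. left_module (RA n) M \<and> finite_dim n M}"


section \<open>Torsion classes\<close>

text \<open>Torsion classes contain the zero modules; by closure under factors this only excludes the
  empty class.\<close>

definition torsion_class :: "nat \<Rightarrow> 'k::field RA_module set \<Rightarrow> bool" where
  "torsion_class n T \<longleftrightarrow> T \<subseteq> fd_modules n \<and> T \<noteq> {} \<and>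
    (\<forall>M \<in> T. \<forall>N \<in> fd_modules n. is_factor_module (RA n) N M \<longrightarrow> N \<in> T) \<and>
    (\<forall>M \<in> T. \<forall>N \<in> fd_modules n. module_isomorphic (RA n) M N \<longrightarrow> N \<in> T) \<and>
    (\<forall>L \<in> T. \<forall>N \<in> T. \<forall>M \<in> fd_modules n. is_extension (RA n) L M N \<longrightarrow> M \<in> T)"

definition tors :: "'k::field itself \<Rightarrow> nat \<Rightarrow> 'k RA_module set gorder" where
  "tors _ n = \<lparr> carrier = {T. torsion_class n T}, eq = (=), le = (\<subseteq>) \<rparr>"


section \<open>Canonical join complexes\<close>

definition join_rep :: "('a, 'b) gorder_scheme \<Rightarrow> 'a \<Rightarrow> 'a set \<Rightarrow> bool" where
  "join_rep L w A \<longleftrightarrow> A \<subseteq> carrier L \<and> w = \<Squnion>\<^bsub>L\<^esub>A"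

definition irredundant_join_rep :: "('a, 'b) gorder_scheme \<Rightarrow> 'a \<Rightarrow> 'a set \<Rightarrow> bool" where
  "irredundant_join_rep L w A \<longleftrightarrow>
    join_rep L w A \<and> (\<forall>A'. A' \<subset> A \<longrightarrow> \<Squnion>\<^bsub>L\<^esub>A' \<sqsubset>\<^bsub>L\<^esub> \<Squnion>\<^bsub>L\<^esub>A)"

definition lower_than :: "('a, 'b) gorder_scheme \<Rightarrow> 'a set \<Rightarrow> 'a set \<Rightarrow> bool" where
  "lower_than L A B \<longleftrightarrow> (\<forall>a \<in> A. \<exists>b \<in> B. a \<sqsubseteq>\<^bsub>L\<^esub> b)"

text \<open>Uniqueness is automatic: irredundant sets are antichains, and \<^const>\<open>lower_than\<close> is
  antisymmetric on antichains.\<close>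

definition canonical_join_rep :: "('a, 'b) gorder_scheme \<Rightarrow> 'a \<Rightarrow> 'a set \<Rightarrow> bool" where
  "canonical_join_rep L w A \<longleftrightarrow>
    irredundant_join_rep L w A \<and> (\<forall>B. irredundant_join_rep L w B \<longrightarrow> lower_than L A B)"

definition canonical_join_complex :: "('a, 'b) gorder_scheme \<Rightarrow> 'a set set" where
  "canonical_join_complex L = {A. A \<subseteq> carrier L \<and> canonical_join_rep L (\<Squnion>\<^bsub>L\<^esub>A) A}"

text \<open>A simplicial complex is given by its set of faces; its vertex set is the union of the faces.\<close>

definition complex_isomorphic :: "'a set set \<Rightarrow> 'b set set \<Rightarrow> bool" where
  "complex_isomorphic \<Gamma> \<Delta> \<longleftrightarrow>
    (\<exists>f. bij_betw f (\<Union>\<Gamma>) (\<Union>\<Delta>) \<and> (\<forall>A. A \<subseteq> \<Union>\<Gamma> \<longrightarrow> (A \<in> \<Gamma> \<longleftrightarrow> f ` A \<in> \<Delta>)))"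


section \<open>Noncrossing arc diagrams\<close>

text \<open>
  An arc up to combinatorial equivalence: its two endpoints and the set of those nodes strictly
  in between that it passes on their right.
\<close>

record nc_arc =
  bot_end :: nat
  top_end :: nat
  right_of :: "nat set"

definition nc_arcs :: "nat \<Rightarrow> nc_arc set" where
  "nc_arcs n = {\<alpha>. bot_end \<alpha> < top_end \<alpha> \<and> top_end \<alpha> \<le> n \<and>
    right_of \<alpha> \<subseteq> {bot_end \<alpha> <..< top_end \<alpha>}}"

text \<open>
  Node \<open>i\<close> is placed at the point $(0, i)$ of the plane.  A curve travelling monotonically up is the
  graph of its horizontal coordinate \<open>f\<close> as a function of the height.
\<close>

definition draws :: "(real \<Rightarrow> real) \<Rightarrow> nc_arc \<Rightarrow> bool" where
  "draws f \<alpha> \<longleftrightarrow>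
    continuous_on {real (bot_end \<alpha>)..real (top_end \<alpha>)} f \<and>
    f (real (bot_end \<alpha>)) = 0 \<and> f (real (top_end \<alpha>)) = 0 \<and>
    (\<forall>i. bot_end \<alpha> < i \<and> i < top_end \<alpha> \<longrightarrow> (if i \<in> right_of \<alpha> then f (real i) > 0 else f (real i) < 0))"

definition interior_heights :: "nc_arc \<Rightarrow> real set" where
  "interior_heights \<alpha> = {real (bot_end \<alpha>) <..< real (top_end \<alpha>)}"

text \<open>The curves \<open>D \<alpha>\<close>, for \<open>\<alpha> \<in> S\<close>, form one picture.\<close>

definition noncrossing_arc_diagram :: "nat \<Rightarrow> nc_arc set \<Rightarrow> (nc_arc \<Rightarrow> real \<Rightarrow> real) \<Rightarrow> bool" where
  "noncrossing_arc_diagram n S D \<longleftrightarrow> S \<subseteq> nc_arcs n \<and> (\<forall>\<alpha> \<in> S. draws (D \<alpha>) \<alpha>) \<and>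
    (\<forall>\<alpha> \<in> S. \<forall>\<beta> \<in> S. \<alpha> \<noteq> \<beta> \<longrightarrow>
      bot_end \<alpha> \<noteq> bot_end \<beta> \<and> top_end \<alpha> \<noteq> top_end \<beta> \<and>
      (\<forall>y \<in> interior_heights \<alpha> \<inter> interior_heights \<beta>. D \<alpha> y \<noteq> D \<beta> y))"

definition noncrossing_arc_complex :: "nat \<Rightarrow> nc_arc set set" where
  "noncrossing_arc_complex n = {A. \<exists>S D. noncrossing_arc_diagram n S D \<and> A \<subseteq> S}"


section \<open>Well-definedness\<close>

lemma quiver_paths_append:
  assumes "(u, p, v) \<in> quiver_paths G" "(v, q, w) \<in> quiver_paths G"
  shows "(u, p @ q, w) \<in> quiver_paths G"
proof -
  have "pre_digraph.cas G u (p @ q) w" if "pre_digraph.cas G u p v" "pre_digraph.cas G v q w"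
    using that by (induction p arbitrary: u) (auto simp: pre_digraph.cas.simps)
  then show ?thesis
    using assms by (auto simp: quiver_paths_def pre_digraph.awalk_def)
qed

lemma finite_path_splits:
  "finite {(p, v, q). p @ q = r \<and> (u, p, v) \<in> quiver_paths G \<and> (v, q, w) \<in> quiver_paths G}"
proof -
  have det: "v = v'" if "pre_digraph.cas G u p v" "pre_digraph.cas G u p v'" for p v v'
    using that by (induction p arbitrary: u) (auto simp: pre_digraph.cas.simps)
  define e where "e p = (THE v. pre_digraph.cas G u p v)" for p
  have e: "e p = v" if "pre_digraph.cas G u p v" for p v
    unfolding e_def using that det by blast
  have "{(p, v, q). p @ q = r \<and> (u, p, v) \<in> quiver_paths G \<and> (v, q, w) \<in> quiver_paths G}
    \<subseteq> (\<lambda>k. (take k r, e (take k r), drop k r)) ` {..length r}"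
  proof (rule subsetI, clarify)
    fix p v q assume *: "(u, p, v) \<in> quiver_paths G"
    have "e p = v" using * by (intro e) (auto simp: quiver_paths_def pre_digraph.awalk_def)
    then show "(p, v, q) \<in> (\<lambda>k. (take k (p @ q), e (take k (p @ q)), drop k (p @ q))) ` {..length (p @ q)}"
      by (intro image_eqI[of _ _ "length p"]) auto
  qed
  then show ?thesis by (rule finite_subset) auto
qed

lemma path_algebra_ring:
  assumes "wf_digraph G" and "finite (verts G)"
  shows "ring (path_algebra G :: (('v, 'a) path \<Rightarrow> 'k::field) ring)" (is "ring ?A")
proof -
  define F where "F u r w = {(p, v, q). p @ q = r \<and> (u, p, v) \<in> quiver_paths G \<and> (v, q, w) \<in> quiver_paths G}"
    for u r w
  have finF: "finite (F u r w)" for u r w unfolding F_def by (rule finite_path_splits)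
  have mult: "(f \<otimes>\<^bsub>?A\<^esub> g) (u, r, w) = (\<Sum>(p, v, q) \<in> F u r w. f (v, q, w) * g (u, p, v))" for f g u r w
    by (simp add: path_algebra_def F_def)
  have add: "f \<oplus>\<^bsub>?A\<^esub> g = (\<lambda>x. f x + g x)" for f g by (simp add: path_algebra_def)
  have zero: "\<zero>\<^bsub>?A\<^esub> = (\<lambda>_. 0)" by (simp add: path_algebra_def)
  have one: "\<one>\<^bsub>?A\<^esub> (u, p, v) = (if u \<in> verts G \<and> p = [] \<and> u = v then 1 else 0)" for u p v
    by (simp add: path_algebra_def)
  have carr: "f \<in> carrier ?A \<longleftrightarrow> finite {x. f x \<noteq> 0} \<and> {x. f x \<noteq> 0} \<subseteq> quiver_paths G" for f
    by (simp add: path_algebra_def)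
  have outside: "f x = 0" if "f \<in> carrier ?A" "x \<notin> quiver_paths G" for f x
    using that by (auto simp: carr)
  have add_cl: "f \<oplus>\<^bsub>?A\<^esub> g \<in> carrier ?A" if "f \<in> carrier ?A" "g \<in> carrier ?A" for f g
  proof -
    have "{x. f x + g x \<noteq> 0} \<subseteq> {x. f x \<noteq> 0} \<union> {x. g x \<noteq> 0}" by auto
    moreover have "finite ({x. f x \<noteq> 0} \<union> {x. g x \<noteq> 0})"
      "{x. f x \<noteq> 0} \<union> {x. g x \<noteq> 0} \<subseteq> quiver_paths G"
      using that by (auto simp: carr)
    ultimately show ?thesis unfolding carr add by (meson finite_subset subset_trans)
  qed
  have mult_cl: "f \<otimes>\<^bsub>?A\<^esub> g \<in> carrier ?A" if f: "f \<in> carrier ?A" and g: "g \<in> carrier ?A" for f g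
  proof -
    have *: "\<exists>p v q. r = p @ q \<and> (u, p, v) \<in> quiver_paths G \<and> (v, q, w) \<in> quiver_paths G \<and>
        f (v, q, w) \<noteq> 0 \<and> g (u, p, v) \<noteq> 0"
      if "(f \<otimes>\<^bsub>?A\<^esub> g) (u, r, w) \<noteq> 0" for u r w
    proof -
      have "\<exists>t \<in> F u r w. (case t of (p, v, q) \<Rightarrow> f (v, q, w) * g (u, p, v)) \<noteq> 0"
      proof (rule ccontr)
        assume "\<not> ?thesis"
        then have "(f \<otimes>\<^bsub>?A\<^esub> g) (u, r, w) = 0" unfolding mult by (intro sum.neutral) blast
        with that show False by simp
      qed
      then show ?thesis unfolding F_def by (auto split: prod.splits)
    qed
    have "{x. (f \<otimes>\<^bsub>?A\<^esub> g) x \<noteq> 0} \<subseteq>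
      (\<lambda>((v', q, w), (u, p, v)). (u, p @ q, w)) ` ({x. f x \<noteq> 0} \<times> {x. g x \<noteq> 0})"
    proof (rule subsetI)
      fix x assume x: "x \<in> {x. (f \<otimes>\<^bsub>?A\<^esub> g) x \<noteq> 0}"
      obtain u r w where X: "x = (u, r, w)" by (cases x) auto
      obtain p v q where "r = p @ q" "f (v, q, w) \<noteq> 0" "g (u, p, v) \<noteq> 0"
        using *[of u r w] x unfolding X by blast
      then show "x \<in> (\<lambda>((v', q, w), (u, p, v)). (u, p @ q, w)) ` ({x. f x \<noteq> 0} \<times> {x. g x \<noteq> 0})"
        unfolding X by (intro image_eqI[of _ _ "((v, q, w), (u, p, v))"]) auto
    qed
    moreover have "finite ({x. f x \<noteq> 0} \<times> {x. g x \<noteq> 0})" using f g by (auto simp: carr)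
    ultimately have fin: "finite {x. (f \<otimes>\<^bsub>?A\<^esub> g) x \<noteq> 0}" by (meson finite_surj)
    have "{x. (f \<otimes>\<^bsub>?A\<^esub> g) x \<noteq> 0} \<subseteq> quiver_paths G"
      using * quiver_paths_append by fastforce
    with fin show ?thesis unfolding carr by blast
  qed
  have one_cl: "\<one>\<^bsub>?A\<^esub> \<in> carrier ?A"
  proof -
    have sub: "{x. \<one>\<^bsub>?A\<^esub> x \<noteq> 0} \<subseteq> (\<lambda>v. (v, [], v)) ` verts G"
      using one by (auto split: if_splits)
    moreover have "(\<lambda>v. (v, [], v)) ` verts G \<subseteq> quiver_paths G"
      by (auto simp: quiver_paths_def pre_digraph.awalk_def pre_digraph.cas.simps)
    ultimately show ?thesis using assms(2) unfolding carr by (meson finite_surj subset_trans)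
  qed
  have zero_cl: "\<zero>\<^bsub>?A\<^esub> \<in> carrier ?A" by (simp add: carr zero)
  have minus_cl: "(\<lambda>x. - f x) \<in> carrier ?A" if "f \<in> carrier ?A" for f
    using that by (simp add: carr)
  have assoc: "(f \<otimes>\<^bsub>?A\<^esub> g) \<otimes>\<^bsub>?A\<^esub> h = f \<otimes>\<^bsub>?A\<^esub> (g \<otimes>\<^bsub>?A\<^esub> h)" for f g h
  proof (rule ext)
    fix x :: "('v, 'a) path"
    obtain u r w where x: "x = (u, r, w)" by (cases x) auto
    have "((f \<otimes>\<^bsub>?A\<^esub> g) \<otimes>\<^bsub>?A\<^esub> h) x =
      (\<Sum>t \<in> F u r w. \<Sum>s \<in> F (fst (snd t)) (snd (snd t)) w.
        f (fst (snd s), snd (snd s), w) * g (fst (snd t), fst s, fst (snd s)) * h (u, fst t, fst (snd t)))"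
      unfolding x mult by (simp add: case_prod_unfold sum_distrib_right)
    also have "\<dots> = (\<Sum>(t, s) \<in> (SIGMA t:F u r w. F (fst (snd t)) (snd (snd t)) w).
        f (fst (snd s), snd (snd s), w) * g (fst (snd t), fst s, fst (snd s)) * h (u, fst t, fst (snd t)))"
      by (rule sum.Sigma) (auto simp: finF)
    also have "\<dots> = (\<Sum>(t, s) \<in> (SIGMA t:F u r w. F u (fst t) (fst (snd t))).
        f (fst (snd t), snd (snd t), w) * (g (fst (snd s), snd (snd s), fst (snd t)) * h (u, fst s, fst (snd s))))"
      by (rule sum.reindex_bij_witness[where
            i = "\<lambda>((p, v, q), (p', v', q')). ((p', v', q' @ q), (q', v, q))" and
            j = "\<lambda>((p, v, q), (p', v', q')). ((p @ p', v', q'), (p, v, p'))"])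
        (auto simp: F_def quiver_paths_append mult.assoc)
    also have "\<dots> = (\<Sum>t \<in> F u r w. \<Sum>s \<in> F u (fst t) (fst (snd t)).
        f (fst (snd t), snd (snd t), w) * (g (fst (snd s), snd (snd s), fst (snd t)) * h (u, fst s, fst (snd s))))"
      by (rule sum.Sigma[symmetric]) (auto simp: finF)
    also have "\<dots> = (f \<otimes>\<^bsub>?A\<^esub> (g \<otimes>\<^bsub>?A\<^esub> h)) x"
      unfolding x mult by (simp add: case_prod_unfold sum_distrib_left)
    finally show "((f \<otimes>\<^bsub>?A\<^esub> g) \<otimes>\<^bsub>?A\<^esub> h) x = (f \<otimes>\<^bsub>?A\<^esub> (g \<otimes>\<^bsub>?A\<^esub> h)) x" .
  qed
  have cas_end: "w \<in> verts G"
    if "pre_digraph.cas G u r w" "set r \<subseteq> arcs G" "u \<in> verts G" for u r w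
    using that
    by (induction r arbitrary: u) (auto simp: pre_digraph.cas.simps wf_digraph.head_in_verts[OF assms(1)])
  have path_ends: "(u, [], u) \<in> quiver_paths G" "(w, [], w) \<in> quiver_paths G"
    if "(u, r, w) \<in> quiver_paths G" for u r w
    using that cas_end[of u r w]
    by (auto simp: quiver_paths_def pre_digraph.awalk_def pre_digraph.cas.simps)
  have l_one: "\<one>\<^bsub>?A\<^esub> \<otimes>\<^bsub>?A\<^esub> f = f" if f: "f \<in> carrier ?A" for f
  proof (rule ext)
    fix x :: "('v, 'a) path"
    obtain u r w where x: "x = (u, r, w)" by (cases x) auto
    have "(\<one>\<^bsub>?A\<^esub> \<otimes>\<^bsub>?A\<^esub> f) x = (\<Sum>t \<in> F u r w. if t = (r, w, []) then f x else 0)"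
      unfolding x mult
      by (intro sum.cong refl) (auto simp: F_def one quiver_paths_def pre_digraph.awalk_def pre_digraph.cas.simps split: if_splits)
    also have "\<dots> = (if (r, w, []) \<in> F u r w then f x else 0)" by (simp add: finF)
    also have "\<dots> = f x"
      using outside[OF f, of x] path_ends[of u r w] by (auto simp: F_def x)
    finally show "(\<one>\<^bsub>?A\<^esub> \<otimes>\<^bsub>?A\<^esub> f) x = f x" .
  qed
  have r_one: "f \<otimes>\<^bsub>?A\<^esub> \<one>\<^bsub>?A\<^esub> = f" if f: "f \<in> carrier ?A" for f
  proof (rule ext)
    fix x :: "('v, 'a) path"
    obtain u r w where x: "x = (u, r, w)" by (cases x) auto
    have "(f \<otimes>\<^bsub>?A\<^esub> \<one>\<^bsub>?A\<^esub>) x = (\<Sum>t \<in> F u r w. if t = ([], u, r) then f x else 0)"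
      unfolding x mult
      by (intro sum.cong refl) (auto simp: F_def one quiver_paths_def pre_digraph.awalk_def pre_digraph.cas.simps split: if_splits)
    also have "\<dots> = (if ([], u, r) \<in> F u r w then f x else 0)" by (simp add: finF)
    also have "\<dots> = f x"
      using outside[OF f, of x] path_ends[of u r w] by (auto simp: F_def x)
    finally show "(f \<otimes>\<^bsub>?A\<^esub> \<one>\<^bsub>?A\<^esub>) x = f x" .
  qed
  have l_distr: "(f \<oplus>\<^bsub>?A\<^esub> g) \<otimes>\<^bsub>?A\<^esub> h = f \<otimes>\<^bsub>?A\<^esub> h \<oplus>\<^bsub>?A\<^esub> g \<otimes>\<^bsub>?A\<^esub> h" for f g h
    by (rule ext) (auto simp: mult add case_prod_unfold distrib_right sum.distrib)
  have r_distr: "h \<otimes>\<^bsub>?A\<^esub> (f \<oplus>\<^bsub>?A\<^esub> g) = h \<otimes>\<^bsub>?A\<^esub> f \<oplus>\<^bsub>?A\<^esub> h \<otimes>\<^bsub>?A\<^esub> g" for f g h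
    by (rule ext) (auto simp: mult add case_prod_unfold distrib_left sum.distrib)
  show ?thesis
  proof (rule ringI)
    show "abelian_group ?A"
    proof (rule abelian_groupI)
      show "\<exists>g \<in> carrier ?A. g \<oplus>\<^bsub>?A\<^esub> f = \<zero>\<^bsub>?A\<^esub>" if "f \<in> carrier ?A" for f
        using minus_cl[OF that] by (intro bexI[of _ "\<lambda>x. - f x"]) (auto simp: add zero)
    qed (auto simp: add_cl zero_cl, auto simp: add zero ac_simps)
    show "monoid ?A"
      by (rule monoidI) (auto simp: mult_cl one_cl assoc l_one r_one)
  qed (auto simp: l_distr r_distr)
qed

lemma kQ_ring: "ring (kQ n)"
  by (intro path_algebra_ring, unfold_locales) (auto simp: RA_quiver_def)

lemma two_cycles_subset: "two_cycles n \<subseteq> carrier (kQ n)"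
  by (auto simp: two_cycles_def path_algebra_def path_elem_def quiver_paths_def RA_quiver_def
      pre_digraph.awalk_def pre_digraph.cas.simps split: if_splits)

lemma RA_ideal: "ideal (RA_ideal n) (kQ n)"
  unfolding RA_ideal_def by (rule ring.genideal_ideal[OF kQ_ring two_cycles_subset])

lemma RA_ring: "ring (RA n)"
  unfolding RA_def by (rule ideal.quotient_is_ring[OF RA_ideal])

lemma RA_scalar_closed: "RA_scalar n c \<in> carrier (RA n)"
proof -
  interpret ring "kQ n :: 'a kQ_elt ring" by (rule kQ_ring)
  have "{x. c * \<one>\<^bsub>kQ n\<^esub> x \<noteq> 0} \<subseteq> {x. \<one>\<^bsub>kQ n\<^esub> x \<noteq> (0::'a)}" by auto
  moreover have "finite {x. \<one>\<^bsub>kQ n\<^esub> x \<noteq> (0::'a)}"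
    "{x. \<one>\<^bsub>kQ n\<^esub> x \<noteq> (0::'a)} \<subseteq> quiver_paths (RA_quiver n)"
    using one_closed unfolding path_algebra_def by simp_all
  ultimately have "(\<lambda>x. c * \<one>\<^bsub>kQ n\<^esub> x) \<in> carrier (kQ n)"
    by (simp add: path_algebra_def)
  then show ?thesis
    unfolding RA_scalar_def RA_def FactRing_def
    by (simp add: a_rcosetsI additive_subgroup.a_subset ideal.axioms(1)[OF RA_ideal])
qed

lemma ex_iso_fd_module:
  fixes M :: "('k::field kQ_elt set, 'v, 'z) module_scheme"
  assumes "left_module (RA n) M" and "finite_dim n M"
  shows "\<exists>N \<in> fd_modules n. module_isomorphic (RA n) M N"
proof -
  interpret left_module "RA n" M by fact
  obtain B where B: "finite B" "B \<subseteq> carrier M"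
    and span: "\<And>x. x \<in> carrier M \<Longrightarrow> \<exists>c :: 'v \<Rightarrow> 'k. x = (\<Oplus>\<^bsub>M\<^esub>b \<in> B. RA_scalar n (c b) \<odot>\<^bsub>M\<^esub> b)"
    using assms(2) unfolding finite_dim_def by blast
  define c where "c x = (SOME d :: 'v \<Rightarrow> 'k. x = (\<Oplus>\<^bsub>M\<^esub>b \<in> B. RA_scalar n (d b) \<odot>\<^bsub>M\<^esub> b))" for x
  have c: "x = (\<Oplus>\<^bsub>M\<^esub>b \<in> B. RA_scalar n (c x b) \<odot>\<^bsub>M\<^esub> b)" if "x \<in> carrier M" for x
    unfolding c_def by (rule someI_ex[OF span[OF that]])
  obtain e where e: "bij_betw e {..<card B} B"
    using ex_bij_betw_nat_finite[OF B(1)] by (auto simp: atLeast0LessThan)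
  define \<phi> where "\<phi> x i = (if i < card B then c x (e i) else 0)" for x i
  have inj: "inj_on \<phi> (carrier M)"
  proof (rule inj_onI)
    fix x y assume xy: "x \<in> carrier M" "y \<in> carrier M" "\<phi> x = \<phi> y"
    have "c x b = c y b" if b: "b \<in> B" for b
    proof -
      obtain i where "i < card B" "b = e i" using b e by (auto simp: bij_betw_def)
      then show ?thesis using fun_cong[OF xy(3), of i] by (simp add: \<phi>_def)
    qed
    then have "(\<Oplus>\<^bsub>M\<^esub>b \<in> B. RA_scalar n (c x b) \<odot>\<^bsub>M\<^esub> b) = (\<Oplus>\<^bsub>M\<^esub>b \<in> B. RA_scalar n (c y b) \<odot>\<^bsub>M\<^esub> b)"
      using B(2) by (intro M.finsum_cong') (auto intro!: smult_closed RA_scalar_closed)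
    then show "x = y" by (rule trans[OF c[OF xy(1)] trans[OF _ c[OF xy(2), symmetric]]])
  qed
  define \<psi> where "\<psi> = inv_into (carrier M) \<phi>"
  have \<psi>[simp]: "\<psi> (\<phi> x) = x" if "x \<in> carrier M" for x
    unfolding \<psi>_def using inj that by (rule inv_into_f_f)
  define N :: "'k RA_module" where "N =
    \<lparr> carrier = \<phi> ` carrier M, mult = (\<lambda>x y. x), one = \<phi> \<zero>\<^bsub>M\<^esub>, zero = \<phi> \<zero>\<^bsub>M\<^esub>,
      add = (\<lambda>x y. \<phi> (\<psi> x \<oplus>\<^bsub>M\<^esub> \<psi> y)), smult = (\<lambda>a x. \<phi> (a \<odot>\<^bsub>M\<^esub> \<psi> x)) \<rparr>"
  have N[simp]: "carrier N = \<phi> ` carrier M" "\<zero>\<^bsub>N\<^esub> = \<phi> \<zero>\<^bsub>M\<^esub>"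
    "\<And>x y. x \<oplus>\<^bsub>N\<^esub> y = \<phi> (\<psi> x \<oplus>\<^bsub>M\<^esub> \<psi> y)" "\<And>a x. a \<odot>\<^bsub>N\<^esub> x = \<phi> (a \<odot>\<^bsub>M\<^esub> \<psi> x)"
    by (simp_all add: N_def)
  interpret N: abelian_group N
  proof (rule abelian_groupI)
    show "\<exists>y \<in> carrier N. y \<oplus>\<^bsub>N\<^esub> x = \<zero>\<^bsub>N\<^esub>" if "x \<in> carrier N" for x
      using that by (auto intro!: bexI[of _ "\<ominus>\<^bsub>M\<^esub> _"] simp: M.l_neg)
  qed (auto simp: M.a_ac)
  have N_mod: "left_module (RA n) N"
    by unfold_locales
      (auto simp: smult_closed smult_l_distr smult_r_distr smult_assoc smult_one)
  have fs: "\<phi> (\<Oplus>\<^bsub>M\<^esub>b \<in> C. g b) = (\<Oplus>\<^bsub>N\<^esub>b \<in> C. \<phi> (g b))"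
    if "finite C" "g \<in> C \<rightarrow> carrier M" for C and g :: "'v \<Rightarrow> 'v"
    using that
  proof (induction C rule: finite_induct)
    case (insert x C)
    then have IH: "(\<Oplus>\<^bsub>N\<^esub>b \<in> C. \<phi> (g b)) = \<phi> (\<Oplus>\<^bsub>M\<^esub>b \<in> C. g b)" by (simp add: Pi_iff)
    have cl: "(\<Oplus>\<^bsub>M\<^esub>b \<in> C. g b) \<in> carrier M" "g x \<in> carrier M"
      using insert.prems by (auto intro: M.finsum_closed)
    have "(\<Oplus>\<^bsub>M\<^esub>b \<in> insert x C. g b) = g x \<oplus>\<^bsub>M\<^esub> (\<Oplus>\<^bsub>M\<^esub>b \<in> C. g b)"
      using insert by (intro M.finsum_insert) auto
    moreover have "(\<Oplus>\<^bsub>N\<^esub>b \<in> insert x C. \<phi> (g b)) = \<phi> (g x) \<oplus>\<^bsub>N\<^esub> (\<Oplus>\<^bsub>N\<^esub>b \<in> C. \<phi> (g b))"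
      using insert by (intro N.finsum_insert) (auto simp: Pi_iff)
    ultimately show ?case by (simp add: IH cl)
  qed simp
  have "finite_dim n N"
    unfolding finite_dim_def
  proof (intro exI[of _ "\<phi> ` B"] conjI ballI)
    fix y assume "y \<in> carrier N"
    then obtain x where x: "x \<in> carrier M" "y = \<phi> x" by auto
    have "y = \<phi> (\<Oplus>\<^bsub>M\<^esub>b \<in> B. RA_scalar n (c x b) \<odot>\<^bsub>M\<^esub> b)"
      unfolding x(2) by (rule arg_cong[OF c[OF x(1)]])
    also have "\<dots> = (\<Oplus>\<^bsub>N\<^esub>b \<in> B. \<phi> (RA_scalar n (c x b) \<odot>\<^bsub>M\<^esub> b))"
      using B by (intro fs) (auto intro!: smult_closed RA_scalar_closed)
    also have "\<dots> = (\<Oplus>\<^bsub>N\<^esub>b \<in> B. RA_scalar n (c x (\<psi> (\<phi> b))) \<odot>\<^bsub>N\<^esub> \<phi> b)"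
      using B(2) by (intro N.finsum_cong') (auto intro!: smult_closed RA_scalar_closed simp: subset_iff)
    also have "\<dots> = (\<Oplus>\<^bsub>N\<^esub>b \<in> \<phi> ` B. RA_scalar n (c x (\<psi> b)) \<odot>\<^bsub>N\<^esub> b)"
      using B(2) inj_on_subset[OF inj B(2)]
      by (intro N.finsum_reindex[symmetric]) (auto intro!: smult_closed RA_scalar_closed simp: subset_iff)
    finally show "\<exists>d. y = (\<Oplus>\<^bsub>N\<^esub>b \<in> \<phi> ` B. RA_scalar n (d b) \<odot>\<^bsub>N\<^esub> b)"
      by (rule exI[of _ "\<lambda>b. c x (\<psi> b)"])
  qed (use B in auto)
  then have "N \<in> fd_modules n" using N_mod by (simp add: fd_modules_def)
  moreover have "module_isomorphic (RA n) M N"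
    unfolding module_isomorphic_def left_module_hom_def
    using inj by (auto intro!: exI[of _ \<phi>] simp: bij_betw_def smult_closed)
  ultimately show ?thesis by blast
qed

lemma ex_zero_module: "\<exists>Z \<in> (fd_modules n :: 'k::field RA_module set). carrier Z = {\<zero>\<^bsub>Z\<^esub>}"
proof -
  define Z :: "'k RA_module" where "Z =
    \<lparr> carrier = {\<lambda>_. 0}, mult = (\<lambda>x y. x), one = (\<lambda>_. 0), zero = (\<lambda>_. 0), add = (\<lambda>x y. x), smult = (\<lambda>a x. x) \<rparr>"
  interpret R: ring "RA n :: 'k kQ_elt set ring" by (rule RA_ring)
  interpret abelian_group Z by (rule abelian_groupI) (auto simp: Z_def)
  have carr: "carrier Z = {\<zero>\<^bsub>Z\<^esub>}" by (simp add: Z_def)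
  have "left_module (RA n) Z" by unfold_locales (auto simp: Z_def)
  moreover have "finite_dim n Z"
    unfolding finite_dim_def by (rule exI[of _ "{}"]) (simp add: carr)
  ultimately show ?thesis by (intro bexI[of _ Z]) (auto simp: fd_modules_def Z_def)
qed

lemma zero_module_in_torsion_class:
  assumes "torsion_class n T" and Z: "Z \<in> fd_modules n" "carrier Z = {\<zero>\<^bsub>Z\<^esub>}"
  shows "Z \<in> T"
proof -
  obtain M where M: "M \<in> T" "M \<in> fd_modules n" using assms(1) unfolding torsion_class_def by blast
  interpret M: left_module "RA n" M using M(2) by (simp add: fd_modules_def)
  interpret Z: left_module "RA n" Z using Z(1) by (simp add: fd_modules_def)
  have "a \<odot>\<^bsub>Z\<^esub> \<zero>\<^bsub>Z\<^esub> = \<zero>\<^bsub>Z\<^esub>" if "a \<in> carrier (RA n)" for a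
    using Z.smult_closed[OF that, of "\<zero>\<^bsub>Z\<^esub>"] Z(2) by auto
  then have "(\<lambda>_. \<zero>\<^bsub>Z\<^esub>) \<in> left_module_hom (RA n) M Z" by (auto simp: left_module_hom_def)
  moreover have "(\<lambda>_. \<zero>\<^bsub>Z\<^esub>) ` carrier M = carrier Z" using Z(2) M.zero_closed by auto
  ultimately have "is_factor_module (RA n) Z M" unfolding is_factor_module_def by blast
  with assms(1) M(1) Z(1) show ?thesis unfolding torsion_class_def by blast
qed

lemma tors_complete_lattice: "complete_lattice (tors TYPE('k::field) n)"
proof -
  let ?L = "tors TYPE('k) n"
  interpret partial_order ?L by unfold_locales (auto simp: tors_def)
  have top: "torsion_class n (fd_modules n :: 'k RA_module set)"
    using ex_zero_module[where 'k = 'k, of n] by (auto simp: torsion_class_def)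
  have Inter: "torsion_class n (\<Inter>A)"
    if "A \<noteq> {}" "\<And>T. T \<in> A \<Longrightarrow> torsion_class n T" for A :: "'k RA_module set set"
  proof -
    obtain Z :: "'k RA_module" where "Z \<in> fd_modules n" "carrier Z = {\<zero>\<^bsub>Z\<^esub>}"
      using ex_zero_module by blast
    then have "Z \<in> \<Inter>A" using that(2) zero_module_in_torsion_class by blast
    moreover have "\<Inter>A \<subseteq> fd_modules n" using that unfolding torsion_class_def by blast
    moreover have "N \<in> \<Inter>A"
      if "M \<in> \<Inter>A" "N \<in> fd_modules n" "is_factor_module (RA n) N M \<or> module_isomorphic (RA n) M N"
      for M N
    proof
      fix T assume "T \<in> A"
      with that \<open>\<And>T. T \<in> A \<Longrightarrow> torsion_class n T\<close> show "N \<in> T"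
        unfolding torsion_class_def by blast
    qed
    moreover have "M \<in> \<Inter>A"
      if "L \<in> \<Inter>A" "N \<in> \<Inter>A" "M \<in> fd_modules n" "is_extension (RA n) L M N" for L M N
    proof
      fix T assume T: "T \<in> A"
      then have "torsion_class n T" "L \<in> T" "N \<in> T"
        using that \<open>\<And>T. T \<in> A \<Longrightarrow> torsion_class n T\<close> by blast+
      with that(3,4) show "M \<in> T"
        unfolding torsion_class_def by blast
    qed
    ultimately show ?thesis unfolding torsion_class_def by (intro conjI ballI impI) blast+
  qed
  show ?thesis
  proof (rule complete_lattice_criterion1)
    show "\<exists>g. greatest ?L g (carrier ?L)"
      using top by (intro exI[of _ "fd_modules n"]) (auto simp: greatest_def tors_def torsion_class_def)
    fix A assume "A \<subseteq> carrier ?L" "A \<noteq> {}"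
    then show "\<exists>i. greatest ?L i (Lower ?L A)"
      using Inter[of A] by (intro exI[of _ "\<Inter>A"]) (auto simp: greatest_def Lower_def tors_def)
  qed
qed

end

theory Submission
  imports Defs
begin

text \<open>
  An arc determines a module that is one-dimensional on an interval of vertices, the sides of the
  arc telling which of $a_i$, $a_i^*$ acts nontrivially.  Every nonzero finite-dimensional module has
  such an arc module as a direct summand, so a torsion class is determined by the arcs it contains.
  A nonzero map between arc modules is an isomorphism from a factor of the first to a submodule of
  the second, supported on a common interval; for two different arcs, such maps exist in neither
  direction exactly if the arcs are compatible.  If \<open>S\<close> is a set of pairwise Hom-orthogonal arc
  modules, every nonzero map from a module in the torsion class generated by \<open>S\<close> to a member of \<open>S\<close> is
  surjective, and hence the torsion classes generated by the members of \<open>S\<close> form a canonical join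
  representation.  Conversely, a torsion class is generated by a Hom-orthogonal set: the arc modules
  without proper nonzero submodules in the class, restricted to those that are not proper factors
  of one another.
\<close>

section \<open>Generators of $RA_n$\<close>

text \<open>\<open>side\<close> is 0 at both ends of an arc, so the weak inequalities in
  \<open>overlap \<alpha> \<beta> c d\<close> treat ends and inner nodes alike. On modules they say
  that the arrows of \<alpha> at the ends of the interval lead out of it and those of \<beta> lead
  into it; on curves, that \<alpha> is weakly left of \<beta> at height c and weakly right of it at
  height d. This double reading turns Hom-orthogonality into compatibility, a shared endpoint being
  a degenerate crossing. A direct summand needs a map from the arc module and a map back, so vectors
  and linear functionals are chosen together; each choice constrains the next vertex, hence an
  induction over pairs of subspaces. A set of arcs must be drawn in one picture although
  orthogonality speaks of pairs only, so each curve is a formula in its own arc that breaks all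
  ties. Surjectivity passes from generators to a whole torsion class because the modules all of
  whose maps to a fixed module are zero or surjective form a torsion class themselves.\<close>

lemma path_algebra_simps:
  "\<zero>\<^bsub>path_algebra G\<^esub> = (\<lambda>_. 0)"
  "f \<oplus>\<^bsub>path_algebra G\<^esub> g = (\<lambda>x. f x + g x)"
  "f \<in> carrier (path_algebra G) \<longleftrightarrow> finite {x. f x \<noteq> 0} \<and> {x. f x \<noteq> 0} \<subseteq> quiver_paths G"
  "\<one>\<^bsub>path_algebra G\<^esub> (u, p, v) = (if u \<in> verts G \<and> p = [] \<and> u = v then 1 else 0)"
  by (simp_all add: path_algebra_def)

lemma path_algebra_mult:
  "(f \<otimes>\<^bsub>path_algebra G\<^esub> g) (u, r, w) =
    (\<Sum>(p, v, q) \<in> {(p, v, q). p @ q = r \<and> (u, p, v) \<in> quiver_paths G \<and> (v, q, w) \<in> quiver_paths G}.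
      f (v, q, w) * g (u, p, v))"
  by (simp add: path_algebra_def)

lemma path_elem_closed: "x \<in> quiver_paths G \<Longrightarrow> path_elem x \<in> carrier (path_algebra G)"
  by (auto simp: path_algebra_simps path_elem_def)

lemma path_algebra_scale_closed:
  "f \<in> carrier (path_algebra G) \<Longrightarrow> (\<lambda>x. c * f x) \<in> carrier (path_algebra G)"
  by (auto simp: path_algebra_simps intro: finite_subset)

text \<open>Properties stable under linear combinations need only be checked on paths. The induction
  runs over a finite set containing the support, so that one path can be split off at a
  time.\<close>

lemma path_algebra_induct [consumes 1, case_names path scale add zero]:
  fixes f :: "('v, 'a) path \<Rightarrow> 'k::field"
  assumes "f \<in> carrier (path_algebra G)"
    and path: "\<And>x. x \<in> quiver_paths G \<Longrightarrow> P (path_elem x)"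
    and scale: "\<And>c f. f \<in> carrier (path_algebra G) \<Longrightarrow> P f \<Longrightarrow> P (\<lambda>x. c * f x)"
    and add: "\<And>f g. f \<in> carrier (path_algebra G) \<Longrightarrow> g \<in> carrier (path_algebra G) \<Longrightarrow>
      P f \<Longrightarrow> P g \<Longrightarrow> P (\<lambda>x. f x + g x)"
    and zero: "P (\<lambda>_. 0)"
  shows "P f"
proof -
  have "P f" if "finite S" "S \<subseteq> quiver_paths G" "{x. f x \<noteq> 0} \<subseteq> S" for S f
    using that
  proof (induction S arbitrary: f rule: finite_induct)
    case empty
    then have "f = (\<lambda>_. 0)" by auto
    then show ?case using zero by simp
  next
    case (insert y S)
    let ?g = "\<lambda>x. if x = y then 0 else f x"
    have sub: "{x. ?g x \<noteq> 0} \<subseteq> S" using insert.prems by auto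
    have "?g \<in> carrier (path_algebra G)"
    proof -
      have "finite {x. ?g x \<noteq> 0}" by (rule finite_subset[OF sub insert.hyps(1)])
      moreover have "{x. ?g x \<noteq> 0} \<subseteq> quiver_paths G" using sub insert.prems(1) by blast
      ultimately show ?thesis by (simp only: path_algebra_simps(3))
    qed
    moreover have "P ?g" using insert.prems(1) sub by (intro insert.IH) auto
    moreover have y: "path_elem y \<in> carrier (path_algebra G :: (('v, 'a) path \<Rightarrow> 'k) ring)"
      using insert.prems by (intro path_elem_closed) auto
    moreover have "P (\<lambda>x. f y * path_elem y x)" using insert.prems y by (intro scale path) auto
    ultimately have "P (\<lambda>x. f y * path_elem y x + ?g x)"
      by (intro add path_algebra_scale_closed)
    also have "(\<lambda>x. f y * path_elem y x + ?g x) = f" by (auto simp: path_elem_def)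
    finally show ?case .
  qed
  then show ?thesis using assms(1) by (auto simp: path_algebra_simps)
qed

lemma path_algebra_scale_mult_left:
  "(\<lambda>x. c * f x) \<otimes>\<^bsub>path_algebra G\<^esub> g = (\<lambda>x. c * (f \<otimes>\<^bsub>path_algebra G\<^esub> g) x)"
  by (rule ext) (auto simp: path_algebra_mult sum_distrib_left mult.assoc split: prod.splits intro!: sum.cong)

lemma path_algebra_scale_mult_right:
  "f \<otimes>\<^bsub>path_algebra G\<^esub> (\<lambda>x. c * g x) = (\<lambda>x. c * (f \<otimes>\<^bsub>path_algebra G\<^esub> g) x)"
  by (rule ext) (auto simp: path_algebra_mult sum_distrib_left ac_simps split: prod.splits intro!: sum.cong)

text \<open>A product runs through its right factor first, hence \<open>p @ q\<close>; of all
  splittings of this path only the one after \<open>p\<close> meets both factors.\<close>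

lemma path_elem_mult:
  assumes "(v, q, w) \<in> quiver_paths G" "(u, p, v') \<in> quiver_paths G"
  shows "path_elem (v, q, w) \<otimes>\<^bsub>path_algebra G\<^esub> path_elem (u, p, v') =
    (if v = v' then path_elem (u, p @ q, w) else (\<lambda>_. 0))"
proof (rule ext)
  fix x :: "('a, 'b) path"
  obtain a r b where x: "x = (a, r, b)" by (cases x) auto
  let ?F = "{(p, v, q). p @ q = r \<and> (a, p, v) \<in> quiver_paths G \<and> (v, q, b) \<in> quiver_paths G}"
  have "(path_elem (v, q, w) \<otimes>\<^bsub>path_algebra G\<^esub> path_elem (u, p, v')) x =
    (\<Sum>t \<in> ?F. if t = (p, v, q) then (if v = v' \<and> a = u \<and> b = w then 1 else 0) else 0)"
    unfolding x path_algebra_mult by (intro sum.cong refl) (auto simp: path_elem_def split: if_splits)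
  also have "\<dots> = (if (p, v, q) \<in> ?F then (if v = v' \<and> a = u \<and> b = w then 1 else 0) else 0)"
    by (simp add: finite_path_splits)
  also have "\<dots> = (if v = v' then path_elem (u, p @ q, w) else (\<lambda>_. 0)) x"
    using assms by (auto simp: x path_elem_def)
  finally show "(path_elem (v, q, w) \<otimes>\<^bsub>path_algebra G\<^esub> path_elem (u, p, v')) x = \<dots>" .
qed

lemma RA_paths:
  "(u, [], v) \<in> quiver_paths (RA_quiver n) \<longleftrightarrow> u = v \<and> u \<in> {1..n}"
  "(u, Fwd i # p, v) \<in> quiver_paths (RA_quiver n) \<longleftrightarrow>
    i \<in> {1..<n} \<and> u = i \<and> (i + 1, p, v) \<in> quiver_paths (RA_quiver n)"
  "(u, Bwd i # p, v) \<in> quiver_paths (RA_quiver n) \<longleftrightarrow>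
    i \<in> {1..<n} \<and> u = i + 1 \<and> (i, p, v) \<in> quiver_paths (RA_quiver n)"
  by (auto simp: quiver_paths_def pre_digraph.awalk_def pre_digraph.cas.simps RA_quiver_def)

definition cls :: "nat \<Rightarrow> 'k::field kQ_elt \<Rightarrow> 'k kQ_elt set" where
  "cls n f = RA_ideal n +>\<^bsub>kQ n\<^esub> f"

text \<open>With \<open>fw\<close> and \<open>bw\<close>, the classes of the trivial paths $e_i$ and
  of the arrows $a_i$, $a_i^*$; together with the scalars they generate $RA_n$.\<close>

definition vx :: "nat \<Rightarrow> nat \<Rightarrow> 'k::field kQ_elt set" where
  "vx n i = cls n (path_elem (i, [], i))"

definition fw :: "nat \<Rightarrow> nat \<Rightarrow> 'k::field kQ_elt set" where
  "fw n i = cls n (path_elem (i, [Fwd i], i + 1))"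

definition bw :: "nat \<Rightarrow> nat \<Rightarrow> 'k::field kQ_elt set" where
  "bw n i = cls n (path_elem (i + 1, [Bwd i], i))"

lemma cls_hom: "(cls n :: 'k::field kQ_elt \<Rightarrow> _) \<in> ring_hom (kQ n) (RA n)"
proof -
  have "(cls n :: 'k kQ_elt \<Rightarrow> _) = (+>\<^bsub>kQ n\<^esub>) (RA_ideal n)" by (rule ext) (simp add: cls_def)
  then show ?thesis by (simp add: RA_def ideal.rcos_ring_hom[OF RA_ideal])
qed

lemmas cls_closed = ring_hom_closed[OF cls_hom]
  and cls_mult = ring_hom_mult[OF cls_hom, symmetric]
  and cls_add = ring_hom_add[OF cls_hom]
  and cls_one = ring_hom_one[OF cls_hom]

lemma cls_zero: "f \<in> RA_ideal n \<Longrightarrow> cls n f = \<zero>\<^bsub>RA n\<^esub>"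
  using abelian_subgroup.a_rcos_const[OF abelian_subgroupI3, of "RA_ideal n" "kQ n" f]
    ideal.axioms(1)[OF RA_ideal] kQ_ring[THEN ring.is_abelian_group]
  by (auto simp: cls_def RA_def FactRing_def)

lemma RA_carrier: "r \<in> carrier (RA n) \<longleftrightarrow> (\<exists>f \<in> carrier (kQ n). r = cls n f)"
  by (auto simp: RA_def FactRing_def A_RCOSETS_def' cls_def)

lemma RA_scalar_eq: "RA_scalar n c = cls n (\<lambda>x. c * \<one>\<^bsub>kQ n\<^esub> x)"
  by (simp add: RA_scalar_def cls_def)

lemma kQ_one_closed: "(\<lambda>x. c * \<one>\<^bsub>kQ n\<^esub> x) \<in> carrier (kQ n)"
  by (rule path_algebra_scale_closed[OF ring.ring_simprules(6)[OF kQ_ring]])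

lemma RA_scalar_cls:
  assumes "f \<in> carrier (kQ n)"
  shows "RA_scalar n c \<otimes>\<^bsub>RA n\<^esub> cls n f = cls n (\<lambda>x. c * f x)"
    and "cls n f \<otimes>\<^bsub>RA n\<^esub> RA_scalar n c = cls n (\<lambda>x. c * f x)"
  using assms
  by (simp_all add: RA_scalar_eq cls_mult kQ_one_closed path_algebra_scale_mult_left
      path_algebra_scale_mult_right ring.is_monoid[OF kQ_ring] monoid.l_one monoid.r_one)

lemma RA_scalar_central: "r \<in> carrier (RA n) \<Longrightarrow> RA_scalar n c \<otimes>\<^bsub>RA n\<^esub> r = r \<otimes>\<^bsub>RA n\<^esub> RA_scalar n c"
  by (auto simp: RA_carrier RA_scalar_cls)

lemma RA_scalar_mult: "RA_scalar n c \<otimes>\<^bsub>RA n\<^esub> RA_scalar n d = RA_scalar n (c * d)"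
  unfolding RA_scalar_eq[of n d] by (subst RA_scalar_cls) (simp_all add: kQ_one_closed RA_scalar_eq mult.assoc)

lemma RA_scalar_add: "RA_scalar n c \<oplus>\<^bsub>RA n\<^esub> RA_scalar n d = RA_scalar n (c + d)"
  unfolding RA_scalar_eq
  by (subst cls_add[symmetric]) (simp_all add: kQ_one_closed path_algebra_simps(2) distrib_right)

lemma RA_scalar_one: "RA_scalar n 1 = \<one>\<^bsub>RA n\<^esub>"
  by (simp add: RA_scalar_eq cls_one)

lemma RA_scalar_zero: "RA_scalar n (0 :: 'k::field) = \<zero>\<^bsub>RA n\<^esub>"
proof -
  have "\<zero>\<^bsub>kQ n\<^esub> \<in> (RA_ideal n :: 'k kQ_elt set)" by (meson RA_ideal additive_subgroup.zero_closed ideal.axioms(1))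
  then show ?thesis by (simp add: RA_scalar_eq cls_zero path_algebra_simps(1))
qed

lemma gen_closed:
  "i \<in> {1..n} \<Longrightarrow> vx n i \<in> carrier (RA n)"
  "i \<in> {1..<n} \<Longrightarrow> fw n i \<in> carrier (RA n)"
  "i \<in> {1..<n} \<Longrightarrow> bw n i \<in> carrier (RA n)"
  by (auto simp: vx_def fw_def bw_def RA_paths intro!: cls_closed path_elem_closed)

lemma cls_path_mult:
  assumes "(v, q, w) \<in> quiver_paths (RA_quiver n)" "(u, p, v') \<in> quiver_paths (RA_quiver n)"
  shows "cls n (path_elem (v, q, w)) \<otimes>\<^bsub>RA n\<^esub> cls n (path_elem (u, p, v')) =
    (if v = v' then cls n (path_elem (u, p @ q, w) :: 'k::field kQ_elt) else \<zero>\<^bsub>RA n\<^esub>)"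
proof -
  have "cls n (\<lambda>_. 0 :: 'k) = \<zero>\<^bsub>RA n\<^esub>"
    using RA_scalar_zero[of n, where 'k = 'k] by (simp add: RA_scalar_eq)
  then show ?thesis
    using assms by (simp add: cls_mult path_elem_closed path_elem_mult)
qed

lemma RA_relations:
  "i \<in> {1..n} \<Longrightarrow> j \<in> {1..n} \<Longrightarrow> vx n i \<otimes>\<^bsub>RA n\<^esub> vx n j = (if i = j then vx n i else \<zero>\<^bsub>RA n\<^esub>)"
  "i \<in> {1..<n} \<Longrightarrow> j \<in> {1..n} \<Longrightarrow> fw n i \<otimes>\<^bsub>RA n\<^esub> vx n j = (if j = i then fw n i else \<zero>\<^bsub>RA n\<^esub>)"
  "i \<in> {1..<n} \<Longrightarrow> j \<in> {1..n} \<Longrightarrow> vx n j \<otimes>\<^bsub>RA n\<^esub> fw n i = (if j = i + 1 then fw n i else \<zero>\<^bsub>RA n\<^esub>)"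
  "i \<in> {1..<n} \<Longrightarrow> j \<in> {1..n} \<Longrightarrow> bw n i \<otimes>\<^bsub>RA n\<^esub> vx n j = (if j = i + 1 then bw n i else \<zero>\<^bsub>RA n\<^esub>)"
  "i \<in> {1..<n} \<Longrightarrow> j \<in> {1..n} \<Longrightarrow> vx n j \<otimes>\<^bsub>RA n\<^esub> bw n i = (if j = i then bw n i else \<zero>\<^bsub>RA n\<^esub>)"
  by (auto simp: vx_def fw_def bw_def cls_path_mult RA_paths)

lemma RA_two_cycles:
  assumes "i \<in> {1..<n}"
  shows "bw n i \<otimes>\<^bsub>RA n\<^esub> fw n i = (\<zero>\<^bsub>RA n\<^esub> :: 'k::field kQ_elt set)"
    and "fw n i \<otimes>\<^bsub>RA n\<^esub> bw n i = (\<zero>\<^bsub>RA n\<^esub> :: 'k kQ_elt set)"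
proof -
  have "two_cycles n \<subseteq> (RA_ideal n :: 'k kQ_elt set)"
    unfolding RA_ideal_def by (rule ring.genideal_self[OF kQ_ring two_cycles_subset])
  then have "path_elem (i, [Fwd i, Bwd i], i) \<in> (RA_ideal n :: 'k kQ_elt set)"
    "path_elem (i + 1, [Bwd i, Fwd i], i + 1) \<in> (RA_ideal n :: 'k kQ_elt set)"
    using assms by (auto simp: two_cycles_def)
  then show "bw n i \<otimes>\<^bsub>RA n\<^esub> fw n i = (\<zero>\<^bsub>RA n\<^esub> :: 'k kQ_elt set)"
    and "fw n i \<otimes>\<^bsub>RA n\<^esub> bw n i = (\<zero>\<^bsub>RA n\<^esub> :: 'k kQ_elt set)"
    using assms by (simp_all add: fw_def bw_def cls_path_mult RA_paths cls_zero)
qed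

text \<open>The elements of \<open>RA n\<close> that \<open>h\<close> commutes with are closed under
  sums and products. A path is a product of arrows, so checking scalars, idempotents and arrows
  suffices.\<close>

lemma left_module_homI:
  fixes M :: "('k::field kQ_elt set, 'v, 'y) module_scheme" and N :: "('k kQ_elt set, 'w, 'z) module_scheme"
  assumes "left_module (RA n) M" "left_module (RA n) N"
    and cl: "\<And>x. x \<in> carrier M \<Longrightarrow> h x \<in> carrier N"
    and add: "\<And>x y. x \<in> carrier M \<Longrightarrow> y \<in> carrier M \<Longrightarrow> h (x \<oplus>\<^bsub>M\<^esub> y) = h x \<oplus>\<^bsub>N\<^esub> h y"
    and sc: "\<And>c x. x \<in> carrier M \<Longrightarrow> h (RA_scalar n c \<odot>\<^bsub>M\<^esub> x) = RA_scalar n c \<odot>\<^bsub>N\<^esub> h x"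
    and vx: "\<And>i x. i \<in> {1..n} \<Longrightarrow> x \<in> carrier M \<Longrightarrow> h (vx n i \<odot>\<^bsub>M\<^esub> x) = vx n i \<odot>\<^bsub>N\<^esub> h x"
    and fw: "\<And>i x. i \<in> {1..<n} \<Longrightarrow> x \<in> carrier M \<Longrightarrow> h (fw n i \<odot>\<^bsub>M\<^esub> x) = fw n i \<odot>\<^bsub>N\<^esub> h x"
    and bw: "\<And>i x. i \<in> {1..<n} \<Longrightarrow> x \<in> carrier M \<Longrightarrow> h (bw n i \<odot>\<^bsub>M\<^esub> x) = bw n i \<odot>\<^bsub>N\<^esub> h x"
  shows "h \<in> left_module_hom (RA n) M N"
proof -
  interpret M: left_module "RA n" M by fact
  interpret N: left_module "RA n" N by fact
  let ?P = "\<lambda>r. r \<in> carrier (RA n) \<and> (\<forall>x \<in> carrier M. h (r \<odot>\<^bsub>M\<^esub> x) = r \<odot>\<^bsub>N\<^esub> h x)"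
  have mult: "?P (r \<otimes>\<^bsub>RA n\<^esub> s)" if "?P r" "?P s" for r s
    using that cl by (auto simp: M.smult_assoc N.smult_assoc M.smult_closed)
  have gen: "?P (cls n (path_elem (u, p, v)))" if "(u, p, v) \<in> quiver_paths (RA_quiver n)" for u p v
    using that
  proof (induction p arbitrary: u)
    case Nil
    then show ?case using vx gen_closed(1)[of u n] by (auto simp: RA_paths vx_def)
  next
    case (Cons a p)
    \<comment> \<open>The first arrow of the path acts first and is therefore the right factor
      \<open>r\<close>.\<close>
    obtain w r where w: "(w, p, v) \<in> quiver_paths (RA_quiver n)" and r: "?P r"
      and eq: "cls n (path_elem (u, a # p, v) :: 'k kQ_elt) = cls n (path_elem (w, p, v)) \<otimes>\<^bsub>RA n\<^esub> r"
    proof (cases a)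
      case (Fwd i)
      with Cons.prems have i: "i \<in> {1..<n}" "u = i" "(i + 1, p, v) \<in> quiver_paths (RA_quiver n)"
        by (auto simp: RA_paths)
      moreover have "?P (fw n i)" using fw gen_closed(2)[OF i(1)] i(1) by auto
      ultimately show ?thesis using Fwd by (intro that[of "i + 1" "fw n i"]) (simp_all add: fw_def cls_path_mult RA_paths)
    next
      case (Bwd i)
      with Cons.prems have i: "i \<in> {1..<n}" "u = i + 1" "(i, p, v) \<in> quiver_paths (RA_quiver n)"
        by (auto simp: RA_paths)
      moreover have "?P (bw n i)" using bw gen_closed(3)[OF i(1)] i(1) by auto
      ultimately show ?thesis using Bwd by (intro that[of i "bw n i"]) (simp_all add: bw_def cls_path_mult RA_paths)
    qed
    show ?case unfolding eq using mult[OF Cons.IH[OF w] r] .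
  qed
  have all: "?P (cls n f)" if "f \<in> carrier (kQ n)" for f
    using that
  proof (induction rule: path_algebra_induct)
    case (path x)
    then show ?case using gen[of "fst x" "fst (snd x)" "snd (snd x)"] by simp
  next
    case (scale c f)
    have "?P (RA_scalar n c)" using sc by (auto simp: RA_scalar_closed)
    from mult[OF this scale(2)] show ?case unfolding RA_scalar_cls(1)[OF scale(1)] .
  next
    case (add f g)
    have eq: "cls n (\<lambda>x. f x + g x) = cls n f \<oplus>\<^bsub>RA n\<^esub> cls n g"
      using cls_add[OF add(1,2)] by (simp add: path_algebra_simps(2))
    show ?case
      unfolding eq
    proof (intro conjI ballI)
      show "cls n f \<oplus>\<^bsub>RA n\<^esub> cls n g \<in> carrier (RA n)" using add(3,4) by (intro M.R.add.m_closed) auto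
      fix x assume x: "x \<in> carrier M"
      have "h ((cls n f \<oplus>\<^bsub>RA n\<^esub> cls n g) \<odot>\<^bsub>M\<^esub> x) = h (cls n f \<odot>\<^bsub>M\<^esub> x) \<oplus>\<^bsub>N\<^esub> h (cls n g \<odot>\<^bsub>M\<^esub> x)"
        using x add(3,4) by (simp add: M.smult_l_distr M.smult_closed assms(4))
      also have "\<dots> = (cls n f \<oplus>\<^bsub>RA n\<^esub> cls n g) \<odot>\<^bsub>N\<^esub> h x"
        using x add(3,4) cl by (simp add: N.smult_l_distr)
      finally show "h ((cls n f \<oplus>\<^bsub>RA n\<^esub> cls n g) \<odot>\<^bsub>M\<^esub> x) = (cls n f \<oplus>\<^bsub>RA n\<^esub> cls n g) \<odot>\<^bsub>N\<^esub> h x" .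
    qed
  next
    case zero
    have "?P (RA_scalar n 0)" using sc by (auto simp: RA_scalar_closed)
    then show ?case by (simp add: RA_scalar_eq)
  qed
  have "h (r \<odot>\<^bsub>M\<^esub> x) = r \<odot>\<^bsub>N\<^esub> h x" if r: "r \<in> carrier (RA n)" and x: "x \<in> carrier M" for r x
  proof -
    obtain f where f: "f \<in> carrier (kQ n)" "r = cls n f" using r unfolding RA_carrier by auto
    show ?thesis using all[OF f(1)] x unfolding f(2) by (elim conjE bspec)
  qed
  note lin = this
  show ?thesis
    unfolding left_module_hom_def by (intro CollectI conjI ballI Pi_I) (erule cl, erule (1) add, erule (1) lin)
qed

section \<open>Arc modules\<close>

text \<open>On the module of an arc, $a_i$ acts nontrivially iff the side is \<open>1\<close> and $a_i^*$ iff it is \<open>- 1\<close>.\<close>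

definition side :: "nc_arc \<Rightarrow> nat \<Rightarrow> int" where
  "side \<alpha> i = (if bot_end \<alpha> < i \<and> i < top_end \<alpha> then if i \<in> right_of \<alpha> then 1 else - 1 else 0)"

text \<open>Vertex \<open>i\<close> of the quiver corresponds to the gap between nodes
  \<open>i - 1\<close> and \<open>i\<close>, and the two arrows between vertices \<open>i\<close>
  and \<open>i + 1\<close> to node \<open>i\<close>; hence the half-open interval.\<close>

definition arc_supp :: "nc_arc \<Rightarrow> nat set" where
  "arc_supp \<alpha> = {bot_end \<alpha> <.. top_end \<alpha>}"

definition arrow_weight :: "nc_arc \<Rightarrow> arrow \<Rightarrow> 'k::field" where
  "arrow_weight \<alpha> a = (case a of Fwd i \<Rightarrow> if side \<alpha> i = 1 then 1 else 0 | Bwd i \<Rightarrow> if side \<alpha> i = - 1 then 1 else 0)"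

lemma arrow_weight_simps:
  "arrow_weight \<alpha> (Fwd i) = (if side \<alpha> i = 1 then 1 else 0)"
  "arrow_weight \<alpha> (Bwd i) = (if side \<alpha> i = - 1 then 1 else 0)"
  by (simp_all add: arrow_weight_def)

text \<open>Matrix entry, in row \<open>j\<close> and column \<open>i\<close>, of the map by which a
  path acts on coordinate vectors.\<close>

definition path_coeff :: "nc_arc \<Rightarrow> nat \<Rightarrow> nat \<Rightarrow> (nat, arrow) path \<Rightarrow> 'k::field" where
  "path_coeff \<alpha> i j x = (if fst x = i \<and> snd (snd x) = j then prod_list (map (arrow_weight \<alpha>) (fst (snd x))) else 0)"

definition lin_ext :: "('x \<Rightarrow> 'k) \<Rightarrow> ('x \<Rightarrow> 'k) \<Rightarrow> 'k::field" where
  "lin_ext K f = (\<Sum>x | f x \<noteq> 0. f x * K x)"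

text \<open>
  The module of an arc from node \<open>b\<close> to node \<open>t\<close> is one-dimensional at the vertices \<open>b + 1, \<dots>, t\<close>.
  The action uses an arbitrary representative of a coset; it does not depend on this choice because
  \<^const>\<open>path_coeff\<close> vanishes on the two-cycles.
\<close>

definition arcmod :: "nat \<Rightarrow> nc_arc \<Rightarrow> 'k::field RA_module" where
  "arcmod n \<alpha> =
    \<lparr> carrier = {v. \<forall>i. i \<notin> arc_supp \<alpha> \<longrightarrow> v i = 0}, mult = (\<lambda>v w. v), one = (\<lambda>_. 0), zero = (\<lambda>_. 0),
      add = (\<lambda>v w i. v i + w i),
      smult = (\<lambda>r v j. \<Sum>i = 1..n. lin_ext (path_coeff \<alpha> i j) (SOME f. f \<in> carrier (kQ n) \<and> r = cls n f) * v i) \<rparr>"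

lemma lin_ext_superset:
  assumes "finite S" "{x. f x \<noteq> 0} \<subseteq> S"
  shows "lin_ext K f = (\<Sum>x \<in> S. f x * K x)"
  unfolding lin_ext_def using assms by (intro sum.mono_neutral_left) auto

lemma lin_ext_add:
  assumes "finite {x. f x \<noteq> 0}" "finite {x. g x \<noteq> 0}"
  shows "lin_ext K (\<lambda>x. f x + g x) = lin_ext K f + lin_ext K g"
proof -
  let ?S = "{x. f x \<noteq> 0} \<union> {x. g x \<noteq> 0}"
  have "lin_ext K f = (\<Sum>x \<in> ?S. f x * K x)" "lin_ext K g = (\<Sum>x \<in> ?S. g x * K x)"
    "lin_ext K (\<lambda>x. f x + g x) = (\<Sum>x \<in> ?S. (f x + g x) * K x)"
    using assms by (auto intro!: lin_ext_superset)
  then show ?thesis by (simp add: distrib_right sum.distrib)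
qed

lemma lin_ext_scale: "lin_ext K (\<lambda>x. c * f x) = c * lin_ext K f"
  by (cases "c = 0") (auto simp: lin_ext_def sum_distrib_left ac_simps)

lemma lin_ext_path_elem: "lin_ext K (path_elem y) = K y"
proof -
  have "{x. path_elem y x \<noteq> (0 :: 'a)} = {y}" by (auto simp: path_elem_def)
  then show ?thesis by (simp add: lin_ext_def path_elem_def)
qed

lemma lin_ext_zero [simp]: "lin_ext K (\<lambda>_. 0) = 0"
  by (simp add: lin_ext_def)

text \<open>An arrow of nonzero weight sits at a node strictly inside the arc, and both vertices
  next to such a node are in the support. This keeps the action inside the carrier of
  \<open>arcmod\<close>.\<close>

lemma path_weight_supp:
  assumes "(u, p, v) \<in> quiver_paths (RA_quiver n)" "prod_list (map (arrow_weight \<alpha>) p) \<noteq> (0 :: 'k::field)"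
    and "u \<in> arc_supp \<alpha>"
  shows "v \<in> arc_supp \<alpha>"
  using assms
proof (induction p arbitrary: u)
  case (Cons a p)
  show ?case
  proof (cases a)
    case (Fwd i)
    then have "(i + 1, p, v) \<in> quiver_paths (RA_quiver n)" "prod_list (map (arrow_weight \<alpha>) p) \<noteq> (0 :: 'k)"
      "side \<alpha> i = 1"
      using Cons.prems(1,2) by (auto simp: RA_paths arrow_weight_simps split: if_splits)
    then show ?thesis by (intro Cons.IH[of "i + 1"]) (auto simp: side_def arc_supp_def split: if_splits)
  next
    case (Bwd i)
    then have "(i, p, v) \<in> quiver_paths (RA_quiver n)" "prod_list (map (arrow_weight \<alpha>) p) \<noteq> (0 :: 'k)"
      "side \<alpha> i = - 1"
      using Cons.prems(1,2) by (auto simp: RA_paths arrow_weight_simps split: if_splits)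
    then show ?thesis by (intro Cons.IH[of i]) (auto simp: side_def arc_supp_def split: if_splits)
  qed
qed (simp add: RA_paths)

text \<open>Matrix multiplication: by bilinearity both factors may be taken to be paths, and then
  only the vertex where they meet contributes to the sum over \<open>m\<close>. Associativity of the
  module action rests on this.\<close>

lemma path_coeff_mult:
  assumes f: "f \<in> carrier (kQ n)" and g: "g \<in> carrier (kQ n :: 'k::field kQ_elt ring)"
  shows "lin_ext (path_coeff \<alpha> i j) (f \<otimes>\<^bsub>kQ n\<^esub> g) =
    (\<Sum>m = 1..n. lin_ext (path_coeff \<alpha> i m) g * lin_ext (path_coeff \<alpha> m j) f)"
proof -
  interpret R: ring "kQ n :: 'k kQ_elt ring" by (rule kQ_ring)
  have fin: "finite {x. h x \<noteq> 0}" if "h \<in> carrier (kQ n :: 'k kQ_elt ring)" for h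
    using that by (simp add: path_algebra_simps(3))
  show ?thesis
    using f
  proof (induction rule: path_algebra_induct)
    case (path x)
    show ?case
      using g
    proof (induction rule: path_algebra_induct)
      case (path y)
      obtain v q w where x: "x = (v, q, w)" by (cases x) auto
      obtain u p v' where y: "y = (u, p, v')" by (cases y) auto
      have v: "v \<in> {1..n}" using \<open>x \<in> quiver_paths (RA_quiver n)\<close>
        by (simp add: x quiver_paths_def pre_digraph.awalk_def RA_quiver_def)
      have "(\<Sum>m = 1..n. path_coeff \<alpha> i m y * path_coeff \<alpha> m j x :: 'k) =
        (\<Sum>m \<in> {1..n}. if m = v then path_coeff \<alpha> i v y * path_coeff \<alpha> v j x else 0)"
        by (intro sum.cong refl) (auto simp: path_coeff_def x)
      also have "\<dots> = path_coeff \<alpha> i v y * path_coeff \<alpha> v j x" using v by simp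
      also have "\<dots> = lin_ext (path_coeff \<alpha> i j) (path_elem x \<otimes>\<^bsub>kQ n\<^esub> path_elem y)"
        using \<open>x \<in> _\<close> path by (auto simp: x y path_elem_mult lin_ext_path_elem path_coeff_def)
      finally show ?case by (simp add: lin_ext_path_elem)
    next
      case (scale c h)
      then show ?case
        by (simp add: path_algebra_scale_mult_right lin_ext_scale sum_distrib_left ac_simps)
    next
      case (add h h')
      have x: "path_elem x \<in> carrier (kQ n :: 'k kQ_elt ring)" using path by (rule path_elem_closed)
      have "path_elem x \<otimes>\<^bsub>kQ n\<^esub> (\<lambda>x. h x + h' x) =
        (\<lambda>y. (path_elem x \<otimes>\<^bsub>kQ n\<^esub> h) y + (path_elem x \<otimes>\<^bsub>kQ n\<^esub> h') y)"
        using R.r_distr[OF add(1,2) x] unfolding path_algebra_simps(2) .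
      then show ?case
        using add(1,2) x by (simp add: lin_ext_add fin add.IH distrib_right sum.distrib)
    next
      case zero
      have x: "path_elem x \<in> carrier (kQ n :: 'k kQ_elt ring)" using path by (rule path_elem_closed)
      show ?case using R.r_null[OF x] unfolding path_algebra_simps(1) by simp
    qed
  next
    case (scale c h)
    then show ?case
      by (simp add: path_algebra_scale_mult_left lin_ext_scale sum_distrib_left ac_simps)
  next
    case (add h h')
    have "(\<lambda>x. h x + h' x) \<otimes>\<^bsub>kQ n\<^esub> g = (\<lambda>y. (h \<otimes>\<^bsub>kQ n\<^esub> g) y + (h' \<otimes>\<^bsub>kQ n\<^esub> g) y)"
      using R.l_distr[OF add(1,2) g] unfolding path_algebra_simps(2) .
    then show ?case
      using add(1,2) g by (simp add: lin_ext_add fin add.IH distrib_left sum.distrib)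
  next
    case zero
    show ?case using R.l_null[OF g] unfolding path_algebra_simps(1) by simp
  qed
qed

text \<open>The elements with all matrix entries zero form the kernel of the representation, an
  ideal. It contains the two-cycles because the side at a node cannot be both 1 and -1, so one of
  the two arrows there has weight 0.\<close>

lemma path_coeff_ideal:
  assumes "f \<in> (RA_ideal n :: 'k::field kQ_elt set)"
  shows "lin_ext (path_coeff \<alpha> i j) f = 0"
proof -
  interpret R: ring "kQ n :: 'k kQ_elt ring" by (rule kQ_ring)
  let ?Z = "{f \<in> carrier (kQ n :: 'k kQ_elt ring). \<forall>i j. lin_ext (path_coeff \<alpha> i j) f = 0}"
  have fin: "finite {x. h x \<noteq> 0}" if "h \<in> carrier (kQ n :: 'k kQ_elt ring)" for h
    using that by (simp add: path_algebra_simps(3))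
  have inv: "\<ominus>\<^bsub>kQ n\<^esub> h = (\<lambda>x. - 1 * h x)" if "h \<in> carrier (kQ n :: 'k kQ_elt ring)" for h
    using that by (intro R.minus_equality path_algebra_scale_closed) (auto simp: path_algebra_simps(1,2))
  have "ideal ?Z (kQ n)"
  proof (rule idealI)
    show "subgroup ?Z (add_monoid (kQ n))"
    proof (rule R.add.subgroupI)
      show "?Z \<noteq> {}" using R.zero_closed by (auto simp: path_algebra_simps(1))
      show "\<ominus>\<^bsub>kQ n\<^esub> h \<in> ?Z" if "h \<in> ?Z" for h
        using that path_algebra_scale_closed[of h "RA_quiver n" "- 1"]
        by (simp add: inv lin_ext_scale[of _ "- 1", simplified])
      show "h \<oplus>\<^bsub>kQ n\<^esub> h' \<in> ?Z" if "h \<in> ?Z" "h' \<in> ?Z" for h h'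
        using that R.a_closed[of h h'] by (simp add: path_algebra_simps(2) lin_ext_add fin)
    qed auto
  qed (auto simp: path_coeff_mult kQ_ring)
  moreover have "two_cycles n \<subseteq> ?Z"
    using two_cycles_subset[of n, where 'a = 'k]
    by (auto simp: two_cycles_def lin_ext_path_elem path_coeff_def arrow_weight_simps)
  ultimately have "RA_ideal n \<subseteq> ?Z" unfolding RA_ideal_def by (rule R.genideal_minimal)
  then show ?thesis using assms by blast
qed

lemma arcmod_simps:
  "v \<in> carrier (arcmod n \<alpha>) \<longleftrightarrow> (\<forall>i. i \<notin> arc_supp \<alpha> \<longrightarrow> v i = 0)"
  "\<zero>\<^bsub>arcmod n \<alpha>\<^esub> = (\<lambda>_. 0)"
  "v \<oplus>\<^bsub>arcmod n \<alpha>\<^esub> w = (\<lambda>i. v i + w i)"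
  by (simp_all add: arcmod_def)

lemma arcmod_smult:
  assumes f: "f \<in> carrier (kQ n :: 'k::field kQ_elt ring)"
  shows "cls n f \<odot>\<^bsub>arcmod n \<alpha>\<^esub> v = (\<lambda>j. \<Sum>i = 1..n. lin_ext (path_coeff \<alpha> i j) f * v i)"
proof -
  interpret R: ring "kQ n :: 'k kQ_elt ring" by (rule kQ_ring)
  let ?P = "\<lambda>g. g \<in> carrier (kQ n) \<and> cls n f = cls n g"
  define g where "g = (SOME g. ?P g)"
  have g: "?P g" unfolding g_def by (rule someI[of ?P f]) (use f in simp)
  have "f \<ominus>\<^bsub>kQ n\<^esub> g \<in> RA_ideal n"
    using f g R.quotient_eq_iff_same_a_r_cos[OF RA_ideal, of f g] by (simp add: cls_def)
  then have zero: "lin_ext (path_coeff \<alpha> i j) (f \<ominus>\<^bsub>kQ n\<^esub> g) = 0" for i j by (rule path_coeff_ideal)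
  have "f = (f \<ominus>\<^bsub>kQ n\<^esub> g) \<oplus>\<^bsub>kQ n\<^esub> g" using f g by (simp add: R.minus_eq R.a_assoc R.l_neg)
  then have split: "f = (\<lambda>x. (f \<ominus>\<^bsub>kQ n\<^esub> g) x + g x)" by (simp only: path_algebra_simps(2))
  have fin: "finite {x. (f \<ominus>\<^bsub>kQ n\<^esub> g) x \<noteq> 0}" "finite {x. g x \<noteq> 0}"
    using R.minus_closed[of f g] f g by (simp_all add: path_algebra_simps(3))
  have "lin_ext (path_coeff \<alpha> i j) f = lin_ext (path_coeff \<alpha> i j) g" for i j
    using lin_ext_add[OF fin, of "path_coeff \<alpha> i j"] zero[of i j] unfolding split[symmetric] by simp
  then show ?thesis by (simp add: arcmod_def g_def)
qed

lemma arcmod_gens: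
  fixes v :: "nat \<Rightarrow> 'k::field"
  shows "i \<in> {1..n} \<Longrightarrow> vx n i \<odot>\<^bsub>arcmod n \<alpha>\<^esub> v = (\<lambda>j. if j = i then v i else 0)"
    and "i \<in> {1..<n} \<Longrightarrow> fw n i \<odot>\<^bsub>arcmod n \<alpha>\<^esub> v = (\<lambda>j. if j = i + 1 \<and> side \<alpha> i = 1 then v i else 0)"
    and "i \<in> {1..<n} \<Longrightarrow> bw n i \<odot>\<^bsub>arcmod n \<alpha>\<^esub> v = (\<lambda>j. if j = i \<and> side \<alpha> i = - 1 then v (i + 1) else 0)"
proof -
  have *: "cls n (path_elem (u, p, w)) \<odot>\<^bsub>arcmod n \<alpha>\<^esub> v =
    (\<lambda>j. if j = w then prod_list (map (arrow_weight \<alpha>) p) * v u else 0)"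
    if "(u, p, w) \<in> quiver_paths (RA_quiver n)" for u p w
  proof (rule ext)
    fix j
    have u: "u \<in> {1..n}" using that by (simp add: quiver_paths_def pre_digraph.awalk_def RA_quiver_def)
    have "(cls n (path_elem (u, p, w)) \<odot>\<^bsub>arcmod n \<alpha>\<^esub> v) j =
      (\<Sum>i = 1..n. if i = u then (if j = w then prod_list (map (arrow_weight \<alpha>) p) * v u else 0) else 0)"
      unfolding arcmod_smult[OF path_elem_closed[OF that]] lin_ext_path_elem
      by (intro sum.cong refl) (auto simp: path_coeff_def)
    then show "(cls n (path_elem (u, p, w)) \<odot>\<^bsub>arcmod n \<alpha>\<^esub> v) j =
      (if j = w then prod_list (map (arrow_weight \<alpha>) p) * v u else 0)"
      using u by simp
  qed
  show "i \<in> {1..n} \<Longrightarrow> vx n i \<odot>\<^bsub>arcmod n \<alpha>\<^esub> v = (\<lambda>j. if j = i then v i else 0)"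
    "i \<in> {1..<n} \<Longrightarrow> fw n i \<odot>\<^bsub>arcmod n \<alpha>\<^esub> v = (\<lambda>j. if j = i + 1 \<and> side \<alpha> i = 1 then v i else 0)"
    "i \<in> {1..<n} \<Longrightarrow> bw n i \<odot>\<^bsub>arcmod n \<alpha>\<^esub> v = (\<lambda>j. if j = i \<and> side \<alpha> i = - 1 then v (i + 1) else 0)"
    unfolding vx_def fw_def bw_def
    by (subst *; force simp: RA_paths arrow_weight_simps)+
qed

lemma arc_supp_subset: "\<alpha> \<in> nc_arcs n \<Longrightarrow> arc_supp \<alpha> \<subseteq> {1..n}"
  by (auto simp: nc_arcs_def arc_supp_def)

lemma kQ_one_coeff:
  assumes "i \<in> {1..n}"
  shows "lin_ext (path_coeff \<alpha> i j) (\<one>\<^bsub>kQ n\<^esub> :: 'k::field kQ_elt) = (if i = j then 1 else 0)"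
proof -
  have S: "{x. \<one>\<^bsub>kQ n\<^esub> x \<noteq> (0 :: 'k)} = (\<lambda>i. (i, [] :: arrow list, i)) ` {1..n}"
  proof (rule Set.set_eqI)
    fix x :: "(nat, arrow) path"
    obtain u p v where x: "x = (u, p, v)" by (cases x) auto
    show "x \<in> {x. \<one>\<^bsub>kQ n\<^esub> x \<noteq> (0 :: 'k)} \<longleftrightarrow> x \<in> (\<lambda>i. (i, [], i)) ` {1..n}"
      by (auto simp: x path_algebra_simps(4) RA_quiver_def image_iff)
  qed
  have "lin_ext (path_coeff \<alpha> i j) (\<one>\<^bsub>kQ n\<^esub> :: 'k kQ_elt) =
    (\<Sum>m \<in> {1..n}. \<one>\<^bsub>kQ n\<^esub> (m, [], m) * path_coeff \<alpha> i j (m, [], m))"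
    unfolding lin_ext_def S by (subst sum.reindex) (auto simp: inj_on_def)
  also have "\<dots> = (\<Sum>m \<in> {1..n}. if m = i then if i = j then 1 else 0 else 0)"
    by (intro sum.cong refl) (auto simp: path_coeff_def path_algebra_simps(4) RA_quiver_def)
  finally show ?thesis using assms by simp
qed

text \<open>A scalar acts through the idempotents at 1 to \<open>n\<close> and erases coordinates
  elsewhere; vectors of the carrier have none.\<close>

lemma arcmod_scalar:
  assumes "\<alpha> \<in> nc_arcs n" and v: "v \<in> carrier (arcmod n \<alpha> :: 'k::field RA_module)"
  shows "RA_scalar n c \<odot>\<^bsub>arcmod n \<alpha>\<^esub> v = (\<lambda>j. c * v j)"
proof (rule ext)
  fix j
  have "(RA_scalar n c \<odot>\<^bsub>arcmod n \<alpha>\<^esub> v) j = (\<Sum>i = 1..n. if i = j then c * v j else 0)"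
    unfolding RA_scalar_eq arcmod_smult[OF kQ_one_closed] lin_ext_scale
    by (intro sum.cong refl) (auto simp: kQ_one_coeff)
  also have "\<dots> = c * v j"
    using v arc_supp_subset[OF assms(1)] by (auto simp: arcmod_simps)
  finally show "(RA_scalar n c \<odot>\<^bsub>arcmod n \<alpha>\<^esub> v) j = c * v j" .
qed

lemma left_module_arcmod:
  assumes \<alpha>: "\<alpha> \<in> nc_arcs n"
  shows "left_module (RA n) (arcmod n \<alpha> :: 'k::field RA_module)"
proof -
  interpret R: ring "RA n :: 'k kQ_elt set ring" by (rule RA_ring)
  interpret Q: ring "kQ n :: 'k kQ_elt ring" by (rule kQ_ring)
  let ?M = "arcmod n \<alpha> :: 'k RA_module"
  have fin: "finite {x. h x \<noteq> 0}" if "h \<in> carrier (kQ n :: 'k kQ_elt ring)" for h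
    using that by (simp add: path_algebra_simps(3))
  interpret M: abelian_group ?M
  proof (rule abelian_groupI)
    show "\<exists>w \<in> carrier ?M. w \<oplus>\<^bsub>?M\<^esub> v = \<zero>\<^bsub>?M\<^esub>" if "v \<in> carrier ?M" for v
      using that by (intro bexI[of _ "\<lambda>i. - v i"]) (auto simp: arcmod_simps)
  qed (auto simp: arcmod_simps ac_simps)
  have closed: "cls n f \<odot>\<^bsub>?M\<^esub> v \<in> carrier ?M" if f: "f \<in> carrier (kQ n)" and v: "v \<in> carrier ?M" for f v
  proof -
    have "lin_ext (path_coeff \<alpha> i j) f * v i = 0" if j: "j \<notin> arc_supp \<alpha>" for i j
    proof (cases "i \<in> arc_supp \<alpha>")
      case True
      have "path_coeff \<alpha> i j x = (0 :: 'k)" if "f x \<noteq> 0" for x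
      proof -
        have x: "x \<in> quiver_paths (RA_quiver n)" using f that by (auto simp: path_algebra_simps(3))
        obtain u p w where X: "x = (u, p, w)" by (cases x) auto
        show ?thesis using path_weight_supp[of u p w n \<alpha>] x True j by (auto simp: path_coeff_def X)
      qed
      then show ?thesis by (simp add: lin_ext_def)
    next
      case False
      then show ?thesis using v by (simp add: arcmod_simps)
    qed
    then show ?thesis by (auto simp: arcmod_simps arcmod_smult[OF f] intro!: sum.neutral)
  qed
  show ?thesis
  proof unfold_locales
    show "a \<odot>\<^bsub>?M\<^esub> v \<in> carrier ?M" if "a \<in> carrier (RA n)" "v \<in> carrier ?M" for a v
      using that closed by (auto simp: RA_carrier)
    show "(a \<oplus>\<^bsub>RA n\<^esub> b) \<odot>\<^bsub>?M\<^esub> v = a \<odot>\<^bsub>?M\<^esub> v \<oplus>\<^bsub>?M\<^esub> b \<odot>\<^bsub>?M\<^esub> v"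
      if elts: "a \<in> carrier (RA n)" "b \<in> carrier (RA n)" "v \<in> carrier ?M" for a b v
    proof -
      obtain f g where fg: "f \<in> carrier (kQ n)" "a = cls n f" "g \<in> carrier (kQ n)" "b = cls n g"
        using elts(1,2) unfolding RA_carrier by blast
      have ab: "a \<oplus>\<^bsub>RA n\<^esub> b = cls n (\<lambda>x. f x + g x)" and cl: "(\<lambda>x. f x + g x) \<in> carrier (kQ n)"
        using fg cls_add[OF fg(1,3)] Q.a_closed[OF fg(1,3)] by (simp_all add: path_algebra_simps(2))
      show ?thesis
        unfolding ab unfolding fg(2,4) arcmod_smult[OF cl] arcmod_smult[OF fg(1)] arcmod_smult[OF fg(3)]
        using fin[OF fg(1)] fin[OF fg(3)]
        by (simp add: arcmod_simps lin_ext_add distrib_right sum.distrib)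
    qed
    show "a \<odot>\<^bsub>?M\<^esub> (v \<oplus>\<^bsub>?M\<^esub> w) = a \<odot>\<^bsub>?M\<^esub> v \<oplus>\<^bsub>?M\<^esub> a \<odot>\<^bsub>?M\<^esub> w" for a v w
      by (simp add: arcmod_def distrib_left sum.distrib)
    show "(a \<otimes>\<^bsub>RA n\<^esub> b) \<odot>\<^bsub>?M\<^esub> v = a \<odot>\<^bsub>?M\<^esub> (b \<odot>\<^bsub>?M\<^esub> v)"
      if elts: "a \<in> carrier (RA n)" "b \<in> carrier (RA n)" "v \<in> carrier ?M" for a b v
    proof -
      obtain f g where fg: "f \<in> carrier (kQ n)" "a = cls n f" "g \<in> carrier (kQ n)" "b = cls n g"
        using elts(1,2) unfolding RA_carrier by blast
      have ab: "a \<otimes>\<^bsub>RA n\<^esub> b = cls n (f \<otimes>\<^bsub>kQ n\<^esub> g)"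
        unfolding fg(2,4) by (rule cls_mult[OF fg(1,3)])
      show ?thesis
        unfolding ab unfolding fg(2,4) arcmod_smult[OF Q.m_closed[OF fg(1,3)]] arcmod_smult[OF fg(1)]
          arcmod_smult[OF fg(3)] path_coeff_mult[OF fg(1,3)]
        unfolding sum_distrib_left sum_distrib_right
        by (rule ext, subst sum.swap) (simp add: ac_simps)
    qed
    show "\<one>\<^bsub>RA n\<^esub> \<odot>\<^bsub>?M\<^esub> v = v" if "v \<in> carrier ?M" for v
      using arcmod_scalar[OF \<alpha> that, of 1] by (simp add: RA_scalar_one)
  qed
qed

section \<open>Linear algebra in modules\<close>

text \<open>The ground field acts on a module only through \<open>RA_scalar\<close>; the linear
  algebra for splitting off summands is built on this action.\<close>

locale RA_mod = left_module "RA n" M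
  for n :: nat and M :: "('k::field kQ_elt set, 'v, 'z) module_scheme" (structure)
begin

abbreviation sc :: "'k \<Rightarrow> 'v \<Rightarrow> 'v" where "sc c x \<equiv> RA_scalar n c \<odot> x"

lemma smult_l_null: "x \<in> carrier M \<Longrightarrow> \<zero>\<^bsub>RA n\<^esub> \<odot> x = \<zero>"
  using smult_l_distr[of "\<zero>\<^bsub>RA n\<^esub>" "\<zero>\<^bsub>RA n\<^esub>" x] smult_closed[of "\<zero>\<^bsub>RA n\<^esub>" x]
  by (simp add: M.add.l_cancel_one' R.l_zero)

lemma smult_r_null: "r \<in> carrier (RA n) \<Longrightarrow> r \<odot> \<zero> = \<zero>"
  using smult_r_distr[of r "\<zero>" "\<zero>"] smult_closed[of r "\<zero>"] by (simp add: M.add.l_cancel_one')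

lemma smult_finsum:
  assumes "r \<in> carrier (RA n)" "finite A" "f \<in> A \<rightarrow> carrier M"
  shows "r \<odot> (\<Oplus>i \<in> A. f i) = (\<Oplus>i \<in> A. r \<odot> f i)"
  using assms(2,3)
proof (induction A rule: finite_induct)
  case empty
  then show ?case by (simp add: smult_r_null assms(1))
next
  case (insert a A)
  have f: "f \<in> A \<rightarrow> carrier M" "f a \<in> carrier M" using insert.prems by auto
  have rf: "(\<lambda>i. r \<odot> f i) \<in> A \<rightarrow> carrier M" using f(1) assms(1) by (auto intro: smult_closed)
  show ?case
    unfolding M.finsum_insert[OF insert.hyps f] M.finsum_insert[OF insert.hyps rf smult_closed[OF assms(1) f(2)]]
    using insert.IH[OF f(1)] f M.finsum_closed[OF f(1)] by (simp add: smult_r_distr assms(1))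
qed

lemma finsum_single:
  assumes "finite A" "k \<in> A" "f k \<in> carrier M" "\<And>i. i \<in> A \<Longrightarrow> i \<noteq> k \<Longrightarrow> f i = \<zero>"
  shows "(\<Oplus>i \<in> A. f i) = f k"
proof -
  have "(\<Oplus>i \<in> insert k (A - {k}). f i) = f k \<oplus> (\<Oplus>i \<in> A - {k}. f i)"
    using assms by (intro M.finsum_insert) auto
  moreover have "(\<Oplus>i \<in> A - {k}. f i) = (\<Oplus>i \<in> A - {k}. \<zero>)"
    using assms by (intro M.finsum_cong') auto
  ultimately show ?thesis using assms(2,3) by (simp add: insert_absorb)
qed

lemmas sc_closed = smult_closed[OF RA_scalar_closed]
  and sc_r_distr = smult_r_distr[OF RA_scalar_closed]
  and sc_r_zero = smult_r_null[OF RA_scalar_closed]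

lemma sc_l_distr: "x \<in> carrier M \<Longrightarrow> sc (c + d) x = sc c x \<oplus> sc d x"
  by (simp add: RA_scalar_add[symmetric] smult_l_distr RA_scalar_closed)

lemma sc_sc: "x \<in> carrier M \<Longrightarrow> sc c (sc d x) = sc (c * d) x"
  by (simp add: RA_scalar_mult[symmetric] smult_assoc RA_scalar_closed)

lemma sc_one: "x \<in> carrier M \<Longrightarrow> sc 1 x = x"
  by (simp add: RA_scalar_one smult_one)

lemma sc_zero: "x \<in> carrier M \<Longrightarrow> sc 0 x = \<zero>"
  by (simp add: RA_scalar_zero smult_l_null)

lemma sc_minus: "x \<in> carrier M \<Longrightarrow> sc (- 1) x = \<ominus> x"
  using sc_l_distr[of x "- 1" 1] by (intro M.minus_equality[symmetric]) (auto simp: sc_zero sc_one sc_closed)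

lemma sc_comm: "x \<in> carrier M \<Longrightarrow> r \<in> carrier (RA n) \<Longrightarrow> r \<odot> sc c x = sc c (r \<odot> x)"
  using RA_scalar_central[of r n c] by (metis RA_scalar_closed smult_assoc)

section \<open>Subspaces and linear functionals\<close>

definition subsp :: "'v set \<Rightarrow> bool" where
  "subsp W \<longleftrightarrow> W \<subseteq> carrier M \<and> \<zero> \<in> W \<and> (\<forall>x \<in> W. \<forall>y \<in> W. x \<oplus> y \<in> W) \<and> (\<forall>c. \<forall>x \<in> W. sc c x \<in> W)"

lemma subspD:
  assumes "subsp W"
  shows "x \<in> W \<Longrightarrow> x \<in> carrier M" "\<zero> \<in> W" "x \<in> W \<Longrightarrow> y \<in> W \<Longrightarrow> x \<oplus> y \<in> W" "x \<in> W \<Longrightarrow> sc c x \<in> W"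
  using assms by (auto simp: subsp_def)

lemma subsp_diff:
  assumes "subsp W" "x \<in> W" "y \<in> W"
  shows "x \<ominus> y \<in> W"
proof -
  have "x \<oplus> sc (- 1) y \<in> W" using assms by (intro subspD[OF assms(1)])
  then show ?thesis using subspD(1)[OF assms(1,3)] by (simp add: sc_minus M.minus_eq)
qed

definition linfun :: "('v \<Rightarrow> 'k) \<Rightarrow> bool" where
  "linfun \<psi> \<longleftrightarrow> (\<forall>x \<in> carrier M. \<forall>y \<in> carrier M. \<psi> (x \<oplus> y) = \<psi> x + \<psi> y) \<and>
    (\<forall>c. \<forall>x \<in> carrier M. \<psi> (sc c x) = c * \<psi> x)"

lemma linfun_zero: "linfun \<psi> \<Longrightarrow> \<psi> \<zero> = 0"
  using sc_r_zero[of 0] by (metis M.zero_closed linfun_def mult_zero_left)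

lemma subsp_sum:
  assumes "subsp U" "subsp W"
  shows "subsp {u \<oplus> w | u w. u \<in> U \<and> w \<in> W}"
  unfolding subsp_def
proof (intro conjI ballI allI)
  note U = subspD[OF assms(1)] and W = subspD[OF assms(2)]
  show "{u \<oplus> w | u w. u \<in> U \<and> w \<in> W} \<subseteq> carrier M" using U W by auto
  show "\<zero> \<in> {u \<oplus> w | u w. u \<in> U \<and> w \<in> W}"
    using U(2) W(2) M.l_zero[of "\<zero>"] by (metis (mono_tags, lifting) M.zero_closed mem_Collect_eq)
  show "a \<oplus> b \<in> {u \<oplus> w | u w. u \<in> U \<and> w \<in> W}"
    if ab: "a \<in> {u \<oplus> w | u w. u \<in> U \<and> w \<in> W}" "b \<in> {u \<oplus> w | u w. u \<in> U \<and> w \<in> W}" for a b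
  proof -
    obtain u w u' w' where *: "a = u \<oplus> w" "b = u' \<oplus> w'" "u \<in> U" "w \<in> W" "u' \<in> U" "w' \<in> W" using ab by auto
    have "a \<oplus> b = (u \<oplus> u') \<oplus> (w \<oplus> w')" using * U(1) W(1) by (simp add: M.a_ac)
    then show ?thesis using * U(3) W(3) by blast
  qed
  show "sc c a \<in> {u \<oplus> w | u w. u \<in> U \<and> w \<in> W}" if a: "a \<in> {u \<oplus> w | u w. u \<in> U \<and> w \<in> W}" for c a
  proof -
    obtain u w where *: "a = u \<oplus> w" "u \<in> U" "w \<in> W" using a by auto
    have "sc c a = sc c u \<oplus> sc c w" using * U(1) W(1) by (simp add: sc_r_distr)
    then show ?thesis using * U(4) W(4) by blast
  qed
qed

lemma subsp_extend:
  assumes "subsp K" "x \<in> carrier M"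
  shows "subsp {k \<oplus> sc c x | k c. k \<in> K}"
proof -
  have "sc a x \<oplus> sc b x \<in> range (\<lambda>c. sc c x)" "sc a (sc b x) \<in> range (\<lambda>c. sc c x)" for a b
    using assms(2) by (simp_all add: sc_l_distr[symmetric] sc_sc)
  moreover have "\<zero> \<in> range (\<lambda>c. sc c x)" using sc_zero[OF assms(2)] by (metis rangeI)
  ultimately have "subsp (range (\<lambda>c. sc c x))" using assms(2) by (auto simp: subsp_def sc_closed)
  moreover have "{k \<oplus> sc c x | k c. k \<in> K} = {k \<oplus> w | k w. k \<in> K \<and> w \<in> range (\<lambda>c. sc c x)}" by blast
  ultimately show ?thesis using subsp_sum[OF assms(1)] by simp
qed

text \<open>Zorn's lemma. A maximal subspace avoiding \<open>y\<close> is a hyperplane; it becomes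
  the kernel of the functional in \<open>ex_linfun\<close>.\<close>

lemma ex_maximal_avoiding:
  assumes "subsp W" "y \<notin> W"
  obtains K where "subsp K" "W \<subseteq> K" "y \<notin> K"
    "\<And>K'. subsp K' \<Longrightarrow> K \<subseteq> K' \<Longrightarrow> y \<notin> K' \<Longrightarrow> K' = K"
proof -
  let ?A = "{K. subsp K \<and> W \<subseteq> K \<and> y \<notin> K}"
  have "\<exists>K \<in> ?A. \<forall>X \<in> ?A. K \<subseteq> X \<longrightarrow> X = K"
  proof (rule subset_Zorn_nonempty)
    show "?A \<noteq> {}" using assms by auto
    fix C assume ne: "C \<noteq> {}" and C: "subset.chain ?A C"
    have sub: "subsp X" "W \<subseteq> X" "y \<notin> X" if "X \<in> C" for X
      using C that by (auto simp: subset.chain_def)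
    have "subsp (\<Union>C)"
      unfolding subsp_def
    proof (intro conjI ballI allI)
      show "\<Union>C \<subseteq> carrier M" using subspD(1)[OF sub(1)] by blast
      show "\<zero> \<in> \<Union>C" using ne subspD(2)[OF sub(1)] by blast
      show "u \<oplus> v \<in> \<Union>C" if uv: "u \<in> \<Union>C" "v \<in> \<Union>C" for u v
      proof -
        obtain X Y where XY: "X \<in> C" "u \<in> X" "Y \<in> C" "v \<in> Y" using uv by blast
        have "X \<subseteq> Y \<or> Y \<subseteq> X" using C XY by (auto simp: subset.chain_def)
        then show ?thesis
          using subspD(3)[OF sub(1)[OF XY(1)], of u v] subspD(3)[OF sub(1)[OF XY(3)], of u v] XY by blast
      qed
      show "sc c u \<in> \<Union>C" if "u \<in> \<Union>C" for c u using that subspD(4)[OF sub(1)] by blast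
    qed
    moreover have "W \<subseteq> \<Union>C" "y \<notin> \<Union>C" using ne sub(2,3) by blast+
    ultimately show "\<Union>C \<in> ?A" by simp
  qed
  then obtain K where "K \<in> ?A" "\<forall>X \<in> ?A. K \<subseteq> X \<longrightarrow> X = K" by (rule bexE)
  then show ?thesis by (intro that[of K]) auto
qed

text \<open>If \<open>K\<close> is maximal among the subspaces avoiding \<open>y\<close>, each
  vector is uniquely \<open>k \<oplus> sc c y\<close> with \<open>k\<close> in \<open>K\<close>; the
  coefficient \<open>c\<close> is the functional.\<close>

lemma ex_linfun:
  assumes W: "subsp W" and y: "y \<in> carrier M" "y \<notin> W"
  obtains \<psi> where "linfun \<psi>" "\<And>w. w \<in> W \<Longrightarrow> \<psi> w = 0" "\<psi> y = 1"
proof -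
  obtain K where K: "subsp K" "W \<subseteq> K" "y \<notin> K"
    and max: "\<And>K'. subsp K' \<Longrightarrow> K \<subseteq> K' \<Longrightarrow> y \<notin> K' \<Longrightarrow> K' = K"
    using ex_maximal_avoiding[OF W y(2)] by metis
  note KD = subspD[OF K(1)]
  let ?r = "\<lambda>x c. \<exists>k \<in> K. x = k \<oplus> sc c y"
  have ex: "\<exists>c. ?r x c" if x: "x \<in> carrier M" for x
  proof (cases "x \<in> K")
    case True
    then show ?thesis using x y sc_zero[of y] by (intro exI[of _ 0] bexI[of _ x]) auto
  next
    case False
    \<comment> \<open>By maximality the span of \<open>K\<close> and \<open>x\<close> contains
      \<open>y\<close>; the coefficient of \<open>x\<close> there is nonzero, so the equation can be
      solved for \<open>x\<close>.\<close>
    let ?K = "{k \<oplus> sc c x | k c. k \<in> K}"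
    have "K \<subseteq> ?K"
    proof
      fix k assume k: "k \<in> K"
      then have "k = k \<oplus> sc 0 x" using x KD(1) by (simp add: sc_zero)
      then show "k \<in> ?K" using k by blast
    qed
    moreover have "x \<in> ?K"
      using x KD(2) sc_one[of x] by (auto intro!: exI[of _ "\<zero>"] exI[of _ 1])
    ultimately have "y \<in> ?K" using max[OF subsp_extend[OF K(1) x]] False by blast
    then obtain k c where kc: "y = k \<oplus> sc c x" "k \<in> K" by auto
    have k: "k \<in> carrier M" using KD(1) kc by auto
    have "c \<noteq> 0" using kc K(3) x k by (auto simp: sc_zero)
    then have "sc (inverse c) y = sc (inverse c) k \<oplus> x"
      using x k by (simp add: kc(1) sc_r_distr sc_closed sc_sc sc_one)
    then have "x = sc (- inverse c) k \<oplus> sc (inverse c) y"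
    proof -
      have "sc (- inverse c) k = \<ominus> sc (inverse c) k"
        using sc_sc[OF k, of "- 1" "inverse c"] k by (simp add: sc_minus sc_closed)
      then show ?thesis
        using \<open>sc (inverse c) y = _\<close> x k by (simp add: sc_closed M.r_neg1)
    qed
    then show ?thesis using KD(4)[OF kc(2)] by blast
  qed
  \<comment> \<open>Two different coefficients would put a nonzero multiple of \<open>y\<close> into
    \<open>K\<close>.\<close>
  have uniq: "c = d" if cd: "?r x c" "?r x d" for x c d
  proof (rule ccontr)
    assume ne: "c \<noteq> d"
    obtain k k' where *: "k \<in> K" "k' \<in> K" "k \<oplus> sc c y = k' \<oplus> sc d y" using cd by blast
    have cl: "k \<in> carrier M" "k' \<in> carrier M" using KD(1) * by auto
    have "sc (c - d) y = sc c y \<ominus> sc d y"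
      using sc_l_distr[OF y(1), of c "- d"] sc_sc[OF y(1), of "- 1" d] y(1)
      by (simp add: sc_minus sc_closed M.minus_eq)
    also have "\<dots> = k' \<ominus> k"
    proof -
      have "sc c y = \<ominus> k \<oplus> (k' \<oplus> sc d y)"
        using *(3)[symmetric] cl y(1) by (simp add: sc_closed M.r_neg1)
      then show ?thesis using cl y(1) by (simp add: sc_closed M.minus_eq M.a_ac M.r_neg)
    qed
    also have "\<dots> \<in> K" using * by (intro subsp_diff[OF K(1)])
    finally have "sc (inverse (c - d)) (sc (c - d) y) \<in> K" by (rule KD(4))
    then show False using ne K(3) y(1) by (simp add: sc_sc sc_one)
  qed
  define \<psi> where "\<psi> x = (THE c. ?r x c)" for x
  have val: "\<psi> x = c" if "?r x c" for x c unfolding \<psi>_def using that uniq by blast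
  have "linfun \<psi>"
    unfolding linfun_def
  proof (intro conjI ballI allI)
    fix u v assume uv: "u \<in> carrier M" "v \<in> carrier M"
    obtain c d where cd: "?r u c" "?r v d" using ex[OF uv(1)] ex[OF uv(2)] by blast
    then obtain k k' where *: "k \<in> K" "k' \<in> K" "u = k \<oplus> sc c y" "v = k' \<oplus> sc d y" by blast
    have "u \<oplus> v = (k \<oplus> k') \<oplus> sc (c + d) y"
      using KD(1)[OF *(1)] KD(1)[OF *(2)] y(1) by (simp add: * sc_l_distr sc_closed M.a_ac)
    then have "?r (u \<oplus> v) (c + d)" using KD(3)[OF *(1,2)] by blast
    then show "\<psi> (u \<oplus> v) = \<psi> u + \<psi> v" using val cd by metis
  next
    fix c u assume u: "u \<in> carrier M"
    obtain d where d: "?r u d" using ex[OF u] by blast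
    then obtain k where *: "k \<in> K" "u = k \<oplus> sc d y" by blast
    have "sc c u = sc c k \<oplus> sc (c * d) y"
      using KD(1)[OF *(1)] y(1) by (simp add: * sc_r_distr sc_closed sc_sc)
    then have "?r (sc c u) (c * d)" using KD(4)[OF *(1)] by blast
    then show "\<psi> (sc c u) = c * \<psi> u" using val d by metis
  qed
  moreover have "\<psi> w = 0" if "w \<in> W" for w
    using that K(2) KD(1)[of w] y(1) by (intro val bexI[of _ w]) (auto simp: sc_zero)
  moreover have "\<psi> y = 1"
    using KD(2) y(1) by (intro val bexI[of _ "\<zero>"]) (auto simp: sc_one)
  ultimately show ?thesis by (rule that)
qed

section \<open>Spans and Steinitz exchange\<close>

definition kspan :: "'v set \<Rightarrow> 'v set" where
  "kspan S = \<Inter>{W. subsp W \<and> S \<subseteq> W}"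

lemma kspan_minimal: "subsp W \<Longrightarrow> S \<subseteq> W \<Longrightarrow> kspan S \<subseteq> W"
  unfolding kspan_def by blast

lemma kspan_base: "x \<in> S \<Longrightarrow> x \<in> kspan S"
  unfolding kspan_def by blast

lemma subsp_kspan:
  assumes "S \<subseteq> carrier M"
  shows "subsp (kspan S)"
proof -
  have "subsp (carrier M)" by (simp add: subsp_def sc_closed)
  then show ?thesis using assms unfolding kspan_def subsp_def by (intro conjI) blast+
qed

lemmas kspanD = subspD[OF subsp_kspan]

lemma kspan_insert:
  assumes "S \<subseteq> carrier M" "b \<in> carrier M" "x \<in> kspan (insert b S)"
  obtains z c where "z \<in> kspan S" "x = z \<oplus> sc c b"
proof -
  let ?W = "{z \<oplus> sc c b | z c. z \<in> kspan S}"
  have "insert b S \<subseteq> ?W"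
  proof
    fix y assume "y \<in> insert b S"
    then consider "y = b" | "y \<in> S" by blast
    then show "y \<in> ?W"
    proof cases
      case 1
      then have "y = \<zero> \<oplus> sc 1 b" using assms(2) by (simp add: sc_one)
      then show ?thesis using kspanD(2)[OF assms(1)] by blast
    next
      case 2
      then have "y = y \<oplus> sc 0 b" using assms(1,2) by (auto simp: sc_zero)
      then show ?thesis using kspan_base[OF 2] by blast
    qed
  qed
  then have "kspan (insert b S) \<subseteq> ?W"
    by (intro kspan_minimal subsp_extend subsp_kspan assms)
  then show ?thesis using assms(3) that by blast
qed

text \<open>Add the elements of \<open>B\<close> one at a time: the one at which \<open>y\<close>
  enters the span occurs in \<open>y\<close> with nonzero coefficient and can be solved for. This
  makes the size of a spanning set drop when a summand is split off.\<close>

lemma kspan_exchange: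
  assumes B: "finite B" "B \<subseteq> carrier M" and y: "y \<in> kspan B" "y \<noteq> \<zero>"
  obtains b where "b \<in> B" "b \<in> kspan (insert y (B - {b}))"
proof -
  have yc: "y \<in> carrier M" using kspanD(1)[OF B(2) y(1)] .
  have emp: "kspan {} \<subseteq> {\<zero>}"
    by (rule kspan_minimal) (auto simp: subsp_def sc_r_zero)
  have "\<exists>C b. C \<subseteq> B \<and> b \<in> B - C \<and> y \<notin> kspan C \<and> y \<in> kspan (insert b C)"
    using B y(1)
  proof (induction B rule: finite_induct)
    case empty
    then show ?case using emp y(2) by blast
  next
    case (insert b C)
    show ?case
    proof (cases "y \<in> kspan C")
      case True
      then obtain D b' where "D \<subseteq> C" "b' \<in> C - D" "y \<notin> kspan D" "y \<in> kspan (insert b' D)"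
        using insert by auto
      then show ?thesis by blast
    next
      case False
      then show ?thesis using insert by blast
    qed
  qed
  then obtain C b where C: "C \<subseteq> B" "b \<in> B - C" "y \<notin> kspan C" "y \<in> kspan (insert b C)" by blast
  have cl: "C \<subseteq> carrier M" "b \<in> carrier M" using C B by auto
  obtain z c where z: "z \<in> kspan C" "y = z \<oplus> sc c b" using kspan_insert[OF cl C(4)] .
  have zc: "z \<in> carrier M" using kspanD(1)[OF cl(1) z(1)] .
  have c: "c \<noteq> 0" using z C(3) cl zc by (auto simp: sc_zero)
  let ?S = "insert y (B - {b})"
  have S: "?S \<subseteq> carrier M" using yc B(2) by auto
  note sub = subspD[OF subsp_kspan[OF S]]
  have "kspan C \<subseteq> kspan ?S"
    using C by (intro kspan_minimal subsp_kspan S subsetI kspan_base) auto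
  then have "z \<in> kspan ?S" using z(1) by blast
  then have "y \<ominus> z \<in> kspan ?S"
    using kspan_base by (intro subsp_diff[OF subsp_kspan[OF S]]) auto
  moreover have "y \<ominus> z = sc c b"
    using zc cl by (simp add: z(2) sc_closed M.minus_eq M.a_ac M.r_neg1 M.r_neg2)
  ultimately have "sc (inverse c) (sc c b) \<in> kspan ?S" using sub(4) by simp
  then have "b \<in> kspan ?S" using c cl by (simp add: sc_sc sc_one)
  then show ?thesis using that C(2) by blast
qed

text \<open>Trades the coefficient sums of \<open>finite_dim\<close> for spans, the form in which
  exchange and images are handled.\<close>

lemma finite_dim_kspan:
  "finite_dim n M \<longleftrightarrow> (\<exists>B. finite B \<and> B \<subseteq> carrier M \<and> carrier M \<subseteq> kspan B)"
proof
  assume "finite_dim n M"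
  then obtain B where B: "finite B" "B \<subseteq> carrier M"
    and span: "\<And>x. x \<in> carrier M \<Longrightarrow> \<exists>c :: 'v \<Rightarrow> 'k. x = (\<Oplus>b \<in> B. sc (c b) b)"
    unfolding finite_dim_def by blast
  have "(\<Oplus>b \<in> C. sc (c b) b) \<in> kspan C" if "finite C" "C \<subseteq> carrier M" for C and c :: "'v \<Rightarrow> 'k"
    using that
  proof (induction C rule: finite_induct)
    case empty
    then show ?case by (simp add: kspanD(2))
  next
    case (insert b C)
    have bC: "insert b C \<subseteq> carrier M" using insert by auto
    have "kspan C \<subseteq> kspan (insert b C)"
      using insert by (intro kspan_minimal subsp_kspan subsetI kspan_base) auto
    then have IH: "(\<Oplus>b \<in> C. sc (c b) b) \<in> kspan (insert b C)" using insert by auto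
    have "(\<Oplus>b \<in> insert b C. sc (c b) b) = sc (c b) b \<oplus> (\<Oplus>b \<in> C. sc (c b) b)"
      using insert by (intro M.finsum_insert) (auto intro!: sc_closed)
    then show ?case using kspanD(3)[OF bC kspanD(4)[OF bC kspan_base[OF insertI1]] IH] by simp
  qed
  note comb = this
  have "carrier M \<subseteq> kspan B"
  proof
    fix x assume "x \<in> carrier M"
    then obtain c :: "'v \<Rightarrow> 'k" where "x = (\<Oplus>b \<in> B. sc (c b) b)" using span by blast
    then show "x \<in> kspan B" using comb[OF B, of c] by simp
  qed
  then show "\<exists>B. finite B \<and> B \<subseteq> carrier M \<and> carrier M \<subseteq> kspan B" using B by blast
next
  assume "\<exists>B. finite B \<and> B \<subseteq> carrier M \<and> carrier M \<subseteq> kspan B"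
  then obtain B where B: "finite B" "B \<subseteq> carrier M" "carrier M \<subseteq> kspan B" by blast
  have fc: "(\<lambda>b. sc (c b) b) \<in> B \<rightarrow> carrier M" for c :: "'v \<Rightarrow> 'k"
    using B(2) by (auto intro!: sc_closed)
  let ?W = "range (\<lambda>c :: 'v \<Rightarrow> 'k. \<Oplus>b \<in> B. sc (c b) b)"
  have "(\<Oplus>b \<in> B. sc (c b) b) \<oplus> (\<Oplus>b \<in> B. sc (d b) b) = (\<Oplus>b \<in> B. sc (c b + d b) b)" for c d :: "'v \<Rightarrow> 'k"
    unfolding M.finsum_addf[OF fc fc, symmetric]
    using B(2) by (intro M.finsum_cong') (auto simp: sc_l_distr subset_iff intro!: sc_closed)
  moreover have "sc a (\<Oplus>b \<in> B. sc (c b) b) = (\<Oplus>b \<in> B. sc (a * c b) b)" for a and c :: "'v \<Rightarrow> 'k"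
    unfolding smult_finsum[OF RA_scalar_closed B(1) fc]
    using B(2) by (intro M.finsum_cong') (auto simp: sc_sc subset_iff intro!: sc_closed)
  moreover have "\<zero> = (\<Oplus>b \<in> B. sc 0 b)"
    using M.finsum_cong'[of B B "\<lambda>_. \<zero>" "\<lambda>b. sc 0 b"] B(2) by (auto simp: sc_zero subset_iff)
  ultimately have "subsp ?W"
    unfolding subsp_def using M.finsum_closed[OF fc] by (auto intro: range_eqI)
  moreover have "x \<in> ?W" if x: "x \<in> B" for x
  proof
    have "(\<Oplus>b \<in> B. sc (if b = x then 1 else 0) b) = sc (if x = x then 1 else 0) x"
      using x B by (intro finsum_single) (auto simp: sc_zero subset_iff intro!: sc_closed)
    then show "x = (\<Oplus>b \<in> B. sc (if b = x then 1 else 0) b)" using x B(2) by (auto simp: sc_one)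
  qed simp
  ultimately have "kspan B \<subseteq> ?W" by (intro kspan_minimal) auto
  then have "\<exists>c :: 'v \<Rightarrow> 'k. x = (\<Oplus>b \<in> B. sc (c b) b)" if "x \<in> carrier M" for x
    using B(3) that by blast
  then show "finite_dim n M" using B unfolding finite_dim_def by blast
qed

end

lemma fd_modules_iff:
  "M \<in> fd_modules n \<longleftrightarrow> RA_mod n M \<and> (\<exists>B. finite B \<and> B \<subseteq> carrier M \<and> carrier M \<subseteq> RA_mod.kspan n M B)"
  using RA_mod.finite_dim_kspan[of n M] by (auto simp: fd_modules_def RA_mod_def)

lemma kspan_hom:
  assumes h: "h \<in> left_module_hom (RA n) M N" and "RA_mod n M" "RA_mod n N" and S: "S \<subseteq> carrier M"
    and x: "x \<in> RA_mod.kspan n M S"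
  shows "h x \<in> RA_mod.kspan n N (h ` S)"
proof -
  interpret M: RA_mod n M by fact
  interpret N: RA_mod n N by fact
  have hS: "h ` S \<subseteq> carrier N" using h S by (auto simp: left_module_hom_def)
  note K = N.kspanD[OF hS]
  have "h (RA_scalar n 0 \<odot>\<^bsub>M\<^esub> \<zero>\<^bsub>M\<^esub>) = RA_scalar n 0 \<odot>\<^bsub>N\<^esub> h \<zero>\<^bsub>M\<^esub>" "h \<zero>\<^bsub>M\<^esub> \<in> carrier N"
    using h by (auto simp: left_module_hom_def RA_scalar_closed)
  then have "M.subsp {x \<in> carrier M. h x \<in> N.kspan (h ` S)}"
    using h K(2-4) unfolding M.subsp_def left_module_hom_def
    by (auto simp: M.sc_zero N.sc_zero M.sc_closed RA_scalar_closed)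
  moreover have "S \<subseteq> {x \<in> carrier M. h x \<in> N.kspan (h ` S)}" using S N.kspan_base by blast
  ultimately show ?thesis using M.kspan_minimal x by blast
qed

section \<open>Arc modules as direct summands\<close>

context RA_mod
begin

abbreviation E :: "nat \<Rightarrow> 'v \<Rightarrow> 'v" where "E i x \<equiv> vx n i \<odot> x"
abbreviation F :: "nat \<Rightarrow> 'v \<Rightarrow> 'v" where "F i x \<equiv> fw n i \<odot> x"
abbreviation G :: "nat \<Rightarrow> 'v \<Rightarrow> 'v" where "G i x \<equiv> bw n i \<odot> x"

text \<open>The vertex space $e_i M$ of the quiver representation given by the module.\<close>

definition V :: "nat \<Rightarrow> 'v set" where
  "V i = {x \<in> carrier M. E i x = x}"

lemma smult_minus: "r \<in> carrier (RA n) \<Longrightarrow> x \<in> carrier M \<Longrightarrow> r \<odot> (\<ominus> x) = \<ominus> (r \<odot> x)"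
  by (metis sc_minus sc_comm smult_closed)

lemma E_E: "i \<in> {1..n} \<Longrightarrow> j \<in> {1..n} \<Longrightarrow> x \<in> carrier M \<Longrightarrow> E i (E j x) = (if i = j then E i x else \<zero>)"
  using RA_relations(1)[of i n j] by (metis gen_closed(1) smult_assoc smult_l_null)

lemma F_E: "i \<in> {1..<n} \<Longrightarrow> j \<in> {1..n} \<Longrightarrow> x \<in> carrier M \<Longrightarrow> F i (E j x) = (if j = i then F i x else \<zero>)"
  using RA_relations(2)[of i n j] by (metis gen_closed(1,2) smult_assoc smult_l_null)

lemma E_F: "i \<in> {1..<n} \<Longrightarrow> j \<in> {1..n} \<Longrightarrow> x \<in> carrier M \<Longrightarrow> E j (F i x) = (if j = i + 1 then F i x else \<zero>)"
  using RA_relations(3)[of i n j] by (metis gen_closed(1,2) smult_assoc smult_l_null)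

lemma G_E: "i \<in> {1..<n} \<Longrightarrow> j \<in> {1..n} \<Longrightarrow> x \<in> carrier M \<Longrightarrow> G i (E j x) = (if j = i + 1 then G i x else \<zero>)"
  using RA_relations(4)[of i n j] by (metis gen_closed(1,3) smult_assoc smult_l_null)

lemma E_G: "i \<in> {1..<n} \<Longrightarrow> j \<in> {1..n} \<Longrightarrow> x \<in> carrier M \<Longrightarrow> E j (G i x) = (if j = i then G i x else \<zero>)"
  using RA_relations(5)[of i n j] by (metis gen_closed(1,3) smult_assoc smult_l_null)

lemma G_F: "i \<in> {1..<n} \<Longrightarrow> x \<in> carrier M \<Longrightarrow> G i (F i x) = \<zero>"
  using RA_two_cycles(1)[of i n] by (metis gen_closed(2,3) smult_assoc smult_l_null)

lemma F_G: "i \<in> {1..<n} \<Longrightarrow> x \<in> carrier M \<Longrightarrow> F i (G i x) = \<zero>"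
  using RA_two_cycles(2)[of i n] by (metis gen_closed(2,3) smult_assoc smult_l_null)

lemmas E_closed = smult_closed[OF gen_closed(1)]
  and F_closed = smult_closed[OF gen_closed(2)]
  and G_closed = smult_closed[OF gen_closed(3)]

lemma V_closed: "x \<in> V i \<Longrightarrow> x \<in> carrier M"
  by (simp add: V_def)

lemma E_V: "i \<in> {1..n} \<Longrightarrow> x \<in> carrier M \<Longrightarrow> E i x \<in> V i"
  by (simp add: V_def E_closed E_E)

lemma F_V: "i \<in> {1..<n} \<Longrightarrow> x \<in> carrier M \<Longrightarrow> F i x \<in> V (i + 1)"
  by (simp add: V_def F_closed E_F)

lemma G_V: "i \<in> {1..<n} \<Longrightarrow> x \<in> carrier M \<Longrightarrow> G i x \<in> V i"
  by (simp add: V_def G_closed E_G)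

lemma subsp_V: "i \<in> {1..n} \<Longrightarrow> subsp (V i)"
  unfolding subsp_def V_def
  by (auto simp: gen_closed smult_r_null smult_r_distr sc_closed sc_comm)

lemma gens_on_V:
  assumes "x \<in> V j" "j \<in> {1..n}"
  shows "i \<in> {1..n} \<Longrightarrow> E i x = (if i = j then x else \<zero>)"
    and "i \<in> {1..<n} \<Longrightarrow> i \<noteq> j \<Longrightarrow> F i x = \<zero>"
    and "i \<in> {1..<n} \<Longrightarrow> i + 1 \<noteq> j \<Longrightarrow> G i x = \<zero>"
  using assms E_E[of i j x] F_E[of i j x] G_E[of i j x] by (auto simp: V_def)

text \<open>
  The vectors \<open>y i\<close> are the images of the basis vectors under a map from the module of \<open>\<alpha>\<close> to \<open>M\<close>, and
  the functionals \<open>\<psi> i\<close> are the coordinates of a map back.  All conditions are imposed except those at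
  the arrows below the bottom end, so that strings can be extended downwards.
\<close>

definition arc_string :: "nc_arc \<Rightarrow> (nat \<Rightarrow> 'v) \<Rightarrow> (nat \<Rightarrow> 'v \<Rightarrow> 'k) \<Rightarrow> bool" where
  "arc_string \<alpha> y \<psi> \<longleftrightarrow>
    (\<forall>i \<in> arc_supp \<alpha>. y i \<in> V i \<and> linfun (\<psi> i)) \<and>
    (\<forall>i. side \<alpha> i = 1 \<longrightarrow> F i (y i) = y (i + 1) \<and> G i (y (i + 1)) = \<zero> \<and>
      (\<forall>v \<in> V i. \<psi> (i + 1) (F i v) = \<psi> i v) \<and> (\<forall>w \<in> V (i + 1). \<psi> i (G i w) = 0)) \<and>
    (\<forall>i. side \<alpha> i = - 1 \<longrightarrow> G i (y (i + 1)) = y i \<and> F i (y i) = \<zero> \<and>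
      (\<forall>w \<in> V (i + 1). \<psi> i (G i w) = \<psi> (i + 1) w) \<and> (\<forall>v \<in> V i. \<psi> (i + 1) (F i v) = 0)) \<and>
    (top_end \<alpha> < n \<longrightarrow> F (top_end \<alpha>) (y (top_end \<alpha>)) = \<zero> \<and>
      (\<forall>w \<in> V (top_end \<alpha> + 1). \<psi> (top_end \<alpha>) (G (top_end \<alpha>) w) = 0))"

text \<open>Prepends vertex \<open>p\<close>; \<open>s\<close> tells whether $a_p$ or $a_p^*$ acts.
  That the opposite arrow kills the basis vector follows from the two-cycle relations
  (\<open>GF\<close>, \<open>FG\<close>); the corresponding vanishing for the functionals is
  assumed.\<close>

lemma arc_string_cons:
  assumes \<beta>: "\<beta> \<in> nc_arcs n" "bot_end \<beta> = p" "arc_string \<beta> y \<psi>" and p: "p \<in> {1..<n}"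
    and z: "z \<in> V p" and \<chi>: "linfun \<chi>"
    and s: "s \<Longrightarrow> F p z = y (p + 1) \<and> (\<forall>v \<in> V p. \<psi> (p + 1) (F p v) = \<chi> v) \<and> (\<forall>w \<in> V (p + 1). \<chi> (G p w) = 0)"
    and ns: "\<not> s \<Longrightarrow> G p (y (p + 1)) = z \<and> (\<forall>w \<in> V (p + 1). \<chi> (G p w) = \<psi> (p + 1) w) \<and>
      (\<forall>v \<in> V p. \<psi> (p + 1) (F p v) = 0)"
    and \<alpha>: "\<alpha> = \<lparr>bot_end = p - 1, top_end = top_end \<beta>, right_of = right_of \<beta> \<union> (if s then {p} else {})\<rparr>"
  shows "\<alpha> \<in> nc_arcs n" "arc_string \<alpha> (y(p := z)) (\<psi>(p := \<chi>))"
proof -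
  show "\<alpha> \<in> nc_arcs n" using \<beta>(1,2) p by (fastforce simp: nc_arcs_def \<alpha>)
  have top: "p < top_end \<beta>" using \<beta>(1,2) by (simp add: nc_arcs_def)
  have notin: "p \<notin> right_of \<beta>" using \<beta>(1,2) by (auto simp: nc_arcs_def)
  have supp: "arc_supp \<alpha> = insert p (arc_supp \<beta>)" "p \<notin> arc_supp \<beta>" "p + 1 \<in> arc_supp \<beta>"
    using p top \<beta>(2) by (auto simp: arc_supp_def \<alpha>)
  have side: "side \<alpha> i = (if i = p then if s then 1 else - 1 else side \<beta> i)" for i
    using p top \<beta>(2) notin by (auto simp: side_def \<alpha>)
  have side_p: "side \<beta> i \<noteq> 0 \<Longrightarrow> p < i" for i using \<beta>(2) by (auto simp: side_def split: if_splits)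
  have y: "y (p + 1) \<in> carrier M" using \<beta>(3) supp(3) V_closed by (auto simp: arc_string_def)
  have GF: "s \<Longrightarrow> G p (y (p + 1)) = \<zero>" using s G_F[OF p, of z] V_closed[OF z] by auto
  have FG: "\<not> s \<Longrightarrow> F p z = \<zero>" using ns F_G[OF p y] by auto
  have \<alpha>top: "top_end \<alpha> = top_end \<beta>" by (simp add: \<alpha>)
  note B = \<beta>(3)[unfolded arc_string_def]
  show "arc_string \<alpha> (y(p := z)) (\<psi>(p := \<chi>))"
    unfolding arc_string_def \<alpha>top
  proof (intro conjI allI impI ballI)
    fix i assume "i \<in> arc_supp \<alpha>"
    then show "(y(p := z)) i \<in> V i" "linfun ((\<psi>(p := \<chi>)) i)" using supp z \<chi> B by auto
  next
    fix i assume i: "side \<alpha> i = 1"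
    show "F i ((y(p := z)) i) = (y(p := z)) (i + 1)" "G i ((y(p := z)) (i + 1)) = \<zero>"
      using i s GF B side_p[of i] by (auto simp: side split: if_splits)
    show "(\<psi>(p := \<chi>)) (i + 1) (F i v) = (\<psi>(p := \<chi>)) i v" if "v \<in> V i" for v
      using i s B side_p[of i] that by (auto simp: side split: if_splits)
    show "(\<psi>(p := \<chi>)) i (G i w) = 0" if "w \<in> V (i + 1)" for w
      using i s B side_p[of i] that by (auto simp: side split: if_splits)
  next
    fix i assume i: "side \<alpha> i = - 1"
    show "G i ((y(p := z)) (i + 1)) = (y(p := z)) i" "F i ((y(p := z)) i) = \<zero>"
      using i ns FG B side_p[of i] by (auto simp: side split: if_splits)
    show "(\<psi>(p := \<chi>)) i (G i w) = (\<psi>(p := \<chi>)) (i + 1) w" if "w \<in> V (i + 1)" for w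
      using i ns B side_p[of i] that by (auto simp: side split: if_splits)
    show "(\<psi>(p := \<chi>)) (i + 1) (F i v) = 0" if "v \<in> V i" for v
      using i ns B side_p[of i] that by (auto simp: side split: if_splits)
  next
    assume "top_end \<beta> < n"
    then show "F (top_end \<beta>) ((y(p := z)) (top_end \<beta>)) = \<zero>" using B top by auto
    show "(\<psi>(p := \<chi>)) (top_end \<beta>) (G (top_end \<beta>) w) = 0" if "w \<in> V (top_end \<beta> + 1)" for w
      using \<open>top_end \<beta> < n\<close> that B top by auto
  qed
qed

text \<open>A string may stop at \<open>p\<close> if its vector lies in the kernel of $a_p$ and its
  functional kills the image of $a_p^*$: these are the conditions at the top end.\<close>

lemma arc_string_point:
  assumes p: "p \<in> {1..n}" and "z \<in> V p" "linfun \<chi>"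
    and "p < n \<Longrightarrow> F p z = \<zero>" "\<And>w. p < n \<Longrightarrow> w \<in> V (p + 1) \<Longrightarrow> \<chi> (G p w) = 0"
    and \<alpha>: "\<alpha> = \<lparr>bot_end = p - 1, top_end = p, right_of = {}\<rparr>"
  shows "\<alpha> \<in> nc_arcs n" "arc_string \<alpha> (\<lambda>_. z) (\<lambda>_. \<chi>)"
proof -
  have "arc_supp \<alpha> = {p}" using p by (auto simp: arc_supp_def \<alpha>)
  moreover have "side \<alpha> i = 0" for i using p by (auto simp: side_def \<alpha>)
  ultimately show "arc_string \<alpha> (\<lambda>_. z) (\<lambda>_. \<chi>)"
    using assms by (auto simp: arc_string_def \<alpha>)
  show "\<alpha> \<in> nc_arcs n" using p by (auto simp: nc_arcs_def \<alpha>)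
qed

lemma subsp_image:
  assumes "subsp W" "r \<in> carrier (RA n)"
  shows "subsp ((\<odot>) r ` W)"
proof -
  note W = subspD[OF assms(1)]
  have "r \<odot> u \<oplus> r \<odot> v \<in> (\<odot>) r ` W" if "u \<in> W" "v \<in> W" for u v
    using that W(1)[of u] W(1)[of v] W(3) by (auto simp: smult_r_distr[symmetric] assms(2))
  moreover have "sc c (r \<odot> u) \<in> (\<odot>) r ` W" if "u \<in> W" for c u
    using that W(1)[of u] W(4) by (auto simp: sc_comm[symmetric] assms(2))
  moreover have "\<zero> \<in> (\<odot>) r ` W"
    using W(2) smult_r_null[OF assms(2)] by (metis imageI)
  ultimately show ?thesis using W(1) assms(2) by (auto simp: subsp_def intro: smult_closed)
qed

lemma subsp_vimage:
  assumes "subsp W" "subsp U" "r \<in> carrier (RA n)"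
  shows "subsp {x \<in> U. r \<odot> x \<in> W}"
  using subspD[OF assms(1)] subspD[OF assms(2)] assms(3)
  by (auto simp: subsp_def smult_r_distr smult_r_null sc_comm)

lemma subsp_ker: "linfun \<psi> \<Longrightarrow> subsp U \<Longrightarrow> subsp {x \<in> U. \<psi> x = 0}"
  using linfun_zero by (auto simp: subsp_def linfun_def subset_iff)

lemma linfun_comp: "linfun \<psi> \<Longrightarrow> r \<in> carrier (RA n) \<Longrightarrow> linfun (\<lambda>x. \<psi> (r \<odot> x))"
  by (auto simp: linfun_def smult_r_distr sc_comm smult_closed)

lemma ex_linfun_sum:
  assumes U: "subsp U" and W: "subsp W" and y: "y \<in> carrier M"
    and ind: "\<And>u w. u \<in> U \<Longrightarrow> w \<in> W \<Longrightarrow> y \<noteq> u \<oplus> w"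
  obtains \<psi> where "linfun \<psi>" "\<And>u. u \<in> U \<Longrightarrow> \<psi> u = 0" "\<And>w. w \<in> W \<Longrightarrow> \<psi> w = 0" "\<psi> y = 1"
proof -
  let ?S = "{u \<oplus> w | u w. u \<in> U \<and> w \<in> W}"
  have "y \<notin> ?S" using ind by blast
  then obtain \<psi> where \<psi>: "linfun \<psi>" "\<And>x. x \<in> ?S \<Longrightarrow> \<psi> x = 0" "\<psi> y = 1"
    using ex_linfun[OF subsp_sum[OF U W] y] by blast
  have "u \<in> ?S" if "u \<in> U" for u
  proof -
    have "u = u \<oplus> \<zero>" using subspD(1)[OF U that] by simp
    then show ?thesis using that subspD(2)[OF W] by blast
  qed
  moreover have "w \<in> ?S" if "w \<in> W" for w
  proof -
    have "w = \<zero> \<oplus> w" using subspD(1)[OF W that] by simp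
    then show ?thesis using that subspD(2)[OF U] by blast
  qed
  ultimately show ?thesis using \<psi> by (intro that[of \<psi>]) auto
qed

text \<open>
  The two-cycle relations give $0 \subseteq \operatorname{im} a_p^* \subseteq
  \ker a_p \subseteq V_p$; the string continues along $a_p^*$, stops at \<open>p\<close>, or continues along $a_p$
  according to the first term of this chain whose meet with \<open>U\<close> leaves \<open>W\<close>.  Passing to
  preimages or images at \<open>p + 1\<close> is the reason for working with a pair \<open>W \<subset> U\<close>.
\<close>

lemma ex_arc_string:
  assumes "p \<in> {1..n}" "subsp U" "subsp W" "W \<subset> U" "U \<subseteq> V p"
  shows "\<exists>\<alpha> y \<psi>. \<alpha> \<in> nc_arcs n \<and> bot_end \<alpha> = p - 1 \<and> arc_string \<alpha> y \<psi> \<and>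
    y p \<in> U \<and> \<psi> p (y p) = 1 \<and> (\<forall>w \<in> W. \<psi> p w = 0)"
  using assms
proof (induction "n - p" arbitrary: p U W rule: less_induct)
  case less
  note p = less.prems(1) and U = less.prems(2) and W = less.prems(3) and WU = less.prems(4) and UV = less.prems(5)
  note UD = subspD[OF U] and WD = subspD[OF W]
  let ?pt = "\<lparr>bot_end = p - 1, top_end = p, right_of = {}\<rparr>"
  let ?arc = "\<lambda>\<beta> s. \<lparr>bot_end = p - 1, top_end = top_end \<beta>, right_of = right_of \<beta> \<union> (if s then {p} else {})\<rparr>"
  show ?case
  proof (cases "p = n")
    case True
    obtain z where z: "z \<in> U" "z \<notin> W" using WU by blast
    then obtain \<psi> where \<psi>: "linfun \<psi>" "\<And>w. w \<in> W \<Longrightarrow> \<psi> w = 0" "\<psi> z = 1"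
      using ex_linfun[OF W UD(1)] by blast
    have "z \<in> V p" using z UV by blast
    from arc_string_point[OF p this \<psi>(1) _ _ refl] True
    have "?pt \<in> nc_arcs n" "arc_string ?pt (\<lambda>_. z) (\<lambda>_. \<psi>)" by auto
    then show ?thesis
      using z \<psi> by (intro exI[of _ ?pt] exI[of _ "\<lambda>_. z"] exI[of _ "\<lambda>_. \<psi>"]) auto
  next
    case False
    then have p': "p \<in> {1..<n}" "p + 1 \<in> {1..n}" "n - (p + 1) < n - p" using p by auto
    have bwc: "(bw n p :: 'k kQ_elt set) \<in> carrier (RA n)" and fwc: "(fw n p :: 'k kQ_elt set) \<in> carrier (RA n)"
      using p'(1) by (rule gen_closed)+
    let ?im = "(\<lambda>w. G p w) ` V (p + 1)"
    have im: "subsp ?im" by (rule subsp_image[OF subsp_V[OF p'(2)] bwc])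
    consider (im) "\<exists>x \<in> U \<inter> ?im. x \<notin> W" | (ker) "U \<inter> ?im \<subseteq> W" "\<exists>x \<in> U. F p x = \<zero> \<and> x \<notin> W"
      | (coker) "\<And>x. x \<in> U \<Longrightarrow> F p x = \<zero> \<Longrightarrow> x \<in> W" by blast
    then show ?thesis
    proof cases
      case im
      \<comment> \<open>Preimages under $a_p^*$ keep the pair strict, since some vector of
        \<open>U\<close> outside \<open>W\<close> lies in the image of $a_p^*$.\<close>
      let ?U = "{x \<in> V (p + 1). G p x \<in> U}" and ?W = "{x \<in> V (p + 1). G p x \<in> W}"
      have sub: "subsp ?U" "subsp ?W" using subsp_vimage[OF _ subsp_V[OF p'(2)] bwc] U W by auto
      have "?W \<subset> ?U" using im WU by blast
      from less.hyps[OF p'(3,2) sub this]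
      obtain \<beta> y \<psi> where IH: "\<beta> \<in> nc_arcs n" "bot_end \<beta> = p" "arc_string \<beta> y \<psi>"
        "y (p + 1) \<in> ?U" "\<psi> (p + 1) (y (p + 1)) = 1" "\<forall>w \<in> ?W. \<psi> (p + 1) w = 0" by auto
      have "p + 1 \<in> arc_supp \<beta>" using IH(1,2) by (auto simp: nc_arcs_def arc_supp_def)
      then have lin: "linfun (\<psi> (p + 1))" and y: "y (p + 1) \<in> V (p + 1)"
        using IH(3) by (auto simp: arc_string_def)
      let ?z = "G p (y (p + 1))"
      \<comment> \<open>The new functional must satisfy
        \<open>\<chi> (G p w) = \<psi> (p + 1) w\<close>. So, besides \<open>W\<close>, it has to
        kill the image of the kernel \<open>?K\<close> of \<open>\<psi> (p + 1)\<close>, and it has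
        to be 1 at \<open>?z\<close>; as \<open>?K\<close> and \<open>y (p + 1)\<close> span
        \<open>V (p + 1)\<close>, this is enough.\<close>
      let ?K = "{x \<in> V (p + 1). \<psi> (p + 1) x = 0}"
      have K: "subsp ?K" by (rule subsp_ker[OF lin subsp_V[OF p'(2)]])
      have yc: "y (p + 1) \<in> carrier M" by (rule V_closed[OF y])
      have zc: "?z \<in> carrier M" by (rule G_closed[OF p'(1) yc])
      \<comment> \<open>Otherwise \<open>y (p + 1)\<close> minus an element of \<open>?K\<close>
        would lie in \<open>?W\<close>, where \<open>\<psi> (p + 1)\<close> vanishes, although its
        value there is 1.\<close>
      have ind: "?z \<noteq> u \<oplus> w" if u: "u \<in> (\<lambda>x. G p x) ` ?K" and w: "w \<in> W" for u w
      proof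
        assume eq: "?z = u \<oplus> w"
        obtain k where k: "k \<in> V (p + 1)" "\<psi> (p + 1) k = 0" "u = G p k" using u by auto
        have kc: "k \<in> carrier M" by (rule V_closed[OF k(1)])
        have sk: "y (p + 1) \<oplus> sc (- 1) k \<in> V (p + 1)"
          using y k(1) subspD[OF subsp_V[OF p'(2)]] by blast
        have "G p (y (p + 1) \<oplus> sc (- 1) k) = ?z \<ominus> u"
          using kc yc bwc by (simp add: smult_r_distr sc_closed sc_comm sc_minus smult_closed smult_minus k(3) M.minus_eq)
        also have "\<dots> = w"
          unfolding eq using WD(1)[OF w] kc bwc
          by (simp add: k(3) smult_closed M.minus_eq M.a_ac M.r_neg M.r_neg1 M.r_neg2)
        finally have "\<psi> (p + 1) (y (p + 1) \<oplus> sc (- 1) k) = 0" using IH(6) sk w by auto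
        then show False using lin kc yc IH(5) k(2) by (simp add: linfun_def sc_closed)
      qed
      obtain \<chi> where \<chi>: "linfun \<chi>" "\<And>u. u \<in> (\<lambda>x. G p x) ` ?K \<Longrightarrow> \<chi> u = 0" "\<And>w. w \<in> W \<Longrightarrow> \<chi> w = 0" "\<chi> ?z = 1"
        using ex_linfun_sum[OF subsp_image[OF K bwc] W zc ind] by blast
      have \<chi>G: "\<chi> (G p w) = \<psi> (p + 1) w" if w: "w \<in> V (p + 1)" for w
      proof -
        let ?c = "\<psi> (p + 1) w"
        have wc: "w \<in> carrier M" by (rule V_closed[OF w])
        have "w \<oplus> sc (- ?c) (y (p + 1)) \<in> V (p + 1)"
          using y w subspD[OF subsp_V[OF p'(2)]] by blast
        moreover have "\<psi> (p + 1) (w \<oplus> sc (- ?c) (y (p + 1))) = 0"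
          using lin wc yc IH(5) by (simp add: linfun_def sc_closed)
        ultimately have "\<chi> (G p (w \<oplus> sc (- ?c) (y (p + 1)))) = 0" using \<chi>(2) by blast
        moreover have "G p (w \<oplus> sc (- ?c) (y (p + 1))) = G p w \<oplus> sc (- ?c) ?z"
          using wc yc bwc by (simp add: smult_r_distr sc_closed sc_comm)
        moreover have "\<chi> (G p w \<oplus> sc (- ?c) ?z) = \<chi> (G p w) + (- ?c) * \<chi> ?z"
          using \<chi>(1) wc zc bwc by (simp add: linfun_def sc_closed smult_closed)
        ultimately show ?thesis using \<chi>(4) by simp
      qed
      \<comment> \<open>The image of $a_p$ is killed by $a_p^*$ and therefore lies in
        \<open>?W\<close>.\<close>
      have \<psi>F: "\<psi> (p + 1) (F p v) = 0" if v: "v \<in> V p" for v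
      proof -
        have "F p v \<in> V (p + 1)" "G p (F p v) = \<zero>"
          using F_V[OF p'(1)] G_F[OF p'(1)] V_closed[OF v] by auto
        then show ?thesis using IH(6) WD(2) by auto
      qed
      let ?\<alpha> = "?arc \<beta> False"
      have "?\<alpha> \<in> nc_arcs n" "arc_string ?\<alpha> (y(p := ?z)) (\<psi>(p := \<chi>))"
        using arc_string_cons[OF IH(1-3) p'(1) G_V[OF p'(1) yc] \<chi>(1), of False] \<chi>G \<psi>F by auto
      then show ?thesis
        using IH(4) \<chi> by (intro exI[of _ ?\<alpha>] exI[of _ "y(p := ?z)"] exI[of _ "\<psi>(p := \<chi>)"]) auto
    next
      case ker
      obtain z where z: "z \<in> U" "F p z = \<zero>" "z \<notin> W" using ker(2) by blast
      \<comment> \<open>If \<open>z = u \<oplus> w\<close>, then \<open>u\<close> lies in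
        \<open>U\<close> and in the image of $a_p^*$, hence in \<open>W\<close>, and so would
        \<open>z\<close>.\<close>
      have ind: "z \<noteq> u \<oplus> w" if u: "u \<in> ?im" and w: "w \<in> W" for u w
      proof
        assume eq: "z = u \<oplus> w"
        have uc: "u \<in> carrier M" using subspD(1)[OF im u] .
        have "z \<ominus> w \<in> U" using z(1) w WU by (intro subsp_diff[OF U]) auto
        moreover have "z \<ominus> w = u"
          unfolding eq using uc WD(1)[OF w] by (simp add: M.minus_eq M.a_assoc M.r_neg)
        ultimately have "u \<in> W" using ker(1) u by blast
        then have "z \<in> W" unfolding eq using w by (rule WD(3))
        then show False using z(3) by simp
      qed
      obtain \<chi> where \<chi>: "linfun \<chi>" "\<And>u. u \<in> ?im \<Longrightarrow> \<chi> u = 0" "\<And>w. w \<in> W \<Longrightarrow> \<chi> w = 0" "\<chi> z = 1"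
        using ex_linfun_sum[OF im W UD(1)[OF z(1)] ind] by blast
      have "z \<in> V p" using z UV by blast
      from arc_string_point[OF p this \<chi>(1) _ _ refl] z(2) \<chi>(2)
      have "?pt \<in> nc_arcs n" "arc_string ?pt (\<lambda>_. z) (\<lambda>_. \<chi>)" by auto
      then show ?thesis
        using z \<chi> by (intro exI[of _ ?pt] exI[of _ "\<lambda>_. z"] exI[of _ "\<lambda>_. \<chi>"]) auto
    next
      case coker
      let ?U = "(\<lambda>x. F p x) ` U" and ?W = "(\<lambda>x. F p x) ` W"
      have sub: "subsp ?U" "subsp ?W" using subsp_image[OF _ fwc] U W by auto
      \<comment> \<open>The kernel of $a_p$ meets \<open>U\<close> only inside \<open>W\<close>, so
        the pair of images stays strict.\<close>
      have WU': "?W \<subset> ?U"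
      proof -
        obtain z where z: "z \<in> U" "z \<notin> W" using WU by blast
        have "F p z \<notin> ?W"
        proof
          assume "F p z \<in> ?W"
          then obtain w where w: "w \<in> W" "F p z = F p w" by blast
          have c: "z \<in> carrier M" "w \<in> carrier M" using UD(1)[OF z(1)] WD(1)[OF w(1)] by auto
          have "z \<oplus> sc (- 1) w \<in> U" using z(1) w(1) WU UD(3,4) by blast
          moreover have "F p (z \<oplus> sc (- 1) w) = \<zero>"
            using c fwc w(2) by (simp add: smult_r_distr sc_closed sc_comm sc_minus smult_closed smult_minus M.r_neg)
          ultimately have "z \<oplus> sc (- 1) w \<in> W" by (rule coker)
          then have "z \<oplus> sc (- 1) w \<oplus> w \<in> W" using w(1) by (rule WD(3))
          then show False using z(2) c by (simp add: sc_minus M.a_assoc M.l_neg)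
        qed
        then show ?thesis using z WU by blast
      qed
      have UV': "?U \<subseteq> V (p + 1)" using F_V[OF p'(1) UD(1)] by blast
      from less.hyps[OF p'(3,2) sub WU' UV']
      obtain \<beta> y \<psi> where IH: "\<beta> \<in> nc_arcs n" "bot_end \<beta> = p" "arc_string \<beta> y \<psi>"
        "y (p + 1) \<in> ?U" "\<psi> (p + 1) (y (p + 1)) = 1" "\<forall>w \<in> ?W. \<psi> (p + 1) w = 0" by auto
      have "p + 1 \<in> arc_supp \<beta>" using IH(1,2) by (auto simp: nc_arcs_def arc_supp_def)
      then have lin: "linfun (\<psi> (p + 1))" using IH(3) by (auto simp: arc_string_def)
      obtain z where z: "z \<in> U" "F p z = y (p + 1)" using IH(4) by auto
      \<comment> \<open>The functional is pulled back along $a_p$; it kills the image of $a_p^*$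
        because $a_p a_p^* = 0$ in $RA_n$.\<close>
      let ?\<chi> = "\<lambda>x. \<psi> (p + 1) (F p x)"
      have \<chi>G: "?\<chi> (G p w) = 0" if w: "w \<in> V (p + 1)" for w
        using F_G[OF p'(1) V_closed[OF w]] linfun_zero[OF lin] by simp
      have zV: "z \<in> V p" using z UV by blast
      let ?\<alpha> = "?arc \<beta> True"
      have "?\<alpha> \<in> nc_arcs n" "arc_string ?\<alpha> (y(p := z)) (\<psi>(p := ?\<chi>))"
        using arc_string_cons[OF IH(1-3) p'(1) zV linfun_comp[OF lin fwc], of True] z(2) \<chi>G by auto
      then show ?thesis
        using z IH(5,6) by (intro exI[of _ ?\<alpha>] exI[of _ "y(p := z)"] exI[of _ "\<psi>(p := ?\<chi>)"]) auto
    qed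
  qed
qed

text \<open>A path absorbs the idempotent of its first vertex on the right, so every element of
  $RA_n$ kills \<open>x\<close>, in particular the unit.\<close>

lemma zero_if_E_zero:
  assumes x: "x \<in> carrier M" "\<And>i. i \<in> {1..n} \<Longrightarrow> E i x = \<zero>"
  shows "x = \<zero>"
proof -
  have "cls n f \<odot> x = \<zero>" if "f \<in> carrier (kQ n)" for f :: "'k kQ_elt"
    using that
  proof (induction rule: path_algebra_induct)
    case (path y)
    obtain u p v where y: "y = (u, p, v)" by (cases y) auto
    have u: "u \<in> {1..n}" using path by (simp add: y quiver_paths_def pre_digraph.awalk_def RA_quiver_def)
    have "cls n (path_elem y :: 'k kQ_elt) = cls n (path_elem y) \<otimes>\<^bsub>RA n\<^esub> vx n u"
      unfolding vx_def y using path u by (simp add: y cls_path_mult RA_paths)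
    then have "cls n (path_elem y) \<odot> x = cls n (path_elem y) \<odot> E u x"
      using smult_assoc[OF cls_closed[OF path_elem_closed[OF path]] gen_closed(1)[OF u] x(1)] by simp
    then show ?case using smult_r_null[OF cls_closed[OF path_elem_closed[OF path]]] x(2)[OF u] by simp
  next
    case (scale c f)
    then show ?case
      using smult_assoc[OF RA_scalar_closed cls_closed[OF scale(1)] x(1), of c]
      by (simp add: RA_scalar_cls(1) sc_r_zero)
  next
    case (add f g)
    then show ?case
      using smult_l_distr[OF cls_closed[OF add(1)] cls_closed[OF add(2)] x(1)]
      by (simp add: cls_add[OF add(1,2), symmetric] path_algebra_simps(2))
  next
    case zero
    show ?case using sc_zero[OF x(1)] by (simp add: RA_scalar_eq)
  qed
  from this[OF kQ_one_closed[of 1]] show ?thesis using sc_one[OF x(1)] by (simp add: RA_scalar_eq)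
qed

text \<open>The string starts at the lowest vertex with nonzero space, from the pair of that space
  and 0. All spaces below vanish, which supplies the conditions at the bottom end that
  \<open>arc_string\<close> omits.\<close>

lemma ex_retract:
  assumes "carrier M \<noteq> {\<zero>}"
  obtains \<alpha> g h where "\<alpha> \<in> nc_arcs n" "g \<in> left_module_hom (RA n) (arcmod n \<alpha>) M"
    "h \<in> left_module_hom (RA n) M (arcmod n \<alpha>)" "\<And>v. v \<in> carrier (arcmod n \<alpha>) \<Longrightarrow> h (g v) = v"
proof -
  define P where "P i \<longleftrightarrow> i \<in> {1..n} \<and> V i \<noteq> {\<zero>}" for i
  have "\<exists>i. P i"
  proof (rule ccontr)
    assume no: "\<not> (\<exists>i. P i)"
    have "x = \<zero>" if x: "x \<in> carrier M" for x
    proof (rule zero_if_E_zero[OF x])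
      show "E i x = \<zero>" if "i \<in> {1..n}" for i using no E_V[OF that x] that by (auto simp: P_def)
    qed
    then show False using assms M.zero_closed by blast
  qed
  define p where "p = (LEAST i. P i)"
  have "P p" unfolding p_def using \<open>\<exists>i. P i\<close> by (rule LeastI_ex)
  then have p: "p \<in> {1..n}" "V p \<noteq> {\<zero>}" by (auto simp: P_def)
  have least: "V i = {\<zero>}" if "i \<in> {1..n}" "i < p" for i
    using not_less_Least[of i P] that by (auto simp: p_def P_def)
  have zero: "subsp {\<zero>}" by (auto simp: subsp_def sc_r_zero)
  have "{\<zero>} \<subset> V p" using p subspD(2)[OF subsp_V[OF p(1)]] by blast
  from ex_arc_string[OF p(1) subsp_V[OF p(1)] zero this subset_refl]
  obtain \<alpha> y \<psi> where \<alpha>: "\<alpha> \<in> nc_arcs n" "bot_end \<alpha> = p - 1" "arc_string \<alpha> y \<psi>" "\<psi> p (y p) = 1"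
    by (elim exE conjE)
  note S = \<alpha>(3)[unfolded arc_string_def]
  let ?N = "arcmod n \<alpha>" and ?S = "arc_supp \<alpha>"
  have sub: "?S \<subseteq> {1..n}" and fin: "finite ?S" using arc_supp_subset[OF \<alpha>(1)] by (auto simp: arc_supp_def)
  interpret N: RA_mod n ?N unfolding RA_mod_def by (rule left_module_arcmod[OF \<alpha>(1)])
  have yV: "y i \<in> V i" and lin: "linfun (\<psi> i)" if "i \<in> ?S" for i using S that by auto
  have yc: "y i \<in> carrier M" if "i \<in> ?S" for i using V_closed[OF yV[OF that]] .
  have supp: "i \<in> ?S \<longleftrightarrow> p \<le> i \<and> i \<le> top_end \<alpha>" for i using \<alpha>(2) p by (auto simp: arc_supp_def)
  have side0: "side \<alpha> i = 0 \<longleftrightarrow> \<not> (i \<in> ?S \<and> i + 1 \<in> ?S)" for i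
    using \<alpha>(2) p by (auto simp: side_def arc_supp_def)
  have side1: "side \<alpha> i \<in> {0, 1, - 1}" for i by (auto simp: side_def)
  have Fy: "F j (y j) = (if side \<alpha> j = 1 then y (j + 1) else \<zero>)" if "j \<in> {1..<n}" "j \<in> ?S" for j
    using S side1[of j] side0[of j] that supp[of j] supp[of "j + 1"] by (cases "j = top_end \<alpha>") auto
  have Gy: "G j (y (j + 1)) = (if side \<alpha> j = - 1 then y j else \<zero>)" if j: "j \<in> {1..<n}" "j + 1 \<in> ?S" for j
  proof (cases "j \<in> ?S")
    case True
    then show ?thesis using S side1[of j] side0[of j] that by auto
  next
    case False
    then have "V j = {\<zero>}" using least[of j] j supp[of j] supp[of "j + 1"] by auto
    then have "G j (y (j + 1)) = \<zero>" using G_V[OF j(1) yc[OF j(2)]] by auto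
    then show ?thesis using side0[of j] False by auto
  qed
  have \<psi>F: "\<psi> (j + 1) (F j v) = (if side \<alpha> j = 1 then \<psi> j v else 0)"
    if j: "j \<in> {1..<n}" "j + 1 \<in> ?S" "v \<in> V j" for j v
  proof (cases "j \<in> ?S")
    case True
    then show ?thesis using S side1[of j] side0[of j] that by auto
  next
    case False
    then have "V j = {\<zero>}" using least[of j] j supp[of j] supp[of "j + 1"] by auto
    then have "F j v = \<zero>" using j(3) smult_r_null[OF gen_closed(2)[OF j(1)]] by auto
    then show ?thesis using side0[of j] False linfun_zero[OF lin[OF j(2)]] by auto
  qed
  have \<psi>G: "\<psi> j (G j w) = (if side \<alpha> j = - 1 then \<psi> (j + 1) w else 0)"
    if "j \<in> {1..<n}" "j \<in> ?S" "w \<in> V (j + 1)" for j w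
    using S side1[of j] side0[of j] that supp[of j] supp[of "j + 1"] by (cases "j = top_end \<alpha>") auto
  \<comment> \<open>Only the value at \<open>p\<close> was arranged; it is carried upwards along
    whichever arrow acts at each node.\<close>
  have \<psi>y: "\<psi> i (y i) = 1" if "i \<in> ?S" for i
    using that
  proof (induction i rule: less_induct)
    case (less i)
    show ?case
    proof (cases "i = p")
      case False
      then obtain j where j: "i = j + 1" "j \<in> ?S" "j \<in> {1..<n}"
        using less.prems supp sub p(1) by (cases i) auto
      then have IH: "\<psi> j (y j) = 1" using less.IH by simp
      from side0[of j] side1[of j] j less.prems consider "side \<alpha> j = 1" | "side \<alpha> j = - 1" by auto
      then show ?thesis
      proof cases
        case 1
        then show ?thesis using \<psi>F[of j "y j"] Fy[of j] IH j less.prems yV by auto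
      next
        case 2
        then show ?thesis using \<psi>G[of j "y i"] Gy[of j] IH j less.prems yV by auto
      qed
    qed (use \<alpha>(4) in simp)
  qed
  define g where "g v = (\<Oplus>i \<in> ?S. sc (v i) (y i))" for v
  define h where "h x i = (if i \<in> ?S then \<psi> i (E i x) else 0)" for x i
  have gc: "(\<lambda>i. sc (v i) (y i)) \<in> ?S \<rightarrow> carrier M" for v using yc by (auto intro!: sc_closed)
  \<comment> \<open>Treats both kinds of arrows at once: \<open>r\<close> leads from vertex
    \<open>a\<close> to vertex \<open>b\<close> and acts nontrivially exactly if
    \<open>P\<close>.\<close>
  have g_shift: "g (r \<odot>\<^bsub>?N\<^esub> v) = r \<odot> g v"
    if r: "r \<in> carrier (RA n)" and rv: "r \<odot>\<^bsub>?N\<^esub> v = (\<lambda>j. if j = b \<and> P then v a else 0)"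
      and ry: "\<And>i. i \<in> ?S \<Longrightarrow> r \<odot> y i = (if i = a \<and> P then y b else \<zero>)"
      and P: "P \<Longrightarrow> a \<in> ?S \<and> b \<in> ?S" for r v a b P
  proof -
    have sum: "r \<odot> g v = (\<Oplus>i \<in> ?S. sc (v i) (r \<odot> y i))"
      unfolding g_def smult_finsum[OF r fin gc]
      using yc r by (intro M.finsum_cong') (auto simp: sc_comm sc_closed smult_closed)
    show ?thesis
    proof (cases P)
      case True
      have "g (r \<odot>\<^bsub>?N\<^esub> v) = sc ((r \<odot>\<^bsub>?N\<^esub> v) b) (y b)"
        unfolding g_def using P[OF True] by (intro finsum_single fin) (auto simp: rv yc sc_closed sc_zero)
      moreover have "r \<odot> g v = sc (v a) (r \<odot> y a)"
        unfolding sum using P[OF True] ry yc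
        by (intro finsum_single fin) (auto simp: sc_closed sc_r_zero)
      ultimately show ?thesis using True P[OF True] ry[of a] by (simp add: rv)
    next
      case False
      have "g (r \<odot>\<^bsub>?N\<^esub> v) = (\<Oplus>i \<in> ?S. \<zero>)"
        unfolding g_def using False by (intro M.finsum_cong') (auto simp: rv yc sc_zero)
      moreover have "r \<odot> g v = (\<Oplus>i \<in> ?S. \<zero>)"
        unfolding sum using False ry by (intro M.finsum_cong') (auto simp: sc_r_zero)
      ultimately show ?thesis by simp
    qed
  qed
  have g: "g \<in> left_module_hom (RA n) ?N M"
  proof (rule left_module_homI[OF N.left_module_axioms left_module_axioms])
    show "g v \<in> carrier M" for v unfolding g_def by (rule M.finsum_closed[OF gc])
    show "g (v \<oplus>\<^bsub>?N\<^esub> w) = g v \<oplus> g w" for v w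
      unfolding g_def arcmod_simps M.finsum_addf[OF gc gc, symmetric]
      using gc yc by (intro M.finsum_cong') (auto simp: sc_l_distr sc_closed)
    show "g (RA_scalar n c \<odot>\<^bsub>?N\<^esub> v) = sc c (g v)" if "v \<in> carrier ?N" for c v
      unfolding g_def arcmod_scalar[OF \<alpha>(1) that] smult_finsum[OF RA_scalar_closed fin gc]
      using gc yc by (intro M.finsum_cong') (auto simp: sc_sc sc_closed)
    show "g (vx n j \<odot>\<^bsub>?N\<^esub> v) = E j (g v)" if j: "j \<in> {1..n}" for j v
      unfolding g_def arcmod_gens(1)[OF j] smult_finsum[OF gen_closed(1)[OF j] fin gc]
      using j gc yc sub gens_on_V(1)[OF yV _ j]
      by (intro M.finsum_cong') (auto simp: sc_comm gen_closed sc_closed E_closed sc_zero sc_r_zero subset_iff)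
    show "g (fw n j \<odot>\<^bsub>?N\<^esub> v) = F j (g v)" if j: "j \<in> {1..<n}" for j v
    proof (rule g_shift[OF gen_closed(2)[OF j] arcmod_gens(2)[OF j]])
      show "F j (y i) = (if i = j \<and> side \<alpha> j = 1 then y (j + 1) else \<zero>)" if i: "i \<in> ?S" for i
        using Fy[OF j] gens_on_V(2)[OF yV[OF i] subsetD[OF sub i] j] i by (cases "i = j") auto
    qed (use side0[of j] in auto)
    show "g (bw n j \<odot>\<^bsub>?N\<^esub> v) = G j (g v)" if j: "j \<in> {1..<n}" for j v
    proof (rule g_shift[OF gen_closed(3)[OF j] arcmod_gens(3)[OF j]])
      show "G j (y i) = (if i = j + 1 \<and> side \<alpha> j = - 1 then y j else \<zero>)" if i: "i \<in> ?S" for i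
        using Gy[OF j] gens_on_V(3)[OF yV[OF i] subsetD[OF sub i] j] i by (cases "i = j + 1") auto
    qed (use side0[of j] in auto)
  qed
  have \<psi>E: "\<psi> i (E i (x \<oplus> x')) = \<psi> i (E i x) + \<psi> i (E i x')" "\<psi> i (E i (sc c x)) = c * \<psi> i (E i x)"
    if "i \<in> ?S" "x \<in> carrier M" "x' \<in> carrier M" for i c x x'
    using linfun_comp[OF lin[OF that(1)] gen_closed(1)[OF subsetD[OF sub that(1)]]] that(2,3)
    by (auto simp: linfun_def)
  have h: "h \<in> left_module_hom (RA n) M ?N"
  proof (rule left_module_homI[OF left_module_axioms N.left_module_axioms])
    show hc: "h x \<in> carrier ?N" for x by (simp add: arcmod_simps h_def)
    show "h (x \<oplus> x') = h x \<oplus>\<^bsub>?N\<^esub> h x'" if "x \<in> carrier M" "x' \<in> carrier M" for x x'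
      using that by (auto simp: h_def arcmod_simps \<psi>E)
    show "h (sc c x) = RA_scalar n c \<odot>\<^bsub>?N\<^esub> h x" if "x \<in> carrier M" for c x
      unfolding arcmod_scalar[OF \<alpha>(1) hc] using that by (auto simp: h_def \<psi>E)
    show "h (E j x) = vx n j \<odot>\<^bsub>?N\<^esub> h x" if "j \<in> {1..n}" "x \<in> carrier M" for j x
      unfolding arcmod_gens(1)[OF that(1)] using that sub linfun_zero[OF lin]
      by (intro ext) (auto simp: h_def E_E subset_iff)
    show "h (F j x) = fw n j \<odot>\<^bsub>?N\<^esub> h x" if j: "j \<in> {1..<n}" "x \<in> carrier M" for j x
    proof
      fix i
      have FE: "F j (E j x) = F j x" using F_E[OF j(1) _ j(2), of j] j(1) by auto
      have "h (F j x) i = (if i = j + 1 \<and> i \<in> ?S then \<psi> (j + 1) (F j (E j x)) else 0)"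
        unfolding FE using E_F[OF j(1) _ j(2), of i] sub linfun_zero[OF lin[of i]] by (auto simp: h_def)
      also have "\<dots> = (if i = j + 1 \<and> side \<alpha> j = 1 then h x j else 0)"
        using \<psi>F[OF j(1) _ E_V, of x] j side0[of j] by (auto simp: h_def)
      finally show "h (F j x) i = (fw n j \<odot>\<^bsub>?N\<^esub> h x) i" unfolding arcmod_gens(2)[OF j(1)] .
    qed
    show "h (G j x) = bw n j \<odot>\<^bsub>?N\<^esub> h x" if j: "j \<in> {1..<n}" "x \<in> carrier M" for j x
    proof
      fix i
      have GE: "G j (E (j + 1) x) = G j x" using G_E[OF j(1) _ j(2), of "j + 1"] j(1) by auto
      have "h (G j x) i = (if i = j \<and> i \<in> ?S then \<psi> j (G j (E (j + 1) x)) else 0)"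
        unfolding GE using E_G[OF j(1) _ j(2), of i] sub linfun_zero[OF lin[of i]] by (auto simp: h_def)
      also have "\<dots> = (if i = j \<and> side \<alpha> j = - 1 then h x (j + 1) else 0)"
        using \<psi>G[OF j(1) _ E_V, of x] j side0[of j] by (auto simp: h_def)
      finally show "h (G j x) i = (bw n j \<odot>\<^bsub>?N\<^esub> h x) i" unfolding arcmod_gens(3)[OF j(1)] .
    qed
  qed
  have "h (g v) = v" if v: "v \<in> carrier ?N" for v
  proof
    fix i
    show "h (g v) i = v i"
    proof (cases "i \<in> ?S")
      case True
      then have i: "i \<in> {1..n}" using sub by auto
      have "E i (g v) = (\<Oplus>j \<in> ?S. E i (sc (v j) (y j)))"
        unfolding g_def by (rule smult_finsum[OF gen_closed(1)[OF i] fin gc])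
      also have "\<dots> = E i (sc (v i) (y i))"
        using True i sub gens_on_V(1)[OF yV _ i] yc
        by (intro finsum_single fin)
          (auto simp: sc_comm gen_closed E_closed sc_closed sc_r_zero subset_iff)
      also have "\<dots> = sc (v i) (y i)"
        using yV[OF True] yc[OF True] i by (simp add: sc_comm gen_closed V_def)
      finally show ?thesis
        using True \<psi>y[OF True] lin[OF True] yc[OF True] by (simp add: h_def linfun_def)
    next
      case False
      then show ?thesis using v by (simp add: h_def arcmod_simps)
    qed
  qed
  then show ?thesis using that \<alpha>(1) g h by blast
qed

end

section \<open>Homomorphisms, submodules and decompositions\<close>

lemma hom_closed: "h \<in> left_module_hom R M N \<Longrightarrow> x \<in> carrier M \<Longrightarrow> h x \<in> carrier N"
  and hom_add: "h \<in> left_module_hom R M N \<Longrightarrow> x \<in> carrier M \<Longrightarrow> y \<in> carrier M \<Longrightarrow>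
    h (x \<oplus>\<^bsub>M\<^esub> y) = h x \<oplus>\<^bsub>N\<^esub> h y"
  and hom_smult: "h \<in> left_module_hom R M N \<Longrightarrow> r \<in> carrier R \<Longrightarrow> x \<in> carrier M \<Longrightarrow>
    h (r \<odot>\<^bsub>M\<^esub> x) = r \<odot>\<^bsub>N\<^esub> h x"
  by (auto simp: left_module_hom_def)

lemma (in RA_mod) eq_if_diff_zero:
  assumes "x \<in> carrier M" "y \<in> carrier M" "x \<ominus> y = \<zero>"
  shows "x = y"
proof -
  have "x = (x \<ominus> y) \<oplus> y" using assms(1,2) by (simp add: M.minus_eq M.a_assoc M.l_neg)
  then show ?thesis using assms by simp
qed

lemma hom_zero:
  assumes "h \<in> left_module_hom (RA n) M N" "RA_mod n M" "RA_mod n N"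
  shows "h \<zero>\<^bsub>M\<^esub> = \<zero>\<^bsub>N\<^esub>"
proof -
  interpret M: RA_mod n M by fact
  interpret N: RA_mod n N by fact
  show ?thesis
    using hom_smult[OF assms(1) RA_scalar_closed M.zero_closed, of 0] hom_closed[OF assms(1) M.zero_closed]
    by (simp add: M.sc_zero N.sc_zero)
qed

lemma hom_diff:
  fixes M :: "('k::field kQ_elt set, 'v, 'y) module_scheme" and N :: "('k kQ_elt set, 'w, 'z) module_scheme"
  assumes "h \<in> left_module_hom (RA n) M N" "RA_mod n M" "RA_mod n N" "x \<in> carrier M" "y \<in> carrier M"
  shows "h (x \<ominus>\<^bsub>M\<^esub> y) = h x \<ominus>\<^bsub>N\<^esub> h y"
proof -
  interpret M: RA_mod n M by fact
  interpret N: RA_mod n N by fact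
  have "h (RA_scalar n (- 1 :: 'k) \<odot>\<^bsub>M\<^esub> y) = RA_scalar n (- 1) \<odot>\<^bsub>N\<^esub> h y"
    by (rule hom_smult[OF assms(1) RA_scalar_closed assms(5)])
  then have "h (\<ominus>\<^bsub>M\<^esub> y) = \<ominus>\<^bsub>N\<^esub> h y"
    using hom_closed[OF assms(1,5)] assms(5) by (simp add: M.sc_minus N.sc_minus)
  then show ?thesis
    using hom_add[OF assms(1,4), of "\<ominus>\<^bsub>M\<^esub> y"] assms(5) by (simp add: M.minus_eq N.minus_eq)
qed

lemma hom_comp:
  "g \<in> left_module_hom R L M \<Longrightarrow> h \<in> left_module_hom R M N \<Longrightarrow> (\<lambda>x. h (g x)) \<in> left_module_hom R L N"
  by (auto simp: left_module_hom_def Pi_iff)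

lemma factor_trans:
  assumes "is_factor_module R N M" "is_factor_module R L N"
  shows "is_factor_module R L M"
proof -
  obtain g where g: "g \<in> left_module_hom R M N" "g ` carrier M = carrier N"
    using assms(1) unfolding is_factor_module_def by (rule bexE)
  obtain h where h: "h \<in> left_module_hom R N L" "h ` carrier N = carrier L"
    using assms(2) unfolding is_factor_module_def by (rule bexE)
  have "(\<lambda>x. h (g x)) ` carrier M = h ` (g ` carrier M)" by (simp add: image_image)
  then have "(\<lambda>x. h (g x)) ` carrier M = carrier L" unfolding g(2) h(2) .
  then show ?thesis
    unfolding is_factor_module_def by (rule bexI[of _ "\<lambda>x. h (g x)", OF _ hom_comp[OF g(1) h(1)]])
qed

lemma RA_mod_image:
  assumes h: "h \<in> left_module_hom (RA n) M N" and mods: "RA_mod n M" "RA_mod n N"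
  shows "RA_mod n (N\<lparr>carrier := h ` carrier M\<rparr>)" (is "RA_mod n ?S")
proof -
  interpret M: RA_mod n M by fact
  interpret N: RA_mod n N by fact
  have sub: "h x \<in> carrier N" if "x \<in> carrier M" for x using hom_closed[OF h that] .
  have zero: "\<zero>\<^bsub>N\<^esub> \<in> h ` carrier M" using hom_zero[OF h mods] M.zero_closed by (metis imageI)
  have add: "h x \<oplus>\<^bsub>N\<^esub> h y \<in> h ` carrier M" if "x \<in> carrier M" "y \<in> carrier M" for x y
    using that by (simp add: hom_add[OF h, symmetric])
  have smult: "r \<odot>\<^bsub>N\<^esub> h x \<in> h ` carrier M" if "r \<in> carrier (RA n)" "x \<in> carrier M" for r x
    using that by (simp add: hom_smult[OF h, symmetric] M.smult_closed)
  interpret S: abelian_group ?S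
  proof (rule abelian_groupI)
    fix y assume "y \<in> carrier ?S"
    then obtain x where x: "x \<in> carrier M" "y = h x" by auto
    then show "\<exists>z \<in> carrier ?S. z \<oplus>\<^bsub>?S\<^esub> y = \<zero>\<^bsub>?S\<^esub>"
      using sub smult[OF RA_scalar_closed x(1), of "- 1"]
      by (intro bexI[of _ "N.sc (- 1) y"]) (auto simp: N.sc_minus N.l_neg)
  qed (use zero add sub in \<open>auto simp: N.a_ac\<close>)
  show ?thesis
    unfolding RA_mod_def
    by unfold_locales
      (use smult sub in \<open>auto simp: N.smult_l_distr N.smult_r_distr N.smult_assoc N.smult_one\<close>)
qed

lemma RA_mod_arcmod: "\<alpha> \<in> nc_arcs n \<Longrightarrow> RA_mod n (arcmod n \<alpha> :: 'k::field RA_module)"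
  unfolding RA_mod_def by (rule left_module_arcmod)

lemma arcmod_fd:
  assumes \<alpha>: "\<alpha> \<in> nc_arcs n"
  shows "(arcmod n \<alpha> :: 'k::field RA_module) \<in> fd_modules n"
proof -
  interpret M: RA_mod n "arcmod n \<alpha> :: 'k RA_module" using \<alpha> by (rule RA_mod_arcmod)
  let ?M = "arcmod n \<alpha> :: 'k RA_module"
  let ?e = "\<lambda>i j. if j = i then 1 else (0 :: 'k)"
  let ?B = "?e ` arc_supp \<alpha>"
  have B: "?B \<subseteq> carrier ?M" by (auto simp: arcmod_simps)
  have "v \<in> M.kspan ?B" if "finite J" "J \<subseteq> arc_supp \<alpha>" "\<And>i. i \<notin> J \<Longrightarrow> v i = 0" for J and v :: "nat \<Rightarrow> 'k"
    using that
  proof (induction J arbitrary: v rule: finite_induct)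
    case empty
    then have "v = \<zero>\<^bsub>?M\<^esub>" by (auto simp: arcmod_simps)
    then show ?case using M.kspanD(2)[OF B] by simp
  next
    case (insert j J)
    have "v(j := 0) \<in> M.kspan ?B" using insert.prems by (intro insert.IH) auto
    moreover have "?e j \<in> M.kspan ?B" using insert.prems by (intro M.kspan_base) auto
    ultimately have "RA_scalar n (v j) \<odot>\<^bsub>?M\<^esub> ?e j \<oplus>\<^bsub>?M\<^esub> v(j := 0) \<in> M.kspan ?B"
      using M.kspanD(3,4)[OF B] by blast
    moreover have "?e j \<in> carrier ?M" using insert.prems by (auto simp: arcmod_simps)
    then have "RA_scalar n (v j) \<odot>\<^bsub>?M\<^esub> ?e j \<oplus>\<^bsub>?M\<^esub> v(j := 0) = v"
      by (auto simp: arcmod_simps arcmod_scalar[OF \<alpha>])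
    ultimately show ?case by simp
  qed
  note span = this
  have "v \<in> M.kspan ?B" if "v \<in> carrier ?M" for v
    using that span[of "arc_supp \<alpha>" v] by (simp add: arcmod_simps arc_supp_def)
  then have "carrier ?M \<subseteq> M.kspan ?B" by blast
  then show ?thesis using B M.RA_mod_axioms unfolding fd_modules_iff by (auto simp: arc_supp_def)
qed

lemma arcmod_in_torsion_class_imp:
  assumes "torsion_class n T" "M \<in> T" "\<alpha> \<in> nc_arcs n" "is_factor_module (RA n) (arcmod n \<alpha>) M"
  shows "arcmod n \<alpha> \<in> T"
  using assms arcmod_fd unfolding torsion_class_def by blast

lemma torsion_class_extension:
  assumes "torsion_class n T" "L \<in> T" "N \<in> T" "M \<in> fd_modules n" "is_extension (RA n) L M N"
  shows "M \<in> T"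
  using assms unfolding torsion_class_def by blast

text \<open>Induction on the size of a spanning set, splitting off one arc module as a direct summand.\<close>

lemma mem_torsion_class_if_arc_factors:
  fixes T :: "'k::field RA_module set"
  assumes T: "torsion_class n T" and M: "M \<in> fd_modules n"
    and arcs: "\<And>\<alpha>. \<alpha> \<in> nc_arcs n \<Longrightarrow> is_factor_module (RA n) (arcmod n \<alpha>) M \<Longrightarrow> arcmod n \<alpha> \<in> T"
  shows "M \<in> T"
proof -
  have "M \<in> T" if "RA_mod n M" "finite B" "B \<subseteq> carrier M" "carrier M \<subseteq> RA_mod.kspan n M B"
    "\<And>\<alpha>. \<alpha> \<in> nc_arcs n \<Longrightarrow> is_factor_module (RA n) (arcmod n \<alpha>) M \<Longrightarrow> arcmod n \<alpha> \<in> T"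
    for B and M :: "'k RA_module"
    using that
  proof (induction "card B" arbitrary: M B rule: less_induct)
    case less
    interpret M: RA_mod n M by (rule less.prems(1))
    note B = less.prems(2-4)
    have Mfd: "M \<in> fd_modules n" using less.prems by (auto simp: fd_modules_iff)
    show ?case
    proof (cases "carrier M = {\<zero>\<^bsub>M\<^esub>}")
      case True
      with T Mfd show ?thesis by (rule zero_module_in_torsion_class)
    next
      case False
      then obtain \<alpha> g h where \<alpha>: "\<alpha> \<in> nc_arcs n" and g: "g \<in> left_module_hom (RA n) (arcmod n \<alpha>) M"
        and h: "h \<in> left_module_hom (RA n) M (arcmod n \<alpha>)"
        and hg: "\<And>v. v \<in> carrier (arcmod n \<alpha>) \<Longrightarrow> h (g v) = v"
        using M.ex_retract by blast
      let ?N = "arcmod n \<alpha> :: 'k RA_module"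
      interpret N: RA_mod n ?N using \<alpha> by (rule RA_mod_arcmod)
      \<comment> \<open>The projection onto the kernel of \<open>h\<close>, a complement of the
        summand; its image \<open>?M'\<close> is the module left for the induction.\<close>
      define q where "q x = x \<ominus>\<^bsub>M\<^esub> g (h x)" for x
      have gh: "(\<lambda>x. g (h x)) \<in> left_module_hom (RA n) M M" by (rule hom_comp[OF h g])
      note ghc = hom_closed[OF gh]
      have q: "q \<in> left_module_hom (RA n) M M"
        unfolding left_module_hom_def
      proof (intro CollectI conjI ballI Pi_I)
        show "q x \<in> carrier M" if "x \<in> carrier M" for x
          using that ghc[OF that] by (simp add: q_def)
        show "q (x \<oplus>\<^bsub>M\<^esub> y) = q x \<oplus>\<^bsub>M\<^esub> q y" if "x \<in> carrier M" "y \<in> carrier M" for x y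
          using that ghc[OF that(1)] ghc[OF that(2)]
          by (simp add: q_def hom_add[OF gh] M.minus_eq M.minus_add M.a_ac)
        show "q (r \<odot>\<^bsub>M\<^esub> x) = r \<odot>\<^bsub>M\<^esub> q x" if "r \<in> carrier (RA n)" "x \<in> carrier M" for r x
          using that ghc[OF that(2)]
          by (simp add: q_def hom_smult[OF gh] M.minus_eq M.smult_r_distr M.smult_minus M.smult_closed)
      qed
      let ?M' = "M\<lparr>carrier := q ` carrier M\<rparr>"
      have M': "RA_mod n ?M'" by (rule RA_mod_image[OF q M.RA_mod_axioms M.RA_mod_axioms])
      interpret M': RA_mod n ?M' by (rule M')
      have q': "q \<in> left_module_hom (RA n) M ?M'" using q by (auto simp: left_module_hom_def)
      define v :: "nat \<Rightarrow> 'k" where "v i = (if i = top_end \<alpha> then 1 else 0)" for i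
      have v: "v \<in> carrier ?N" "v \<noteq> \<zero>\<^bsub>?N\<^esub>"
        using \<alpha> by (auto simp: v_def arcmod_simps arc_supp_def nc_arcs_def fun_eq_iff)
      have yc: "g v \<in> carrier M" by (rule hom_closed[OF g v(1)])
      have y: "g v \<noteq> \<zero>\<^bsub>M\<^esub>"
        using hg[OF v(1)] v(2) hom_zero[OF h M.RA_mod_axioms N.RA_mod_axioms] by auto
      have qy: "q (g v) = \<zero>\<^bsub>M\<^esub>" using yc by (simp add: q_def hg[OF v(1)] M.minus_eq M.r_neg)
      have "g v \<in> RA_mod.kspan n M B" using yc B(3) by blast
      then obtain b where b: "b \<in> B" "b \<in> RA_mod.kspan n M (insert (g v) (B - {b}))"
        using M.kspan_exchange[OF B(1,2) _ y] by blast
      \<comment> \<open>After the exchange the spanning set contains \<open>g v\<close>, which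
        \<open>q\<close> kills; the images of the other elements span \<open>?M'\<close>, and there
        are at least one fewer of them.\<close>
      let ?C = "insert (g v) (B - {b})"
      have C: "?C \<subseteq> carrier M" using yc B(2) by auto
      have "RA_mod.kspan n M B \<subseteq> RA_mod.kspan n M ?C"
        using b by (intro M.kspan_minimal M.subsp_kspan C subsetI) (metis M.kspan_base Diff_iff insertCI singletonD)
      then have C2: "carrier M \<subseteq> RA_mod.kspan n M ?C" using B(3) by blast
      let ?B' = "q ` (B - {b})"
      have B': "?B' \<subseteq> carrier ?M'" using B(2) by auto
      have "q ` ?C \<subseteq> M'.kspan ?B'"
      proof (rule image_subsetI)
        fix x assume "x \<in> ?C"
        then show "q x \<in> M'.kspan ?B'" using M'.kspan_base[of "q x" ?B'] M'.kspanD(2)[OF B'] qy by auto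
      qed
      then have sub: "M'.kspan (q ` ?C) \<subseteq> M'.kspan ?B'"
        by (intro M'.kspan_minimal M'.subsp_kspan B')
      have span: "carrier ?M' \<subseteq> M'.kspan ?B'"
        using kspan_hom[OF q' M.RA_mod_axioms M' C] C2 sub by auto
      have fac: "is_factor_module (RA n) ?M' M"
        unfolding is_factor_module_def using q' by (intro bexI[of _ q]) auto
      have "card ?B' < card B"
        using b(1) B(1) by (meson card_Diff1_less card_image_le finite_Diff order_le_less_trans)
      then have "?M' \<in> T"
        using less.hyps[OF _ M' _ B' span] less.prems(5) factor_trans[OF fac] B(1) by blast
      moreover have "?N \<in> T"
        using h hg hom_closed[OF g] hom_closed[OF h]
        by (intro less.prems(5)[OF \<alpha>]) (force simp: is_factor_module_def intro!: bexI[of _ h])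
      moreover have "is_extension (RA n) ?N M ?M'"
        unfolding is_extension_def
      proof (intro bexI[OF _ g] bexI[OF _ q'] conjI)
        show "inj_on g (carrier ?N)" by (rule inj_on_inverseI[of _ h]) (rule hg)
        show "g ` carrier ?N = {x \<in> carrier M. q x = \<zero>\<^bsub>?M'\<^esub>}"
        proof (intro equalityI subsetI)
          fix x assume "x \<in> g ` carrier ?N"
          then obtain u where u: "u \<in> carrier ?N" "x = g u" by blast
          have "g u \<in> carrier M" by (rule hom_closed[OF g u(1)])
          then show "x \<in> {x \<in> carrier M. q x = \<zero>\<^bsub>?M'\<^esub>}"
            using u by (simp add: q_def hg M.minus_eq M.r_neg)
        next
          fix x assume "x \<in> {x \<in> carrier M. q x = \<zero>\<^bsub>?M'\<^esub>}"
          then have x: "x \<in> carrier M" "x \<ominus>\<^bsub>M\<^esub> g (h x) = \<zero>\<^bsub>M\<^esub>" by (auto simp: q_def)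
          have "x = g (h x)" by (rule M.eq_if_diff_zero[OF x(1) ghc[OF x(1)] x(2)])
          then show "x \<in> g ` carrier ?N" using hom_closed[OF h x(1)] by blast
        qed
      qed simp
      ultimately show ?thesis using torsion_class_extension[OF T] Mfd by blast
    qed
  qed
  then show ?thesis using M arcs unfolding fd_modules_iff by blast
qed

section \<open>Torsion classes defined by a module\<close>

lemma hom_factor_through:
  assumes mods: "RA_mod n M" "RA_mod n N" "RA_mod n B"
    and g: "g \<in> left_module_hom (RA n) M N" "g ` carrier M = carrier N"
    and \<phi>: "\<phi> \<in> left_module_hom (RA n) M B" "\<And>x. x \<in> carrier M \<Longrightarrow> g x = \<zero>\<^bsub>N\<^esub> \<Longrightarrow> \<phi> x = \<zero>\<^bsub>B\<^esub>"
  obtains \<chi> where "\<chi> \<in> left_module_hom (RA n) N B" "\<And>x. x \<in> carrier M \<Longrightarrow> \<chi> (g x) = \<phi> x"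
proof -
  interpret M: RA_mod n M by fact
  interpret N: RA_mod n N by fact
  interpret B: RA_mod n B by fact
  define \<chi> where "\<chi> y = \<phi> (SOME x. x \<in> carrier M \<and> g x = y)" for y
  have \<chi>: "\<chi> (g x) = \<phi> x" if x: "x \<in> carrier M" for x
  proof -
    define x' where "x' = (SOME z. z \<in> carrier M \<and> g z = g x)"
    have x': "x' \<in> carrier M" "g x' = g x"
      using someI[of "\<lambda>z. z \<in> carrier M \<and> g z = g x" x] x unfolding x'_def by auto
    have "g (x' \<ominus>\<^bsub>M\<^esub> x) = \<zero>\<^bsub>N\<^esub>"
      unfolding hom_diff[OF g(1) mods(1,2) x'(1) x] x'(2)
      using hom_closed[OF g(1) x] by (simp add: N.minus_eq N.r_neg)
    then have "\<phi> x' \<ominus>\<^bsub>B\<^esub> \<phi> x = \<zero>\<^bsub>B\<^esub>"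
      using \<phi>(2)[of "x' \<ominus>\<^bsub>M\<^esub> x"] x x' hom_diff[OF \<phi>(1) mods(1,3) x'(1) x] by simp
    then show ?thesis
      using hom_closed[OF \<phi>(1)] x x' B.eq_if_diff_zero unfolding \<chi>_def x'_def[symmetric] by blast
  qed
  have "\<chi> \<in> left_module_hom (RA n) N B"
    unfolding left_module_hom_def
  proof (intro CollectI conjI ballI Pi_I)
    fix y assume y: "y \<in> carrier N"
    obtain x where x: "x \<in> carrier M" "y = g x" using y g(2) by auto
    show "\<chi> y \<in> carrier B" using x \<chi> hom_closed[OF \<phi>(1)] by simp
    show "\<chi> (r \<odot>\<^bsub>N\<^esub> y) = r \<odot>\<^bsub>B\<^esub> \<chi> y" if r: "r \<in> carrier (RA n)" for r
    proof -
      have "\<chi> (r \<odot>\<^bsub>N\<^esub> y) = \<chi> (g (r \<odot>\<^bsub>M\<^esub> x))" using x r by (simp add: hom_smult[OF g(1)])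
      then show ?thesis using x r by (simp add: \<chi> M.smult_closed hom_smult[OF \<phi>(1)])
    qed
    fix y' assume y': "y' \<in> carrier N"
    obtain x' where x': "x' \<in> carrier M" "y' = g x'" using y' g(2) by auto
    have "\<chi> (y \<oplus>\<^bsub>N\<^esub> y') = \<chi> (g (x \<oplus>\<^bsub>M\<^esub> x'))" using x x' by (simp add: hom_add[OF g(1)])
    then show "\<chi> (y \<oplus>\<^bsub>N\<^esub> y') = \<chi> y \<oplus>\<^bsub>B\<^esub> \<chi> y'" using x x' by (simp add: \<chi> hom_add[OF \<phi>(1)])
  qed
  then show ?thesis using \<chi> that by blast
qed

text \<open>An isomorphism makes its target a factor, so closure under isomorphisms follows from
  closure under factors.\<close>

lemma torsion_classI:
  assumes "T \<subseteq> fd_modules n" "T \<noteq> {}"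
    and fac: "\<And>M N. M \<in> T \<Longrightarrow> N \<in> fd_modules n \<Longrightarrow> is_factor_module (RA n) N M \<Longrightarrow> N \<in> T"
    and "\<And>L M N. L \<in> T \<Longrightarrow> N \<in> T \<Longrightarrow> M \<in> fd_modules n \<Longrightarrow> is_extension (RA n) L M N \<Longrightarrow> M \<in> T"
  shows "torsion_class n T"
proof -
  have "is_factor_module (RA n) N M" if "module_isomorphic (RA n) M N" for M N :: "'a RA_module"
    using that by (auto simp: module_isomorphic_def is_factor_module_def bij_betw_def)
  then show ?thesis using assms unfolding torsion_class_def by blast
qed

definition zero_hom :: "nat \<Rightarrow> 'k::field RA_module \<Rightarrow> 'k RA_module \<Rightarrow> ((nat \<Rightarrow> 'k) \<Rightarrow> nat \<Rightarrow> 'k) \<Rightarrow> bool" where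
  "zero_hom n M B f \<longleftrightarrow> (\<forall>x \<in> carrier M. f x = \<zero>\<^bsub>B\<^esub>)"

definition perp :: "nat \<Rightarrow> 'k::field RA_module \<Rightarrow> 'k RA_module set" where
  "perp n B = {M \<in> fd_modules n. \<forall>f \<in> left_module_hom (RA n) M B. zero_hom n M B f}"

definition zero_or_surj :: "nat \<Rightarrow> 'k::field RA_module \<Rightarrow> 'k RA_module set" where
  "zero_or_surj n B = {M \<in> fd_modules n. \<forall>f \<in> left_module_hom (RA n) M B.
    zero_hom n M B f \<or> f ` carrier M = carrier B}"

text \<open>The flag \<open>surj\<close> treats \<open>perp\<close> and \<open>zero_or_surj\<close>
  together. For an extension of \<open>N\<close> by \<open>L\<close>, a map to \<open>B\<close>
  vanishing on \<open>L\<close> factors through \<open>N\<close>; otherwise its restriction to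
  \<open>L\<close> is nonzero, hence \<open>surj\<close> holds and the restriction is onto, and so
  is the map.\<close>

lemma torsion_class_hom_property:
  fixes B :: "'k::field RA_module" and surj :: bool
  assumes B: "RA_mod n B"
  shows "torsion_class n {M \<in> fd_modules n. \<forall>f \<in> left_module_hom (RA n) M B.
    zero_hom n M B f \<or> surj \<and> f ` carrier M = carrier B}" (is "torsion_class n ?T")
proof (rule torsion_classI)
  have RM: "RA_mod n M" if "M \<in> fd_modules n" for M :: "'k RA_module" using that by (simp add: fd_modules_iff)
  obtain Z :: "'k RA_module" where Z: "Z \<in> fd_modules n" "carrier Z = {\<zero>\<^bsub>Z\<^esub>}"
    using ex_zero_module by blast
  then have "Z \<in> ?T" using hom_zero[OF _ RM[OF Z(1)] B] by (auto simp: zero_hom_def)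
  then show "?T \<noteq> {}" by blast
  show "N \<in> ?T" if M: "M \<in> ?T" and N: "N \<in> fd_modules n" "is_factor_module (RA n) N M" for M N
  proof -
    obtain q where q: "q \<in> left_module_hom (RA n) M N" "q ` carrier M = carrier N"
      using N(2) by (auto simp: is_factor_module_def)
    have "zero_hom n N B f \<or> surj \<and> f ` carrier N = carrier B" if f: "f \<in> left_module_hom (RA n) N B" for f
      using hom_comp[OF q(1) f] M q(2)[symmetric] by (auto simp: zero_hom_def image_image)
    then show ?thesis using N(1) by blast
  qed
  show "M \<in> ?T" if LN: "L \<in> ?T" "N \<in> ?T" and M: "M \<in> fd_modules n" and ext: "is_extension (RA n) L M N" for L M N
  proof -
    obtain i q where i: "i \<in> left_module_hom (RA n) L M" and q: "q \<in> left_module_hom (RA n) M N"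
      "q ` carrier M = carrier N" and ker: "i ` carrier L = {x \<in> carrier M. q x = \<zero>\<^bsub>N\<^esub>}"
      using ext by (auto simp: is_extension_def)
    have LNfd: "L \<in> fd_modules n" "N \<in> fd_modules n" using LN by auto
    have "zero_hom n M B f \<or> surj \<and> f ` carrier M = carrier B" if f: "f \<in> left_module_hom (RA n) M B" for f
    proof (cases "zero_hom n L B (\<lambda>x. f (i x))")
      case True
      have "f x = \<zero>\<^bsub>B\<^esub>" if "x \<in> carrier M" "q x = \<zero>\<^bsub>N\<^esub>" for x
      proof -
        have "x \<in> i ` carrier L" unfolding ker using that by blast
        then show ?thesis using True by (auto simp: zero_hom_def)
      qed
      then obtain f' where f': "f' \<in> left_module_hom (RA n) N B" "\<And>x. x \<in> carrier M \<Longrightarrow> f' (q x) = f x"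
        using hom_factor_through[OF RM[OF M] RM[OF LNfd(2)] B q f] by blast
      then have "zero_hom n N B f' \<or> surj \<and> f' ` carrier N = carrier B" using LN(2) by blast
      then show ?thesis using f'(2) q(2)[symmetric] by (auto simp: zero_hom_def image_image)
    next
      case False
      have "(\<lambda>x. f (i x)) \<in> left_module_hom (RA n) L B" by (rule hom_comp[OF i f])
      then have s: "surj" "(\<lambda>x. f (i x)) ` carrier L = carrier B" using LN(1) False by auto
      have "carrier B \<subseteq> f ` carrier M" using s(2)[symmetric] hom_closed[OF i] by auto
      moreover have "f ` carrier M \<subseteq> carrier B" using hom_closed[OF f] by blast
      ultimately show ?thesis using s(1) by blast
    qed
    then show ?thesis using M by blast
  qed
qed auto

lemma torsion_class_perp: "RA_mod n B \<Longrightarrow> torsion_class n (perp n B)"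
  using torsion_class_hom_property[of n B False] by (simp add: perp_def)

lemma torsion_class_zero_or_surj: "RA_mod n B \<Longrightarrow> torsion_class n (zero_or_surj n B)"
  using torsion_class_hom_property[of n B True] by (simp add: zero_or_surj_def)

section \<open>Homomorphisms between arc modules\<close>

text \<open>
  The interval \<open>{c <.. d}\<close> supports a factor of the module of \<open>\<alpha>\<close> that is also a submodule of the
  module of \<open>\<beta>\<close>.
\<close>

definition overlap :: "nc_arc \<Rightarrow> nc_arc \<Rightarrow> nat \<Rightarrow> nat \<Rightarrow> bool" where
  "overlap \<alpha> \<beta> c d \<longleftrightarrow> c < d \<and> bot_end \<alpha> \<le> c \<and> bot_end \<beta> \<le> c \<and> d \<le> top_end \<alpha> \<and> d \<le> top_end \<beta> \<and>
    (\<forall>i. c < i \<and> i < d \<longrightarrow> side \<alpha> i = side \<beta> i) \<and>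
    side \<alpha> c \<le> 0 \<and> 0 \<le> side \<beta> c \<and> 0 \<le> side \<alpha> d \<and> side \<beta> d \<le> 0"

text \<open>At \<open>c\<close> the side is both at most and at least 0, so \<open>c\<close> is an
  end of the arc; likewise \<open>d\<close>. On modules: nonzero endomorphisms are
  bijective.\<close>

lemma overlap_self: "overlap \<alpha> \<alpha> c d \<Longrightarrow> c = bot_end \<alpha> \<and> d = top_end \<alpha>"
  by (auto simp: overlap_def side_def split: if_splits)

lemma overlap_antisym:
  assumes mem: "\<alpha> \<in> nc_arcs n" "\<beta> \<in> nc_arcs n"
    and ov: "overlap \<alpha> \<beta> (bot_end \<beta>) (top_end \<beta>)" and ends: "bot_end \<beta> = bot_end \<alpha>" "top_end \<beta> = top_end \<alpha>"
  shows "\<alpha> = \<beta>"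
proof -
  have "i \<in> right_of \<alpha> \<longleftrightarrow> i \<in> right_of \<beta>" for i
  proof (cases "bot_end \<alpha> < i \<and> i < top_end \<alpha>")
    case True
    then have "side \<alpha> i = side \<beta> i" using ov ends by (auto simp: overlap_def)
    then show ?thesis using True ends by (auto simp: side_def split: if_splits)
  qed (use mem ends in \<open>auto simp: nc_arcs_def\<close>)
  then have "right_of \<alpha> = right_of \<beta>" by blast
  then show ?thesis using ends by (simp add: nc_arc.equality)
qed

text \<open>Vertex spaces have dimension at most one, so \<open>f\<close> is diagonal with entries
  \<open>\<mu> i\<close>. Commuting with the arrows ties neighbouring entries together; the maximal
  run of nonzero entries around \<open>k\<close> is the overlap, its end conditions coming from the
  arrows between a zero and a nonzero entry.\<close>

lemma arc_hom_overlap: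
  fixes f :: "(nat \<Rightarrow> 'k::field) \<Rightarrow> nat \<Rightarrow> 'k"
  assumes \<alpha>: "\<alpha> \<in> nc_arcs n" and \<beta>: "\<beta> \<in> nc_arcs n"
    and f: "f \<in> left_module_hom (RA n) (arcmod n \<alpha>) (arcmod n \<beta>)"
    and x: "x \<in> carrier (arcmod n \<alpha>)" "f x k \<noteq> 0"
  obtains \<mu> c d where "overlap \<alpha> \<beta> c d" "c < k" "k \<le> d"
    "\<And>x i. x \<in> carrier (arcmod n \<alpha>) \<Longrightarrow> f x i = \<mu> i * x i"
    "\<And>i. c < i \<Longrightarrow> i \<le> d \<Longrightarrow> \<mu> i \<noteq> (0 :: 'k)" "\<mu> c = 0" "\<mu> (d + 1) = 0"
proof -
  let ?M = "arcmod n \<alpha> :: 'k RA_module" and ?N = "arcmod n \<beta> :: 'k RA_module"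
  have RM: "RA_mod n ?M" and RN: "RA_mod n ?N" using \<alpha> \<beta> by (simp_all add: RA_mod_arcmod)
  define e :: "nat \<Rightarrow> nat \<Rightarrow> 'k" where "e i = (\<lambda>j. if j = i then 1 else 0)" for i
  have e: "e i \<in> carrier ?M" if "i \<in> arc_supp \<alpha>" for i using that by (auto simp: e_def arcmod_simps)
  define \<mu> where "\<mu> i = (if i \<in> arc_supp \<alpha> then f (e i) i else 0)" for i
  have f0: "f (\<lambda>_. 0) = (\<lambda>_. 0)" using hom_zero[OF f RM RN] by (simp add: arcmod_simps)
  have supp: "\<mu> i = 0" if "i \<notin> arc_supp \<alpha> \<inter> arc_supp \<beta>" for i
    using that hom_closed[OF f e, of i] by (auto simp: \<mu>_def arcmod_simps)
  have eig: "f x i = \<mu> i * x i" if x: "x \<in> carrier ?M" for x i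
  proof (cases "i \<in> arc_supp \<beta>")
    case False
    then show ?thesis using hom_closed[OF f x] supp[of i] by (auto simp: arcmod_simps)
  next
    case True
    then have i: "i \<in> {1..n}" using arc_supp_subset[OF \<beta>] by blast
    have "f x i = (vx n i \<odot>\<^bsub>?N\<^esub> f x) i" by (simp add: arcmod_gens(1)[OF i])
    also have "\<dots> = f (vx n i \<odot>\<^bsub>?M\<^esub> x) i" using hom_smult[OF f gen_closed(1)[OF i] x] by simp
    also have "\<dots> = \<mu> i * x i"
    proof (cases "i \<in> arc_supp \<alpha>")
      case True
      have "vx n i \<odot>\<^bsub>?M\<^esub> x = RA_scalar n (x i) \<odot>\<^bsub>?M\<^esub> e i"
        unfolding arcmod_gens(1)[OF i] arcmod_scalar[OF \<alpha> e[OF True]] by (auto simp: e_def)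
      then show ?thesis
        using hom_smult[OF f RA_scalar_closed e[OF True], of "x i"] hom_closed[OF f e[OF True]] True
        by (simp add: arcmod_scalar[OF \<beta>] \<mu>_def)
    next
      case False
      then have "vx n i \<odot>\<^bsub>?M\<^esub> x = (\<lambda>_. 0)" using x unfolding arcmod_gens(1)[OF i] by (auto simp: arcmod_simps)
      then show ?thesis using f0 False by (simp add: \<mu>_def)
    qed
    finally show ?thesis .
  qed
  \<comment> \<open>Compares applying $a_i$ before and after \<open>f\<close> on the basis vector at
    \<open>i\<close>; \<open>rel2\<close> does the same with $a_i^*$ and the basis vector at
    \<open>i + 1\<close>.\<close>
  have rel1: "(if side \<alpha> i = 1 then \<mu> (i + 1) else 0) = (if side \<beta> i = 1 then \<mu> i else 0)" if i: "i \<in> {1..<n}" for i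
  proof (cases "i \<in> arc_supp \<alpha>")
    case True
    have "f (fw n i \<odot>\<^bsub>?M\<^esub> e i) (i + 1) = (fw n i \<odot>\<^bsub>?N\<^esub> f (e i)) (i + 1)"
      using hom_smult[OF f gen_closed(2)[OF i] e[OF True]] by simp
    moreover have "fw n i \<odot>\<^bsub>?M\<^esub> e i = (if side \<alpha> i = 1 then e (i + 1) else (\<lambda>_. 0))"
      unfolding arcmod_gens(2)[OF i] by (auto simp: e_def)
    moreover have "side \<alpha> i = 1 \<Longrightarrow> i + 1 \<in> arc_supp \<alpha>" by (auto simp: side_def arc_supp_def split: if_splits)
    ultimately show ?thesis using f0 True by (auto simp: arcmod_gens(2)[OF i] \<mu>_def split: if_splits)
  next
    case False
    then have "side \<alpha> i \<noteq> 1" by (auto simp: side_def arc_supp_def)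
    then show ?thesis using False by (simp add: \<mu>_def)
  qed
  have rel2: "(if side \<alpha> i = - 1 then \<mu> i else 0) = (if side \<beta> i = - 1 then \<mu> (i + 1) else 0)" if i: "i \<in> {1..<n}" for i
  proof (cases "i + 1 \<in> arc_supp \<alpha>")
    case True
    have "f (bw n i \<odot>\<^bsub>?M\<^esub> e (i + 1)) i = (bw n i \<odot>\<^bsub>?N\<^esub> f (e (i + 1))) i"
      using hom_smult[OF f gen_closed(3)[OF i] e[OF True]] by simp
    moreover have "bw n i \<odot>\<^bsub>?M\<^esub> e (i + 1) = (if side \<alpha> i = - 1 then e i else (\<lambda>_. 0))"
      unfolding arcmod_gens(3)[OF i] by (auto simp: e_def)
    moreover have "side \<alpha> i = - 1 \<Longrightarrow> i \<in> arc_supp \<alpha>" by (auto simp: side_def arc_supp_def split: if_splits)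
    ultimately show ?thesis using f0 True by (auto simp: arcmod_gens(3)[OF i] \<mu>_def split: if_splits)
  next
    case False
    then have "side \<alpha> i \<noteq> - 1" by (auto simp: side_def arc_supp_def)
    then show ?thesis using False by (simp add: \<mu>_def)
  qed
  have k: "\<mu> k \<noteq> 0" using eig[OF x(1), of k] x(2) by auto
  have in_supp: "i \<in> arc_supp \<alpha>" "i \<in> arc_supp \<beta>" if "\<mu> i \<noteq> 0" for i using supp[of i] that by auto
  have \<mu>0: "\<mu> 0 = 0" by (rule supp) (simp add: arc_supp_def)
  have \<mu>n: "\<mu> (n + 1) = 0" using \<alpha> by (intro supp) (simp add: arc_supp_def nc_arcs_def)
  have kn: "0 < k" "k \<le> n" using in_supp[OF k] \<alpha> by (auto simp: arc_supp_def nc_arcs_def)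
  \<comment> \<open>\<open>c\<close> is the last zero of \<open>\<mu>\<close> below \<open>k\<close>
    and \<open>d + 1\<close> the first one above; they exist because \<open>\<mu>\<close> vanishes
    at 0 and at \<open>n + 1\<close>.\<close>
  define c where "c = Max {i. i < k \<and> \<mu> i = 0}"
  have cset: "finite {i. i < k \<and> \<mu> i = 0}" "{i. i < k \<and> \<mu> i = 0} \<noteq> {}" using \<mu>0 kn by auto
  have c: "c < k" "\<mu> c = 0" using Max_in[OF cset] by (auto simp: c_def)
  have c_max: "\<mu> i \<noteq> 0" if "c < i" "i \<le> k" for i
  proof
    assume "\<mu> i = 0"
    moreover from this have "i \<noteq> k" using k by auto
    ultimately have "i \<in> {i. i < k \<and> \<mu> i = 0}" using that by simp
    then have "i \<le> c" unfolding c_def by (rule Max_ge[OF cset(1)])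
    then show False using that by simp
  qed
  define d where "d = (LEAST d. k \<le> d \<and> \<mu> (d + 1) = 0)"
  have d: "k \<le> d \<and> \<mu> (d + 1) = 0" unfolding d_def by (rule LeastI[of _ n]) (use kn \<mu>n in auto)
  have d_min: "\<mu> i \<noteq> 0" if "k \<le> i" "i \<le> d" for i
  proof (cases "i = k")
    case False
    then show ?thesis using not_less_Least[of "i - 1" "\<lambda>d. k \<le> d \<and> \<mu> (d + 1) = 0"] that by (auto simp: d_def)
  qed (use k in simp)
  have nz: "\<mu> i \<noteq> 0" if "c < i" "i \<le> d" for i using c_max[of i] d_min[of i] that by (cases "i \<le> k") auto
  have cd: "c < d" using c(1) d by linarith
  have bounds: "bot_end \<alpha> \<le> c" "bot_end \<beta> \<le> c" "d \<le> top_end \<alpha>" "d \<le> top_end \<beta>"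
    using in_supp[OF nz[of "c + 1"]] in_supp[OF nz[of d]] cd by (auto simp: arc_supp_def)
  have dn: "d \<le> n" using bounds(3) \<alpha> by (simp add: nc_arcs_def)
  have side_cases: "side \<gamma> i \<in> {- 1, 0, 1}" for \<gamma> i by (auto simp: side_def)
  have "overlap \<alpha> \<beta> c d"
    unfolding overlap_def
  proof (intro conjI allI impI)
    fix i assume i: "c < i \<and> i < d"
    then have "i \<in> {1..<n}" "\<mu> i \<noteq> 0" "\<mu> (i + 1) \<noteq> 0" using dn nz by auto
    then show "side \<alpha> i = side \<beta> i"
      using rel1[of i] rel2[of i] side_cases[of \<alpha> i] side_cases[of \<beta> i] by (auto split: if_splits)
  next
    have "side \<gamma> 0 = 0" for \<gamma> by (simp add: side_def)
    then show "side \<alpha> c \<le> 0" "0 \<le> side \<beta> c"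
      using rel1[of c] rel2[of c] c(2) nz[of "c + 1"] cd dn side_cases[of \<alpha> c] side_cases[of \<beta> c]
      by (cases "c = 0"; auto split: if_splits)+
  next
    have "side \<gamma> d = 0" if "d = n" "\<gamma> \<in> nc_arcs n" for \<gamma> using that by (auto simp: side_def nc_arcs_def)
    then show "0 \<le> side \<alpha> d" "side \<beta> d \<le> 0"
      using rel1[of d] rel2[of d] d nz[of d] cd dn side_cases[of \<alpha> d] side_cases[of \<beta> d] \<alpha> \<beta>
      by (cases "d = n"; auto split: if_splits)+
  qed (use cd bounds in auto)
  then show ?thesis using c d eig nz by (intro that[of c d \<mu>]) auto
qed

text \<open>Truncation to the interval respects the arrows at its ends: in \<alpha> they lead out of
  it, where the result is cut off, and in \<beta> into it, from coordinates that are already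
  0.\<close>

lemma overlap_hom:
  assumes \<alpha>: "\<alpha> \<in> nc_arcs n" and \<beta>: "\<beta> \<in> nc_arcs n" and ov: "overlap \<alpha> \<beta> c d"
  shows "(\<lambda>x i. if c < i \<and> i \<le> d then x i else (0 :: 'k::field)) \<in> left_module_hom (RA n) (arcmod n \<alpha>) (arcmod n \<beta>)"
    (is "?f \<in> _")
proof (rule left_module_homI)
  let ?M = "arcmod n \<alpha> :: 'k RA_module" and ?N = "arcmod n \<beta> :: 'k RA_module"
  show "left_module (RA n) ?M" "left_module (RA n) ?N" using \<alpha> \<beta> by (simp_all add: left_module_arcmod)
  show cl: "?f x \<in> carrier ?N" for x using ov by (auto simp: arcmod_simps overlap_def arc_supp_def)
  show "?f (x \<oplus>\<^bsub>?M\<^esub> y) = ?f x \<oplus>\<^bsub>?N\<^esub> ?f y" for x y by (auto simp: arcmod_simps)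
  show "?f (RA_scalar n a \<odot>\<^bsub>?M\<^esub> x) = RA_scalar n a \<odot>\<^bsub>?N\<^esub> ?f x" if "x \<in> carrier ?M" for a x
    unfolding arcmod_scalar[OF \<alpha> that] arcmod_scalar[OF \<beta> cl] by auto
  show "?f (vx n i \<odot>\<^bsub>?M\<^esub> x) = vx n i \<odot>\<^bsub>?N\<^esub> ?f x" if "i \<in> {1..n}" for i x
    unfolding arcmod_gens(1)[OF that] by auto
  have 1: "c < j + 1 \<and> j + 1 \<le> d \<and> side \<alpha> j = 1 \<longleftrightarrow> c < j \<and> j \<le> d \<and> side \<beta> j = 1" for j
    using ov unfolding overlap_def by (cases "j = c"; cases "j = d"; cases "c < j \<and> j < d") auto
  have 2: "c < j \<and> j \<le> d \<and> side \<alpha> j = - 1 \<longleftrightarrow> c < j + 1 \<and> j + 1 \<le> d \<and> side \<beta> j = - 1" for j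
    using ov unfolding overlap_def by (cases "j = c"; cases "j = d"; cases "c < j \<and> j < d") auto
  show "?f (fw n j \<odot>\<^bsub>?M\<^esub> x) = fw n j \<odot>\<^bsub>?N\<^esub> ?f x" if "j \<in> {1..<n}" for j x
    unfolding arcmod_gens(2)[OF that] using 1[of j] by (intro ext) auto
  show "?f (bw n j \<odot>\<^bsub>?M\<^esub> x) = bw n j \<odot>\<^bsub>?N\<^esub> ?f x" if "j \<in> {1..<n}" for j x
    unfolding arcmod_gens(3)[OF that] using 2[of j] by (intro ext) auto
qed

lemma perpD:
  assumes "M \<in> perp n B" "f \<in> left_module_hom (RA n) M B" "x \<in> carrier M"
  shows "f x = \<zero>\<^bsub>B\<^esub>"
proof -
  have "\<forall>f \<in> left_module_hom (RA n) M B. zero_hom n M B f" using assms(1) by (simp add: perp_def)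
  then have "zero_hom n M B f" using assms(2) by (rule bspec)
  then show ?thesis using assms(3) by (simp add: zero_hom_def)
qed

lemma arcmod_perp:
  assumes "\<alpha> \<in> nc_arcs n" "\<beta> \<in> nc_arcs n"
  shows "(arcmod n \<alpha> :: 'k::field RA_module) \<in> perp n (arcmod n \<beta>) \<longleftrightarrow> (\<forall>c d. \<not> overlap \<alpha> \<beta> c d)"
proof
  let ?M = "arcmod n \<alpha> :: 'k RA_module" and ?N = "arcmod n \<beta> :: 'k RA_module"
  assume perp: "?M \<in> perp n ?N"
  show "\<forall>c d. \<not> overlap \<alpha> \<beta> c d"
  proof (intro allI notI)
    fix c d assume ov: "overlap \<alpha> \<beta> c d"
    define v :: "nat \<Rightarrow> 'k" where "v i = (if i = d then 1 else 0)" for i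
    have "v \<in> carrier ?M" using ov by (auto simp: v_def arcmod_simps overlap_def arc_supp_def)
    from perpD[OF perp overlap_hom[OF assms ov] this]
    have "(\<lambda>i. if c < i \<and> i \<le> d then v i else 0) = (\<lambda>_. 0)"
      by (simp add: arcmod_simps(2))
    from fun_cong[OF this, of d] show False using ov by (auto simp: v_def overlap_def)
  qed
next
  assume no: "\<forall>c d. \<not> overlap \<alpha> \<beta> c d"
  have "f x = (\<lambda>_. 0)"
    if "f \<in> left_module_hom (RA n) (arcmod n \<alpha>) (arcmod n \<beta>)" "x \<in> carrier (arcmod n \<alpha>)"
    for f :: "(nat \<Rightarrow> 'k) \<Rightarrow> nat \<Rightarrow> 'k" and x
    using arc_hom_overlap[OF assms that] no by (intro ext) metis
  then show "(arcmod n \<alpha> :: 'k RA_module) \<in> perp n (arcmod n \<beta>)"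
    using assms(1) by (auto simp: perp_def zero_hom_def arcmod_simps arcmod_fd)
qed

text \<open>A surjection hits every coordinate of \<beta>, so its diagonal entries vanish nowhere on
  the support and the overlap is all of it. Conversely, truncation to the support of \<beta> is
  onto.\<close>

lemma arcmod_factor:
  assumes \<alpha>: "\<alpha> \<in> nc_arcs n" and \<beta>: "\<beta> \<in> nc_arcs n"
  shows "is_factor_module (RA n) (arcmod n \<beta> :: 'k::field RA_module) (arcmod n \<alpha> :: 'k RA_module) \<longleftrightarrow>
    overlap \<alpha> \<beta> (bot_end \<beta>) (top_end \<beta>)"
proof
  let ?M = "arcmod n \<alpha> :: 'k RA_module" and ?N = "arcmod n \<beta> :: 'k RA_module"
  assume "is_factor_module (RA n) ?N ?M"
  then obtain f where f: "f \<in> left_module_hom (RA n) ?M ?N" "f ` carrier ?M = carrier ?N"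
    unfolding is_factor_module_def by (rule bexE)
  have hit: "\<exists>x \<in> carrier ?M. f x i \<noteq> 0" if "i \<in> arc_supp \<beta>" for i
  proof -
    have "(\<lambda>j. if j = i then 1 else 0) \<in> carrier ?N" using that by (auto simp: arcmod_simps)
    then have "(\<lambda>j. if j = i then 1 else 0) \<in> f ` carrier ?M" by (simp only: f(2))
    then obtain x where x: "(\<lambda>j. if j = i then 1 else 0) = f x" "x \<in> carrier ?M" by (rule imageE)
    then show ?thesis using fun_cong[OF x(1), of i] by (intro bexI[of _ x]) auto
  qed
  have "top_end \<beta> \<in> arc_supp \<beta>" using \<beta> by (simp add: arc_supp_def nc_arcs_def)
  then obtain x where x: "x \<in> carrier ?M" "f x (top_end \<beta>) \<noteq> 0" using hit by blast
  obtain \<mu> c d where *: "overlap \<alpha> \<beta> c d" "top_end \<beta> \<le> d"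
    "\<And>x i. x \<in> carrier ?M \<Longrightarrow> f x i = \<mu> i * x i" "\<mu> c = 0"
    using arc_hom_overlap[OF \<alpha> \<beta> f(1) x] by metis
  have "c \<notin> arc_supp \<beta>" using hit[of c] *(3,4) by auto
  then have "c = bot_end \<beta>" "d = top_end \<beta>" using *(1,2) by (auto simp: overlap_def arc_supp_def)
  then show "overlap \<alpha> \<beta> (bot_end \<beta>) (top_end \<beta>)" using *(1) by simp
next
  let ?M = "arcmod n \<alpha> :: 'k RA_module" and ?N = "arcmod n \<beta> :: 'k RA_module"
  assume ov: "overlap \<alpha> \<beta> (bot_end \<beta>) (top_end \<beta>)"
  let ?f = "\<lambda>x i. if bot_end \<beta> < i \<and> i \<le> top_end \<beta> then x i else (0 :: 'k)"
  note f = overlap_hom[OF assms ov, where 'k = 'k]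
  have "v \<in> ?f ` carrier ?M" if v: "v \<in> carrier ?N" for v
  proof
    show "v = ?f v" using v by (auto simp: arcmod_simps arc_supp_def fun_eq_iff)
    show "v \<in> carrier ?M" using v ov by (auto simp: arcmod_simps arc_supp_def overlap_def)
  qed
  then have "?f ` carrier ?M = carrier ?N" using hom_closed[OF f] by blast
  then show "is_factor_module (RA n) ?N ?M" unfolding is_factor_module_def using f by (rule bexI)
qed

lemma arcmod_zero_or_surj:
  assumes \<alpha>: "\<alpha> \<in> nc_arcs n" and \<beta>: "\<beta> \<in> nc_arcs n"
    and full: "\<And>c d. overlap \<alpha> \<beta> c d \<Longrightarrow> c = bot_end \<beta> \<and> d = top_end \<beta>"
  shows "(arcmod n \<alpha> :: 'k::field RA_module) \<in> zero_or_surj n (arcmod n \<beta>)"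
proof -
  let ?M = "arcmod n \<alpha> :: 'k RA_module" and ?N = "arcmod n \<beta> :: 'k RA_module"
  have "f ` carrier ?M = carrier ?N"
    if f: "f \<in> left_module_hom (RA n) ?M ?N" and nz: "\<not> zero_hom n ?M ?N f" for f
  proof -
    obtain x k where x: "x \<in> carrier ?M" "f x k \<noteq> 0"
      using nz by (auto simp: zero_hom_def arcmod_simps fun_eq_iff)
    obtain \<mu> c d where *: "overlap \<alpha> \<beta> c d" "\<And>x i. x \<in> carrier ?M \<Longrightarrow> f x i = \<mu> i * x i"
      "\<And>i. c < i \<Longrightarrow> i \<le> d \<Longrightarrow> \<mu> i \<noteq> 0"
      using arc_hom_overlap[OF \<alpha> \<beta> f x] by metis
    have nz: "\<mu> i \<noteq> 0" if "i \<in> arc_supp \<beta>" for i using full[OF *(1)] *(3) that by (auto simp: arc_supp_def)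
    have sub: "arc_supp \<beta> \<subseteq> arc_supp \<alpha>" using full[OF *(1)] *(1) by (auto simp: arc_supp_def overlap_def)
    have "v \<in> f ` carrier ?M" if v: "v \<in> carrier ?N" for v
    proof
      \<comment> \<open>Dividing by the diagonal entries gives a preimage; where an entry may be 0,
        outside the support of \<beta>, \<open>v\<close> is 0 as well.\<close>
      let ?x = "\<lambda>i. v i / \<mu> i"
      show x: "?x \<in> carrier ?M" using v sub by (auto simp: arcmod_simps)
      show "v = f ?x"
      proof
        fix i show "v i = f ?x i" using v nz[of i] *(2)[OF x, of i] by (auto simp: arcmod_simps)
      qed
    qed
    then show ?thesis using hom_closed[OF f] by blast
  qed
  then show ?thesis using arcmod_fd[OF \<alpha>] by (auto simp: zero_or_surj_def)
qed

lemma arcmod_extension: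
  assumes \<alpha>: "\<alpha> \<in> nc_arcs n" and \<gamma>: "\<gamma> \<in> nc_arcs n" and \<delta>: "\<delta> \<in> nc_arcs n"
    and sub: "overlap \<gamma> \<alpha> (bot_end \<gamma>) (top_end \<gamma>)" and quot: "overlap \<alpha> \<delta> (bot_end \<delta>) (top_end \<delta>)"
    and disj: "arc_supp \<gamma> \<inter> arc_supp \<delta> = {}" "arc_supp \<alpha> = arc_supp \<gamma> \<union> arc_supp \<delta>"
  shows "is_extension (RA n) (arcmod n \<gamma> :: 'k::field RA_module) (arcmod n \<alpha> :: 'k RA_module) (arcmod n \<delta> :: 'k RA_module)"
proof -
  let ?L = "arcmod n \<gamma> :: 'k RA_module" and ?M = "arcmod n \<alpha> :: 'k RA_module" and ?N = "arcmod n \<delta> :: 'k RA_module"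
  let ?f = "\<lambda>x i. if bot_end \<gamma> < i \<and> i \<le> top_end \<gamma> then x i else (0 :: 'k)"
  let ?g = "\<lambda>x i. if bot_end \<delta> < i \<and> i \<le> top_end \<delta> then x i else (0 :: 'k)"
  have f: "?f \<in> left_module_hom (RA n) ?L ?M" by (rule overlap_hom[OF \<gamma> \<alpha> sub])
  have g: "?g \<in> left_module_hom (RA n) ?M ?N" by (rule overlap_hom[OF \<alpha> \<delta> quot])
  have f_id: "?f x = x" if "x \<in> carrier ?L" for x using that by (auto simp: arcmod_simps arc_supp_def fun_eq_iff)
  have LM: "x \<in> carrier ?M" if "x \<in> carrier ?L" for x using hom_closed[OF f that] f_id[OF that] by simp
  have NM: "x \<in> carrier ?M" if "x \<in> carrier ?N" for x using that disj(2) by (auto simp: arcmod_simps)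
  have "inj_on ?f (carrier ?L)" by (rule inj_onI) (metis f_id)
  moreover have "?g ` carrier ?M = carrier ?N"
  proof
    show "?g ` carrier ?M \<subseteq> carrier ?N" using hom_closed[OF g] by blast
    show "carrier ?N \<subseteq> ?g ` carrier ?M"
    proof
      fix x assume x: "x \<in> carrier ?N"
      then have "x = ?g x" by (auto simp: arcmod_simps arc_supp_def fun_eq_iff)
      then show "x \<in> ?g ` carrier ?M" using NM[OF x] by (rule image_eqI)
    qed
  qed
  moreover have "?f ` carrier ?L = {x \<in> carrier ?M. ?g x = \<zero>\<^bsub>?N\<^esub>}"
  proof (intro equalityI subsetI)
    fix x assume "x \<in> ?f ` carrier ?L"
    then have x: "x \<in> carrier ?L" using f_id by auto
    then have "?g x = \<zero>\<^bsub>?N\<^esub>" using disj(1) by (auto simp: arcmod_simps arc_supp_def fun_eq_iff)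
    then show "x \<in> {x \<in> carrier ?M. ?g x = \<zero>\<^bsub>?N\<^esub>}" using LM[OF x] by simp
  next
    fix x assume x: "x \<in> {x \<in> carrier ?M. ?g x = \<zero>\<^bsub>?N\<^esub>}"
    have "x i = 0" if "i \<notin> arc_supp \<gamma>" for i
    proof (cases "i \<in> arc_supp \<delta>")
      case True
      have "?g x = (\<lambda>_. 0)" using x by (simp add: arcmod_simps(2))
      from fun_cong[OF this, of i] show ?thesis using True by (simp add: arc_supp_def)
    next
      case False
      then show ?thesis using x that disj(2) by (auto simp: arcmod_simps)
    qed
    then have xL: "x \<in> carrier ?L" by (simp add: arcmod_simps)
    show "x \<in> ?f ` carrier ?L" by (rule image_eqI[of _ ?f, OF f_id[OF xL, symmetric] xL])
  qed
  ultimately show ?thesis unfolding is_extension_def using f g by blast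
qed

section \<open>Restricting an arc to an interval of nodes\<close>

definition arc_restrict :: "nc_arc \<Rightarrow> nat \<Rightarrow> nat \<Rightarrow> nc_arc" where
  "arc_restrict \<alpha> c d = \<lparr>bot_end = c, top_end = d, right_of = right_of \<alpha> \<inter> {c <..< d}\<rparr>"

lemma arc_restrict_simps [simp]:
  "bot_end (arc_restrict \<alpha> c d) = c" "top_end (arc_restrict \<alpha> c d) = d"
  by (simp_all add: arc_restrict_def)

lemma side_restrict:
  "bot_end \<alpha> \<le> c \<Longrightarrow> d \<le> top_end \<alpha> \<Longrightarrow> side (arc_restrict \<alpha> c d) i = (if c < i \<and> i < d then side \<alpha> i else 0)"
  by (auto simp: side_def arc_restrict_def)

lemma arc_restrict_nc_arcs:
  "\<alpha> \<in> nc_arcs n \<Longrightarrow> c < d \<Longrightarrow> d \<le> top_end \<alpha> \<Longrightarrow> arc_restrict \<alpha> c d \<in> nc_arcs n"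
  by (auto simp: nc_arcs_def arc_restrict_def)

lemma arc_restrict_self: "\<alpha> \<in> nc_arcs n \<Longrightarrow> arc_restrict \<alpha> (bot_end \<alpha>) (top_end \<alpha>) = \<alpha>"
  by (auto simp: nc_arcs_def arc_restrict_def intro!: nc_arc.equality)

lemma arc_supp_restrict: "arc_supp (arc_restrict \<alpha> c d) = {c <.. d}"
  by (simp add: arc_supp_def)

section \<open>Generating torsion classes by arc modules\<close>

definition arcs_of :: "nat \<Rightarrow> 'k::field RA_module set \<Rightarrow> nc_arc set" where
  "arcs_of n T = {\<alpha> \<in> nc_arcs n. arcmod n \<alpha> \<in> T}"

text \<open>A module lies in a torsion class as soon as all its arc factors do, and the arc factors
  of a module in \<open>T\<close> are in \<open>T\<close>.\<close>

lemma torsion_class_subset_iff: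
  assumes "torsion_class n T" "torsion_class n T'"
  shows "T \<subseteq> T' \<longleftrightarrow> arcs_of n T \<subseteq> arcs_of n T'"
proof
  assume sub: "arcs_of n T \<subseteq> arcs_of n T'"
  show "T \<subseteq> T'"
  proof
    fix M assume M: "M \<in> T"
    have "M \<in> fd_modules n" using assms(1) M unfolding torsion_class_def by blast
    show "M \<in> T'"
    proof (rule mem_torsion_class_if_arc_factors[OF assms(2) \<open>M \<in> fd_modules n\<close>])
      fix \<alpha> assume \<alpha>: "\<alpha> \<in> nc_arcs n" "is_factor_module (RA n) (arcmod n \<alpha>) M"
      then have "\<alpha> \<in> arcs_of n T"
        using arcmod_in_torsion_class_imp[OF assms(1) M \<alpha>] by (simp add: arcs_of_def)
      then show "arcmod n \<alpha> \<in> T'" using sub by (auto simp: arcs_of_def)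
    qed
  qed
next
  assume "T \<subseteq> T'"
  then show "arcs_of n T \<subseteq> arcs_of n T'" unfolding arcs_of_def by blast
qed

lemma arcs_of_quotient:
  assumes "torsion_class n T" "\<alpha> \<in> arcs_of n T" "\<beta> \<in> nc_arcs n" "overlap \<alpha> \<beta> (bot_end \<beta>) (top_end \<beta>)"
  shows "\<beta> \<in> arcs_of n T"
  using assms arcmod_factor[of \<alpha> n \<beta>] arcmod_in_torsion_class_imp[OF assms(1), of "arcmod n \<alpha>" \<beta>]
  by (auto simp: arcs_of_def)

text \<open>The sign conditions say that the arrows at the ends of the interval lead out of it; the
  remaining coordinates then form a submodule, with the restricted arc as factor.\<close>

lemma arcs_of_restrict:
  assumes "torsion_class n T" "\<alpha> \<in> arcs_of n T" "bot_end \<alpha> \<le> c" "c < d" "d \<le> top_end \<alpha>"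
    and "side \<alpha> c \<le> 0" "0 \<le> side \<alpha> d"
  shows "arc_restrict \<alpha> c d \<in> arcs_of n T"
proof (rule arcs_of_quotient[OF assms(1,2)])
  show "arc_restrict \<alpha> c d \<in> nc_arcs n" using assms by (intro arc_restrict_nc_arcs) (auto simp: arcs_of_def)
  show "overlap \<alpha> (arc_restrict \<alpha> c d) (bot_end (arc_restrict \<alpha> c d)) (top_end (arc_restrict \<alpha> c d))"
    using assms by (auto simp: overlap_def side_restrict)
qed

text \<open>The arrow acting at node \<open>c\<close> points from one piece to the other; the piece
  it points to is a submodule, so the arc module is an extension of the two pieces: the upper one is
  the submodule if the side is 1, the lower one if it is -1.\<close>

lemma arcs_of_cut:
  assumes T: "torsion_class n T" and \<alpha>: "\<alpha> \<in> nc_arcs n" and c: "bot_end \<alpha> < c" "c < top_end \<alpha>"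
    and lo: "arc_restrict \<alpha> (bot_end \<alpha>) c \<in> arcs_of n T" and up: "arc_restrict \<alpha> c (top_end \<alpha>) \<in> arcs_of n T"
  shows "\<alpha> \<in> arcs_of n T"
proof -
  let ?lo = "arc_restrict \<alpha> (bot_end \<alpha>) c" and ?up = "arc_restrict \<alpha> c (top_end \<alpha>)"
  have mem: "?lo \<in> nc_arcs n" "?up \<in> nc_arcs n" using lo up by (auto simp: arcs_of_def)
  have supp: "arc_supp ?lo \<inter> arc_supp ?up = {}" "arc_supp \<alpha> = arc_supp ?lo \<union> arc_supp ?up"
    using c by (auto simp: arc_supp_restrict arc_supp_def)
  have side0: "side \<alpha> (bot_end \<alpha>) = 0" "side \<alpha> (top_end \<alpha>) = 0" by (auto simp: side_def)
  consider "side \<alpha> c = 1" | "side \<alpha> c = - 1" using c by (cases "c \<in> right_of \<alpha>") (auto simp: side_def)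
  then have "is_extension (RA n) (arcmod n ?up) (arcmod n \<alpha>) (arcmod n ?lo :: 'a RA_module) \<or>
    is_extension (RA n) (arcmod n ?lo) (arcmod n \<alpha>) (arcmod n ?up :: 'a RA_module)"
  proof cases
    case 1
    then have "overlap ?up \<alpha> (bot_end ?up) (top_end ?up)" "overlap \<alpha> ?lo (bot_end ?lo) (top_end ?lo)"
      using c side0 by (auto simp: overlap_def side_restrict)
    then show ?thesis using supp by (intro disjI1 arcmod_extension \<alpha> mem) auto
  next
    case 2
    then have "overlap ?lo \<alpha> (bot_end ?lo) (top_end ?lo)" "overlap \<alpha> ?up (bot_end ?up) (top_end ?up)"
      using c side0 by (auto simp: overlap_def side_restrict)
    then show ?thesis using supp by (intro disjI2 arcmod_extension \<alpha> mem) auto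
  qed
  then have "arcmod n \<alpha> \<in> T"
    using lo up torsion_class_extension[OF T _ _ arcmod_fd[OF \<alpha>]] by (auto simp: arcs_of_def)
  then show ?thesis using \<alpha> by (simp add: arcs_of_def)
qed

text \<open>
  If \<open>A\<close> is the set of arcs of a torsion class \<open>T\<close>, then \<open>min_arcs A\<close> consists of the arcs whose module
  has no proper nonzero submodule in \<open>T\<close>, and \<open>cjr_arcs A\<close> of those among them that are not proper
  factors of others.
\<close>

definition min_arcs :: "nc_arc set \<Rightarrow> nc_arc set" where
  "min_arcs A = {\<alpha> \<in> A. \<forall>\<beta> \<in> A. \<forall>c d. overlap \<beta> \<alpha> c d \<longrightarrow> c = bot_end \<alpha> \<and> d = top_end \<alpha>}"

definition cjr_arcs :: "nc_arc set \<Rightarrow> nc_arc set" where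
  "cjr_arcs A = {\<alpha> \<in> min_arcs A. \<forall>\<beta> \<in> min_arcs A. overlap \<beta> \<alpha> (bot_end \<alpha>) (top_end \<alpha>) \<longrightarrow> \<beta> = \<alpha>}"

definition orthogonal :: "nc_arc set \<Rightarrow> bool" where
  "orthogonal S \<longleftrightarrow> (\<forall>\<alpha> \<in> S. \<forall>\<beta> \<in> S. \<alpha> \<noteq> \<beta> \<longrightarrow> (\<forall>c d. \<not> overlap \<alpha> \<beta> c d))"

text \<open>Minimality forces an overlap onto \<beta> to be all of \<beta>, making \<beta> a factor
  of \<alpha>; the second condition in \<open>cjr_arcs\<close> leaves only equality.\<close>

lemma orthogonal_cjr_arcs: "orthogonal (cjr_arcs A)"
  unfolding orthogonal_def
proof (intro ballI impI allI notI)
  fix \<alpha> \<beta> c d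
  assume *: "\<alpha> \<in> cjr_arcs A" "\<beta> \<in> cjr_arcs A" "\<alpha> \<noteq> \<beta>" "overlap \<alpha> \<beta> c d"
  then have "\<alpha> \<in> min_arcs A" "\<beta> \<in> min_arcs A" "\<alpha> \<in> A" by (auto simp: cjr_arcs_def min_arcs_def)
  then have "overlap \<alpha> \<beta> (bot_end \<beta>) (top_end \<beta>)" using *(4) by (auto simp: min_arcs_def)
  then show False using *(2,3) \<open>\<alpha> \<in> min_arcs A\<close> by (auto simp: cjr_arcs_def)
qed

text \<open>Factors recover the minimal arcs from \<open>cjr_arcs\<close>, and extensions then
  recover all arcs of \<open>T\<close> from the minimal ones; arcs determine the torsion
  class.\<close>

lemma cjr_arcs_generate:
  assumes T: "torsion_class n T" and T': "torsion_class n T'" and sub: "cjr_arcs (arcs_of n T) \<subseteq> arcs_of n T'"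
  shows "T \<subseteq> T'"
proof -
  let ?A = "arcs_of n T"
  have A: "\<alpha> \<in> nc_arcs n" if "\<alpha> \<in> ?A" for \<alpha> using that by (simp add: arcs_of_def)
  have X: "\<alpha> \<in> arcs_of n T'" if "\<alpha> \<in> min_arcs ?A" for \<alpha>
    using that
  \<comment> \<open>Longest arcs first: a minimal arc outside \<open>cjr_arcs\<close> is a proper
    factor of a longer minimal arc, and lengths are at most \<open>n\<close>.\<close>
  proof (induction "n - (top_end \<alpha> - bot_end \<alpha>)" arbitrary: \<alpha> rule: less_induct)
    case less
    show ?case
    proof (cases "\<alpha> \<in> cjr_arcs ?A")
      case False
      then obtain \<beta> where \<beta>: "\<beta> \<in> min_arcs ?A" "overlap \<beta> \<alpha> (bot_end \<alpha>) (top_end \<alpha>)" "\<beta> \<noteq> \<alpha>"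
        using less.prems by (auto simp: cjr_arcs_def)
      have mem: "\<alpha> \<in> nc_arcs n" "\<beta> \<in> nc_arcs n" using less.prems \<beta>(1) A by (auto simp: min_arcs_def)
      have "bot_end \<beta> < bot_end \<alpha> \<or> top_end \<alpha> < top_end \<beta>"
      proof (rule ccontr)
        assume "\<not> ?thesis"
        then have ends: "bot_end \<beta> = bot_end \<alpha>" "top_end \<beta> = top_end \<alpha>" using \<beta>(2) by (auto simp: overlap_def)
        show False using overlap_antisym[OF mem(2,1) \<beta>(2) ends[symmetric]] \<beta>(3) by blast
      qed
      then have "n - (top_end \<beta> - bot_end \<beta>) < n - (top_end \<alpha> - bot_end \<alpha>)"
        using \<beta>(2) mem by (auto simp: overlap_def nc_arcs_def)
      then have "\<beta> \<in> arcs_of n T'" using less.hyps \<beta>(1) by blast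
      then show ?thesis using arcs_of_quotient[OF T' _ mem(1) \<beta>(2)] by blast
    qed (use sub in blast)
  qed
  have "\<alpha> \<in> arcs_of n T'" if "\<alpha> \<in> ?A" for \<alpha>
    using that
  proof (induction "top_end \<alpha> - bot_end \<alpha>" arbitrary: \<alpha> rule: less_induct)
    case less
    show ?case
    proof (cases "\<alpha> \<in> min_arcs ?A")
      case False
      then obtain \<beta> c d where \<beta>: "\<beta> \<in> ?A" and ov: "overlap \<beta> \<alpha> c d" and ne: "c \<noteq> bot_end \<alpha> \<or> d \<noteq> top_end \<alpha>"
        using less.prems by (auto simp: min_arcs_def)
      have ovs: "c < d" "bot_end \<alpha> \<le> c" "bot_end \<beta> \<le> c" "d \<le> top_end \<alpha>" "d \<le> top_end \<beta>"
        "side \<beta> c \<le> 0" "0 \<le> side \<alpha> c" "0 \<le> side \<beta> d" "side \<alpha> d \<le> 0" using ov by (auto simp: overlap_def)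
      have \<alpha>: "\<alpha> \<in> nc_arcs n" by (rule A[OF less.prems])
      \<comment> \<open>The interval from \<open>c\<close> to \<open>d\<close> is a submodule of
        \<alpha> and a factor of \<beta>; the pieces of \<alpha> outside it are factors of \<alpha>.
        All pieces are thus shorter arcs of \<open>T\<close>, and \<open>arcs_of_cut\<close>
        reassembles \<alpha> in \<open>T'\<close>.\<close>
      let ?r = "arc_restrict \<alpha>"
      have small: "?r x y \<in> arcs_of n T'"
        if "?r x y \<in> ?A" "x < y" "bot_end \<alpha> \<le> x" "y \<le> top_end \<alpha>" "x \<noteq> bot_end \<alpha> \<or> y \<noteq> top_end \<alpha>" for x y
        using that by (intro less.hyps) auto
      have eq: "?r c d = arc_restrict \<beta> c d"
      proof -
        have "i \<in> right_of \<alpha> \<longleftrightarrow> i \<in> right_of \<beta>" if "c < i" "i < d" for i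
        proof -
          have "side \<beta> i = side \<alpha> i" using ov that by (auto simp: overlap_def)
          then show ?thesis using ovs that by (auto simp: side_def split: if_splits)
        qed
        then show ?thesis by (auto simp: arc_restrict_def)
      qed
      have mid: "?r c d \<in> arcs_of n T'"
        using ovs ne by (intro small) (auto simp: eq intro!: arcs_of_restrict[OF T \<beta>])
      have side0: "side \<alpha> (bot_end \<alpha>) = 0" "side \<alpha> (top_end \<alpha>) = 0" by (auto simp: side_def)
      have upper: "?r c (top_end \<alpha>) \<in> arcs_of n T'"
      proof (cases "d = top_end \<alpha>")
        case False
        then have d: "d < top_end \<alpha>" using ovs by simp
        let ?u = "?r c (top_end \<alpha>)"
        have last: "?r d (top_end \<alpha>) \<in> arcs_of n T'"
          using d ovs side0 by (intro small arcs_of_restrict[OF T less.prems]) auto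
        have "arc_restrict ?u (bot_end ?u) d = ?r c d" "arc_restrict ?u d (top_end ?u) = ?r d (top_end \<alpha>)"
          using d ovs(1) by (auto simp: arc_restrict_def)
        then have parts: "arc_restrict ?u (bot_end ?u) d \<in> arcs_of n T'"
          "arc_restrict ?u d (top_end ?u) \<in> arcs_of n T'"
          using mid last by (simp_all only:)
        have "?u \<in> nc_arcs n" using \<alpha> ovs by (intro arc_restrict_nc_arcs) auto
        from arcs_of_cut[OF T' this _ _ parts] show ?thesis using d ovs(1) by simp
      qed (use mid in simp)
      show ?thesis
      proof (cases "c = bot_end \<alpha>")
        case True
        then show ?thesis using upper arc_restrict_self[OF \<alpha>] by simp
      next
        case False
        then have c: "bot_end \<alpha> < c" "c < top_end \<alpha>" using ovs by auto
        have "?r (bot_end \<alpha>) c \<in> arcs_of n T'"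
          using c ovs side0 by (intro small arcs_of_restrict[OF T less.prems]) auto
        then show ?thesis using upper c by (intro arcs_of_cut[OF T' \<alpha>])
      qed
    qed (use X in blast)
  qed
  then show ?thesis using torsion_class_subset_iff[OF T T'] by blast
qed

section \<open>Canonical join representations\<close>

definition arc_torsion :: "nat \<Rightarrow> nc_arc \<Rightarrow> 'k::field RA_module set" where
  "arc_torsion n \<alpha> = \<Inter>{T. torsion_class n T \<and> arcmod n \<alpha> \<in> T}"

abbreviation tors_join :: "nat \<Rightarrow> 'k::field RA_module set set \<Rightarrow> 'k RA_module set" where
  "tors_join n A \<equiv> \<Squnion>\<^bsub>tors TYPE('k) n\<^esub>A"

lemma tors_simps [simp]:
  "carrier (tors K n) = {T. torsion_class n T}" "T \<sqsubseteq>\<^bsub>tors K n\<^esub> T' \<longleftrightarrow> T \<subseteq> T'"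
  "T \<sqsubset>\<^bsub>tors K n\<^esub> T' \<longleftrightarrow> T \<subset> T'"
  by (auto simp: tors_def lless_def)

lemma torsion_class_Inter:
  fixes A :: "'k::field RA_module set set"
  assumes "A \<noteq> {}" "\<And>T. T \<in> A \<Longrightarrow> torsion_class n T"
  shows "torsion_class n (\<Inter>A)"
proof (rule torsion_classI)
  obtain Z :: "'k RA_module" where "Z \<in> fd_modules n" "carrier Z = {\<zero>\<^bsub>Z\<^esub>}"
    using ex_zero_module by blast
  then have "Z \<in> \<Inter>A" using zero_module_in_torsion_class assms(2) by blast
  then show "\<Inter>A \<noteq> {}" by blast
  show "\<Inter>A \<subseteq> fd_modules n" using assms unfolding torsion_class_def by blast
  show "N \<in> \<Inter>A" if "M \<in> \<Inter>A" "N \<in> fd_modules n" "is_factor_module (RA n) N M" for M N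
    using that assms(2) unfolding torsion_class_def by (intro InterI) blast
  show "M \<in> \<Inter>A" if "L \<in> \<Inter>A" "N \<in> \<Inter>A" "M \<in> fd_modules n" "is_extension (RA n) L M N" for L M N
    using that torsion_class_extension[OF assms(2)] by (intro InterI) blast
qed

lemma torsion_class_fd_modules: "torsion_class n (fd_modules n :: 'k::field RA_module set)"
  using ex_zero_module[where 'k = 'k, of n] by (intro torsion_classI) auto

lemma torsion_class_arc_torsion:
  assumes "\<alpha> \<in> nc_arcs n"
  shows "torsion_class n (arc_torsion n \<alpha> :: 'k::field RA_module set)"
proof -
  have "{T :: 'k RA_module set. torsion_class n T \<and> arcmod n \<alpha> \<in> T} \<noteq> {}"
    using torsion_class_fd_modules[of n, where 'k = 'k] arcmod_fd[OF assms, where 'k = 'k] by blast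
  then show ?thesis unfolding arc_torsion_def by (rule torsion_class_Inter) simp
qed

lemma arcmod_in_arc_torsion: "arcmod n \<alpha> \<in> arc_torsion n \<alpha>"
  by (simp add: arc_torsion_def)

lemma arc_torsion_subset_iff: "torsion_class n T \<Longrightarrow> arc_torsion n \<alpha> \<subseteq> T \<longleftrightarrow> arcmod n \<alpha> \<in> T"
  using arcmod_in_arc_torsion by (auto simp: arc_torsion_def)

lemma torsion_class_join:
  assumes "A \<subseteq> {T :: 'k::field RA_module set. torsion_class n T}"
  shows "torsion_class n (tors_join n A)"
proof -
  interpret complete_lattice "tors TYPE('k) n" by (rule tors_complete_lattice)
  show ?thesis using sup_closed[of A] assms by simp
qed

lemma join_subset_iff:
  assumes A: "A \<subseteq> {T :: 'k::field RA_module set. torsion_class n T}" and T: "torsion_class n T"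
  shows "tors_join n A \<subseteq> T \<longleftrightarrow> (\<forall>a \<in> A. a \<subseteq> T)"
proof -
  interpret complete_lattice "tors TYPE('k) n" by (rule tors_complete_lattice)
  show ?thesis
  proof
    assume "tors_join n A \<subseteq> T"
    then show "\<forall>a \<in> A. a \<subseteq> T" using sup_upper[of A] A by fastforce
  next
    assume "\<forall>a \<in> A. a \<subseteq> T"
    then show "tors_join n A \<subseteq> T" using sup_least[of A T] A T by simp
  qed
qed

lemma arcmod_brick: "\<alpha> \<in> nc_arcs n \<Longrightarrow> arcmod n \<alpha> \<notin> perp n (arcmod n \<alpha> :: 'k::field RA_module)"
proof -
  assume \<alpha>: "\<alpha> \<in> nc_arcs n"
  then have "overlap \<alpha> \<alpha> (bot_end \<alpha>) (top_end \<alpha>)" by (auto simp: overlap_def side_def nc_arcs_def)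
  then show ?thesis using arcmod_perp[OF \<alpha> \<alpha>] by blast
qed

lemma arc_torsion_perp:
  assumes "orthogonal S" "S \<subseteq> nc_arcs n" "\<alpha> \<in> S" "\<beta> \<in> S" "\<alpha> \<noteq> \<beta>"
  shows "arc_torsion n \<alpha> \<subseteq> perp n (arcmod n \<beta> :: 'k::field RA_module)"
proof -
  have mem: "\<alpha> \<in> nc_arcs n" "\<beta> \<in> nc_arcs n" using assms by auto
  have "arcmod n \<alpha> \<in> perp n (arcmod n \<beta> :: 'k RA_module)"
    unfolding arcmod_perp[OF mem] using assms by (auto simp: orthogonal_def)
  then show ?thesis
    unfolding arc_torsion_subset_iff[OF torsion_class_perp[OF RA_mod_arcmod[OF mem(2)]]] .
qed

text \<open>Other members of \<open>S\<close> have no nonzero map to \<beta>, and nonzero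
  endomorphisms of \<beta> are onto by \<open>overlap_self\<close>. As \<open>zero_or_surj\<close>
  is a torsion class, this extends from the generator to all of
  \<open>arc_torsion n \<alpha>\<close>.\<close>

lemma arc_torsion_zero_or_surj:
  assumes "orthogonal S" "S \<subseteq> nc_arcs n" "\<alpha> \<in> S" "\<beta> \<in> S"
  shows "arc_torsion n \<alpha> \<subseteq> zero_or_surj n (arcmod n \<beta> :: 'k::field RA_module)"
proof -
  have mem: "\<alpha> \<in> nc_arcs n" "\<beta> \<in> nc_arcs n" using assms by auto
  have "arcmod n \<alpha> \<in> zero_or_surj n (arcmod n \<beta> :: 'k RA_module)"
  proof (rule arcmod_zero_or_surj[OF mem])
    show "c = bot_end \<beta> \<and> d = top_end \<beta>" if "overlap \<alpha> \<beta> c d" for c d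
      using that assms overlap_self[of \<alpha> c d] by (cases "\<alpha> = \<beta>") (auto simp: orthogonal_def)
  qed
  then show ?thesis
    unfolding arc_torsion_subset_iff[OF torsion_class_zero_or_surj[OF RA_mod_arcmod[OF mem(2)]]] .
qed

lemma factor_if_not_perp:
  assumes "M \<in> zero_or_surj n B" "M \<notin> perp n B"
  shows "is_factor_module (RA n) B M"
proof -
  obtain f where f: "f \<in> left_module_hom (RA n) M B" "\<not> zero_hom n M B f"
    using assms by (auto simp: perp_def zero_or_surj_def)
  then have "f ` carrier M = carrier B" using assms(1) by (auto simp: zero_or_surj_def)
  then show ?thesis unfolding is_factor_module_def using f(1) by (rule bexI)
qed

text \<open>
  Every nonzero map from a module of the join to the module of \<open>\<beta>\<close> is surjective, and some member of
  \<open>B\<close> contains a module with such a map, for otherwise the join would lie in the torsion class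
  \<^const>\<open>perp\<close> of modules without nonzero maps to the module of \<open>\<beta>\<close>.
\<close>

lemma arc_torsion_le_if_join:
  assumes S: "orthogonal S" "S \<subseteq> nc_arcs n" and B: "B \<subseteq> {T :: 'k::field RA_module set. torsion_class n T}"
    and eq: "tors_join n B = tors_join n (arc_torsion n ` S)"
    and \<beta>: "\<beta> \<in> S"
  shows "\<exists>b \<in> B. arc_torsion n \<beta> \<subseteq> b"
proof (rule ccontr)
  assume none: "\<not> ?thesis"
  let ?J = "tors_join n (arc_torsion n ` S) :: 'k RA_module set"
  have \<beta>': "\<beta> \<in> nc_arcs n" using S(2) \<beta> by blast
  have R: "RA_mod n (arcmod n \<beta> :: 'k RA_module)" by (rule RA_mod_arcmod[OF \<beta>'])
  have AS: "arc_torsion n ` S \<subseteq> {T :: 'k RA_module set. torsion_class n T}"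
    using S(2) by (auto intro!: torsion_class_arc_torsion)
  have zs: "?J \<subseteq> zero_or_surj n (arcmod n \<beta>)"
    unfolding join_subset_iff[OF AS torsion_class_zero_or_surj[OF R]]
    using arc_torsion_zero_or_surj[OF S _ \<beta>] by blast
  have "b \<subseteq> perp n (arcmod n \<beta>)" if b: "b \<in> B" for b
  proof
    fix M assume M: "M \<in> b"
    have tb: "torsion_class n b" using B b by blast
    have "b \<subseteq> ?J" using join_subset_iff[OF B torsion_class_join[OF AS]] eq b by blast
    then have "M \<in> zero_or_surj n (arcmod n \<beta>)" using zs M by blast
    moreover have "\<not> is_factor_module (RA n) (arcmod n \<beta>) M"
      using arcmod_in_torsion_class_imp[OF tb M \<beta>'] none b arc_torsion_subset_iff[OF tb, of \<beta>] by blast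
    ultimately show "M \<in> perp n (arcmod n \<beta>)" using factor_if_not_perp by blast
  qed
  then have "?J \<subseteq> perp n (arcmod n \<beta>)"
    using join_subset_iff[OF B torsion_class_perp[OF R]] eq by blast
  moreover have "arc_torsion n \<beta> \<subseteq> ?J"
    using join_subset_iff[OF AS torsion_class_join[OF AS]] \<beta> by blast
  ultimately have "arcmod n \<beta> \<in> perp n (arcmod n \<beta> :: 'k RA_module)"
    using arcmod_in_arc_torsion by blast
  then show False using arcmod_brick[OF \<beta>'] by blast
qed

text \<open>\<open>arc_torsion_le_if_join\<close> is used twice: for an arbitrary representation it
  gives lowness. For a proper subset with the same join it would put the class of an omitted \<beta>
  below that of another \<alpha>, whose modules have no nonzero maps to \<beta>.\<close>

lemma orthogonal_canonical_join_rep: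
  assumes S: "orthogonal S" "S \<subseteq> nc_arcs n"
  shows "canonical_join_rep (tors TYPE('k::field) n) (tors_join n (arc_torsion n ` S)) (arc_torsion n ` S)"
proof -
  let ?L = "tors TYPE('k) n" and ?A = "arc_torsion n ` S :: 'k RA_module set set"
  have A: "?A \<subseteq> {T. torsion_class n T}" using S(2) by (auto intro!: torsion_class_arc_torsion)
  have irr: "tors_join n A' \<subset> tors_join n ?A" if A': "A' \<subset> ?A" for A'
  proof -
    have A'': "A' \<subseteq> {T. torsion_class n T}" using A A' by blast
    have "tors_join n A' \<noteq> tors_join n ?A"
    proof
      assume eq: "tors_join n A' = tors_join n ?A"
      obtain \<beta> where \<beta>: "\<beta> \<in> S" "arc_torsion n \<beta> \<notin> A'" using A' by blast
      obtain a where a: "a \<in> A'" "arc_torsion n \<beta> \<subseteq> a" using arc_torsion_le_if_join[OF S A'' eq \<beta>(1)] by blast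
      obtain \<alpha> where \<alpha>: "\<alpha> \<in> S" "a = arc_torsion n \<alpha>" "\<alpha> \<noteq> \<beta>" using a A' \<beta>(2) by blast
      have "arcmod n \<beta> \<in> perp n (arcmod n \<beta> :: 'k RA_module)"
        using arc_torsion_perp[OF S \<alpha>(1) \<beta>(1) \<alpha>(3)] a(2) \<alpha>(2) arcmod_in_arc_torsion by blast
      then show False using arcmod_brick S(2) \<beta>(1) by blast
    qed
    moreover have "tors_join n A' \<subseteq> tors_join n ?A"
      using join_subset_iff[OF A'' torsion_class_join[OF A]] join_subset_iff[OF A torsion_class_join[OF A]] A' by blast
    ultimately show ?thesis by blast
  qed
  have low: "lower_than ?L ?A B" if B: "irredundant_join_rep ?L (tors_join n ?A) B" for B
  proof -
    have "B \<subseteq> {T. torsion_class n T}" "tors_join n B = tors_join n ?A"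
      using B by (auto simp: irredundant_join_rep_def join_rep_def)
    from arc_torsion_le_if_join[OF S this] show ?thesis by (auto simp: lower_than_def)
  qed
  have "irredundant_join_rep ?L (tors_join n ?A) ?A"
    using A irr by (simp add: irredundant_join_rep_def join_rep_def)
  then show ?thesis using low by (simp add: canonical_join_rep_def)
qed

text \<open>A member below another one could be dropped without changing the join.\<close>

lemma irredundant_antichain:
  assumes "irredundant_join_rep (tors TYPE('k::field) n) w A" "a \<in> A" "b \<in> A" "a \<subseteq> b"
  shows "a = b"
proof (rule ccontr)
  assume ne: "a \<noteq> b"
  let ?L = "tors TYPE('k) n"
  have A: "A \<subseteq> {T. torsion_class n T}" and irr: "\<And>A'. A' \<subset> A \<Longrightarrow> tors_join n A' \<subset> tors_join n A"
    using assms(1) by (auto simp: irredundant_join_rep_def join_rep_def)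
  have A': "A - {a} \<subseteq> {T. torsion_class n T}" using A by blast
  have "\<forall>c \<in> A - {a}. c \<subseteq> tors_join n (A - {a})"
    using join_subset_iff[OF A' torsion_class_join[OF A']] by blast
  then have "\<forall>c \<in> A. c \<subseteq> tors_join n (A - {a})" using assms(2-4) ne by blast
  then have "tors_join n A \<subseteq> tors_join n (A - {a})" using join_subset_iff[OF A torsion_class_join[OF A']] by blast
  moreover have "tors_join n (A - {a}) \<subset> tors_join n A" using assms(2) by (intro irr) blast
  ultimately show False by blast
qed

lemma canonical_join_rep_unique:
  assumes "canonical_join_rep (tors TYPE('k::field) n) w A" "canonical_join_rep (tors TYPE('k) n) w B"
  shows "A = B"
proof -
  have "A \<subseteq> B" if "canonical_join_rep (tors TYPE('k) n) w A" "canonical_join_rep (tors TYPE('k) n) w B" for A B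
  proof
    fix a assume a: "a \<in> A"
    have irrA: "irredundant_join_rep (tors TYPE('k) n) w A" using that by (simp add: canonical_join_rep_def)
    have low: "lower_than (tors TYPE('k) n) A B" "lower_than (tors TYPE('k) n) B A"
      using that by (auto simp: canonical_join_rep_def)
    obtain b where b: "b \<in> B" "a \<subseteq> b" using low(1) a by (auto simp: lower_than_def)
    obtain a' where a': "a' \<in> A" "b \<subseteq> a'" using low(2) b(1) by (auto simp: lower_than_def)
    have "a = a'" using irredundant_antichain[OF irrA a a'(1)] b(2) a'(2) by blast
    then show "a \<in> B" using b a' by auto
  qed
  then show ?thesis using assms by blast
qed

text \<open>For a face with join \<open>w\<close>, the orthogonal set is \<open>cjr_arcs\<close> of
  the arcs in \<open>w\<close>: it generates \<open>w\<close>, its classes form a canonical join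
  representation, and that representation is unique.\<close>

lemma canonical_join_complex_tors:
  "canonical_join_complex (tors TYPE('k::field) n) =
    (\<lambda>S. arc_torsion n ` S) ` {S. S \<subseteq> nc_arcs n \<and> orthogonal S}"
proof (intro equalityI subsetI)
  let ?L = "tors TYPE('k) n"
  fix A assume "A \<in> canonical_join_complex ?L"
  then have A: "A \<subseteq> {T. torsion_class n T}" "canonical_join_rep ?L (tors_join n A) A"
    by (auto simp: canonical_join_complex_def)
  let ?w = "tors_join n A"
  have w: "torsion_class n ?w" by (rule torsion_class_join[OF A(1)])
  let ?S = "cjr_arcs (arcs_of n ?w)"
  have S: "?S \<subseteq> arcs_of n ?w" "?S \<subseteq> nc_arcs n" by (auto simp: cjr_arcs_def min_arcs_def arcs_of_def)
  let ?B = "arc_torsion n ` ?S :: 'k RA_module set set"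
  have B: "?B \<subseteq> {T. torsion_class n T}" using S(2) by (auto intro!: torsion_class_arc_torsion)
  have "tors_join n ?B \<subseteq> ?w"
    unfolding join_subset_iff[OF B w] using S(1) arc_torsion_subset_iff[OF w] by (auto simp: arcs_of_def)
  moreover have "?w \<subseteq> tors_join n ?B"
  proof (rule cjr_arcs_generate[OF w torsion_class_join[OF B]])
    have "arc_torsion n \<alpha> \<subseteq> tors_join n ?B" if "\<alpha> \<in> ?S" for \<alpha>
      using join_subset_iff[OF B torsion_class_join[OF B]] that by blast
    then have "arcmod n \<alpha> \<in> tors_join n ?B" if "\<alpha> \<in> ?S" for \<alpha>
      using that arc_torsion_subset_iff[OF torsion_class_join[OF B]] by blast
    then show "?S \<subseteq> arcs_of n (tors_join n ?B)" using S(2) unfolding arcs_of_def by blast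
  qed
  ultimately have eq: "tors_join n ?B = ?w" by blast
  have "canonical_join_rep ?L ?w ?B"
    using orthogonal_canonical_join_rep[OF orthogonal_cjr_arcs S(2), where 'k = 'k] unfolding eq .
  then have "A = ?B" by (rule canonical_join_rep_unique[OF A(2)])
  then show "A \<in> (\<lambda>S. arc_torsion n ` S) ` {S. S \<subseteq> nc_arcs n \<and> orthogonal S}"
    using S(2) orthogonal_cjr_arcs by blast
next
  let ?L = "tors TYPE('k) n"
  fix A assume "A \<in> (\<lambda>S. arc_torsion n ` S :: 'k RA_module set set) ` {S. S \<subseteq> nc_arcs n \<and> orthogonal S}"
  then obtain S where S: "S \<subseteq> nc_arcs n" "orthogonal S" "A = arc_torsion n ` S" by blast
  then have "A \<subseteq> {T. torsion_class n T}" by (auto intro!: torsion_class_arc_torsion)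
  then show "A \<in> canonical_join_complex ?L"
    using orthogonal_canonical_join_rep[OF S(2,1), where 'k = 'k] S(3) by (simp add: canonical_join_complex_def)
qed

text \<open>If the classes agree, maps from \<alpha> to \<beta> are zero or onto, and one is nonzero
  since otherwise \<open>perp\<close> of \<beta> would contain \<beta>. So each arc module is a
  factor of the other.\<close>

lemma inj_on_arc_torsion: "inj_on (arc_torsion n :: nc_arc \<Rightarrow> 'k::field RA_module set) (nc_arcs n)"
proof (rule inj_onI)
  have *: "overlap \<alpha> \<beta> (bot_end \<beta>) (top_end \<beta>)"
    if mem: "\<alpha> \<in> nc_arcs n" "\<beta> \<in> nc_arcs n" and eq: "arc_torsion n \<alpha> = (arc_torsion n \<beta> :: 'k RA_module set)" for \<alpha> \<beta>
  proof -
    have R: "RA_mod n (arcmod n \<beta> :: 'k RA_module)" by (rule RA_mod_arcmod[OF mem(2)])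
    have "arcmod n \<alpha> \<in> (arc_torsion n \<beta> :: 'k RA_module set)" unfolding eq[symmetric] by (rule arcmod_in_arc_torsion)
    moreover have "orthogonal {\<beta>}" by (simp add: orthogonal_def)
    ultimately have "arcmod n \<alpha> \<in> zero_or_surj n (arcmod n \<beta> :: 'k RA_module)"
      using arc_torsion_zero_or_surj[of "{\<beta>}" n \<beta> \<beta>] mem(2) by blast
    moreover have "arcmod n \<alpha> \<notin> perp n (arcmod n \<beta> :: 'k RA_module)"
    proof
      assume "arcmod n \<alpha> \<in> perp n (arcmod n \<beta> :: 'k RA_module)"
      then have "arc_torsion n \<beta> \<subseteq> perp n (arcmod n \<beta> :: 'k RA_module)"
        using arc_torsion_subset_iff[OF torsion_class_perp[OF R], of \<alpha>] eq by blast
      then show False using arcmod_in_arc_torsion arcmod_brick[OF mem(2)] by blast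
    qed
    ultimately show ?thesis using factor_if_not_perp arcmod_factor[OF mem] by blast
  qed
  fix \<alpha> \<beta> assume mem: "\<alpha> \<in> nc_arcs n" "\<beta> \<in> nc_arcs n" and eq: "arc_torsion n \<alpha> = (arc_torsion n \<beta> :: 'k RA_module set)"
  note ov = *[OF mem eq] *[OF mem(2,1) eq[symmetric]]
  have "bot_end \<beta> = bot_end \<alpha>" "top_end \<beta> = top_end \<alpha>" using ov by (auto simp: overlap_def)
  then show "\<alpha> = \<beta>" by (rule overlap_antisym[OF mem ov(1)])
qed

section \<open>Noncrossing arc diagrams\<close>

lemma side_range: "side \<alpha> i \<in> {- 1, 0, 1}"
  by (auto simp: side_def)

lemma side_endpoint: "bot_end \<alpha> \<le> i \<Longrightarrow> i \<le> top_end \<alpha> \<Longrightarrow> side \<alpha> i = 0 \<longleftrightarrow> i = bot_end \<alpha> \<or> i = top_end \<alpha>"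
  by (auto simp: side_def)

text \<open>Extends the sign conditions of \<open>draws\<close> to the ends of the arc, where side
  and curve are both 0.\<close>

lemma draws_side:
  assumes "draws f \<alpha>" "bot_end \<alpha> \<le> i" "i \<le> top_end \<alpha>"
  shows "side \<alpha> i < 0 \<longleftrightarrow> f (real i) < 0" "0 < side \<alpha> i \<longleftrightarrow> 0 < f (real i)"
proof -
  consider "i = bot_end \<alpha> \<or> i = top_end \<alpha>" | "bot_end \<alpha> < i" "i < top_end \<alpha>" using assms(2,3) by linarith
  then have "(side \<alpha> i < 0 \<longleftrightarrow> f (real i) < 0) \<and> (0 < side \<alpha> i \<longleftrightarrow> 0 < f (real i))"
  proof cases
    case 1
    then have "side \<alpha> i = 0" "f (real i) = 0" using assms(1) by (auto simp: side_def draws_def)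
    then show ?thesis by simp
  next
    case 2
    then have "if i \<in> right_of \<alpha> then f (real i) > 0 else f (real i) < 0" using assms(1) by (simp add: draws_def)
    then show ?thesis using 2 by (auto simp: side_def split: if_splits)
  qed
  then show "side \<alpha> i < 0 \<longleftrightarrow> f (real i) < 0" "0 < side \<alpha> i \<longleftrightarrow> 0 < f (real i)" by blast+
qed

text \<open>An overlap puts \<alpha> weakly left of \<beta> at \<open>c\<close> and weakly right at
  \<open>d\<close>. Distinct ends make both strict, and the intermediate value theorem yields a
  crossing in between.\<close>

lemma diagram_orthogonal:
  assumes "noncrossing_arc_diagram n S D"
  shows "orthogonal S"
  unfolding orthogonal_def
proof (intro ballI impI allI notI)
  fix \<alpha> \<beta> c d
  assume \<alpha>: "\<alpha> \<in> S" and \<beta>: "\<beta> \<in> S" and ne: "\<alpha> \<noteq> \<beta>" and ov: "overlap \<alpha> \<beta> c d"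
  have dr: "draws (D \<alpha>) \<alpha>" "draws (D \<beta>) \<beta>" using assms \<alpha> \<beta> by (auto simp: noncrossing_arc_diagram_def)
  have ends: "bot_end \<alpha> \<noteq> bot_end \<beta>" "top_end \<alpha> \<noteq> top_end \<beta>"
    using assms \<alpha> \<beta> ne by (auto simp: noncrossing_arc_diagram_def)
  have ovs: "c < d" "bot_end \<alpha> \<le> c" "bot_end \<beta> \<le> c" "d \<le> top_end \<alpha>" "d \<le> top_end \<beta>"
    "side \<alpha> c \<le> 0" "0 \<le> side \<beta> c" "0 \<le> side \<alpha> d" "side \<beta> d \<le> 0" using ov by (auto simp: overlap_def)
  have range: "bot_end \<alpha> \<le> c" "c \<le> top_end \<alpha>" "bot_end \<beta> \<le> c" "c \<le> top_end \<beta>"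
    "bot_end \<alpha> \<le> d" "bot_end \<beta> \<le> d" using ovs by linarith+
  \<comment> \<open>If both sides were 0, both arcs would start at \<open>c\<close>, which lies
    below both tops; \<open>nz2\<close> is the same at the top.\<close>
  have nz1: "side \<alpha> c < 0 \<or> 0 < side \<beta> c"
  proof (rule ccontr)
    assume "\<not> ?thesis"
    then have "side \<alpha> c = 0" "side \<beta> c = 0" using ovs(6,7) by auto
    then show False
      using side_endpoint[OF range(1,2)] side_endpoint[OF range(3,4)] ovs(1,4,5) ends(1) by simp
  qed
  have nz2: "0 < side \<alpha> d \<or> side \<beta> d < 0"
  proof (rule ccontr)
    assume "\<not> ?thesis"
    then have "side \<alpha> d = 0" "side \<beta> d = 0" using ovs(8,9) by auto
    then show False
      using side_endpoint[OF range(5) ovs(4)] side_endpoint[OF range(6) ovs(5)] ovs(1-3) ends(2) by simp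
  qed
  note sc = draws_side[OF dr(1) range(1,2)] draws_side[OF dr(2) range(3,4)]
  note sd = draws_side[OF dr(1) range(5) ovs(4)] draws_side[OF dr(2) range(6) ovs(5)]
  have le: "\<not> 0 < D \<alpha> (real c)" "\<not> D \<beta> (real c) < 0" "\<not> D \<alpha> (real d) < 0" "\<not> 0 < D \<beta> (real d)"
    unfolding sc[symmetric] sd[symmetric] using ovs(6-9) by simp_all
  have "D \<alpha> (real c) < 0 \<or> 0 < D \<beta> (real c)" "0 < D \<alpha> (real d) \<or> D \<beta> (real d) < 0"
    unfolding sc[symmetric] sd[symmetric] by (fact nz1 nz2)+
  then have sgn: "D \<alpha> (real c) < D \<beta> (real c)" "D \<beta> (real d) < D \<alpha> (real d)"
    using le by linarith+
  have "continuous_on {real c..real d} (D \<gamma>)" if "\<gamma> \<in> {\<alpha>, \<beta>}" for \<gamma>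
    by (rule continuous_on_subset[of "{real (bot_end \<gamma>)..real (top_end \<gamma>)}"])
      (use dr ovs that in \<open>auto simp: draws_def\<close>)
  then have cont: "continuous_on {real c..real d} (\<lambda>y. D \<beta> y - D \<alpha> y)" by (intro continuous_on_diff) auto
  obtain y where y: "real c \<le> y" "y \<le> real d" "D \<beta> y - D \<alpha> y = 0"
    using IVT2'[of "\<lambda>y. D \<beta> y - D \<alpha> y" "real d" 0 "real c"] sgn cont ovs(1) by auto
  have "y \<noteq> real c" "y \<noteq> real d" using sgn y(3) by auto
  then have "y \<in> interior_heights \<alpha> \<inter> interior_heights \<beta>"
    using y ovs by (auto simp: interior_heights_def)
  then show False using assms \<alpha> \<beta> ne y(3) by (auto simp: noncrossing_arc_diagram_def)
qed

text \<open>Follow both arcs upwards to the first node \<open>d\<close> where one ends or their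
  sides differ. There one side is at most 0 and the other at least 0, and this decides the direction
  of the overlap.\<close>

lemma overlap_if_same_bottom:
  assumes mem: "\<alpha> \<in> nc_arcs n" "\<beta> \<in> nc_arcs n" and b: "bot_end \<alpha> = bot_end \<beta>"
  shows "\<exists>d. overlap \<alpha> \<beta> (bot_end \<alpha>) d \<or> overlap \<beta> \<alpha> (bot_end \<alpha>) d"
proof -
  let ?b = "bot_end \<alpha>"
  let ?P = "\<lambda>d. ?b < d \<and> (d = top_end \<alpha> \<or> d = top_end \<beta> \<or> side \<alpha> d \<noteq> side \<beta> d)"
  define d where "d = (LEAST d. ?P d)"
  have P: "?P (top_end \<alpha>)" "?P (top_end \<beta>)" using mem b by (auto simp: nc_arcs_def)
  have d: "?P d" unfolding d_def using P(1) by (rule LeastI)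
  have le: "d \<le> top_end \<alpha>" "d \<le> top_end \<beta>" unfolding d_def using P by (auto intro: Least_le)
  have eq: "side \<alpha> i = side \<beta> i" if "?b < i" "i < d" for i
    using not_less_Least[of i ?P] that unfolding d_def[symmetric] by blast
  have 0: "side \<alpha> ?b = 0" "side \<beta> ?b = 0" using b by (auto simp: side_def)
  have "side \<alpha> d = 0 \<or> side \<beta> d = 0 \<or> side \<alpha> d \<noteq> side \<beta> d" using d by (auto simp: side_def)
  then have "side \<beta> d \<le> 0 \<and> 0 \<le> side \<alpha> d \<or> side \<alpha> d \<le> 0 \<and> 0 \<le> side \<beta> d"
    using side_range[of \<alpha> d] side_range[of \<beta> d] by auto
  then have "overlap \<alpha> \<beta> ?b d \<or> overlap \<beta> \<alpha> ?b d"
    unfolding overlap_def using d le eq 0 b by simp linarith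
  then show ?thesis by blast
qed

lemma overlap_if_same_top:
  assumes mem: "\<alpha> \<in> nc_arcs n" "\<beta> \<in> nc_arcs n" and t: "top_end \<alpha> = top_end \<beta>"
  shows "\<exists>c. overlap \<alpha> \<beta> c (top_end \<alpha>) \<or> overlap \<beta> \<alpha> c (top_end \<alpha>)"
proof -
  let ?t = "top_end \<alpha>"
  let ?C = "{c. c < ?t \<and> (c = bot_end \<alpha> \<or> c = bot_end \<beta> \<or> side \<alpha> c \<noteq> side \<beta> c)}"
  define c where "c = Max ?C"
  have C: "finite ?C" "bot_end \<alpha> \<in> ?C" "bot_end \<beta> \<in> ?C" using mem t by (auto simp: nc_arcs_def)
  have c: "c \<in> ?C" unfolding c_def using C by (intro Max_in) auto
  have ge: "bot_end \<alpha> \<le> c" "bot_end \<beta> \<le> c" unfolding c_def using C by (auto intro: Max_ge)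
  have eq: "side \<alpha> i = side \<beta> i" if "c < i" "i < ?t" for i
  proof (rule ccontr)
    assume "side \<alpha> i \<noteq> side \<beta> i"
    then have "i \<le> c" unfolding c_def using that C(1) by (intro Max_ge) auto
    then show False using that by simp
  qed
  have 0: "side \<alpha> ?t = 0" "side \<beta> ?t = 0" using t by (auto simp: side_def)
  have "side \<alpha> c = 0 \<or> side \<beta> c = 0 \<or> side \<alpha> c \<noteq> side \<beta> c" using c by (auto simp: side_def)
  then have "side \<beta> c \<le> 0 \<and> 0 \<le> side \<alpha> c \<or> side \<alpha> c \<le> 0 \<and> 0 \<le> side \<beta> c"
    using side_range[of \<alpha> c] side_range[of \<beta> c] by auto
  then have "overlap \<alpha> \<beta> c ?t \<or> overlap \<beta> \<alpha> c ?t"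
    unfolding overlap_def using c ge eq 0 t by simp linarith
  then show ?thesis by blast
qed

text \<open>Take the first \<open>d\<close> above \<open>i\<close> where \<alpha> has the larger
  side, then the last \<open>c\<close> below \<open>d\<close> where it has the smaller one; in
  between the sides agree. Different values among -1, 0, 1 are weakly separated by 0, as
  \<open>overlap\<close> demands.\<close>

lemma overlap_if_crossing:
  assumes "bot_end \<alpha> \<le> i" "bot_end \<beta> \<le> i" "i < j" "j \<le> top_end \<alpha>" "j \<le> top_end \<beta>"
    and "side \<alpha> i < side \<beta> i" "side \<beta> j < side \<alpha> j"
  shows "\<exists>c d. overlap \<alpha> \<beta> c d"
proof -
  let ?P = "\<lambda>d. i < d \<and> side \<beta> d < side \<alpha> d"
  define d where "d = (LEAST d. ?P d)"
  have d: "?P d" unfolding d_def by (rule LeastI[of ?P j]) (use assms in auto)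
  have dj: "d \<le> j" unfolding d_def by (rule Least_le) (use assms in auto)
  have d_min: "side \<alpha> k \<le> side \<beta> k" if "i < k" "k < d" for k
    using not_less_Least[of k ?P] that unfolding d_def[symmetric] by auto
  let ?C = "{c. i \<le> c \<and> c < d \<and> side \<alpha> c < side \<beta> c}"
  define c where "c = Max ?C"
  have C: "finite ?C" "i \<in> ?C" using assms d by auto
  have c: "c \<in> ?C" unfolding c_def using C by (intro Max_in) auto
  have c_max: "side \<beta> k \<le> side \<alpha> k" if "c < k" "k < d" for k
  proof (rule ccontr)
    assume "\<not> ?thesis"
    then have "k \<le> c" unfolding c_def using that c C(1) by (intro Max_ge) auto
    then show False using that by simp
  qed
  have "side \<alpha> k = side \<beta> k" if "c < k" "k < d" for k
    using d_min[of k] c_max[of k] that c by auto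
  then have "overlap \<alpha> \<beta> c d"
    using assms c d dj side_range[of \<alpha> c] side_range[of \<beta> c] side_range[of \<alpha> d] side_range[of \<beta> d]
    by (auto simp: overlap_def)
  then show ?thesis by blast
qed

text \<open>
  The weights decay so fast that two arcs passing a node on the same side are ordered by the first
  node below it where they differ.
\<close>

fun node_coord :: "nc_arc \<Rightarrow> nat \<Rightarrow> real" where
  "node_coord \<alpha> 0 = 0"
| "node_coord \<alpha> (Suc i) = (if side \<alpha> (Suc i) = 0 then 0 else of_int (side \<alpha> (Suc i)) + node_coord \<alpha> i / 4)"

text \<open>The bound is the fixed point of b = 1 + b / 4. So the correction term is at most 1/3 in
  absolute value and cannot change the sign given by \<open>side\<close>.\<close>

lemma node_coord_bound: "\<bar>node_coord \<alpha> i\<bar> \<le> 4 / 3"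
proof (induction i)
  case (Suc i)
  then show ?case using side_range[of \<alpha> "Suc i"] by auto
qed simp

lemma node_coord_sign:
  "0 < side \<alpha> i \<Longrightarrow> 0 < node_coord \<alpha> i" "side \<alpha> i < 0 \<Longrightarrow> node_coord \<alpha> i < 0"
  "side \<alpha> i = 0 \<Longrightarrow> node_coord \<alpha> i = 0"
proof -
  have "side \<alpha> 0 = 0" by (simp add: side_def)
  then show "0 < side \<alpha> i \<Longrightarrow> 0 < node_coord \<alpha> i" "side \<alpha> i < 0 \<Longrightarrow> node_coord \<alpha> i < 0"
    "side \<alpha> i = 0 \<Longrightarrow> node_coord \<alpha> i = 0"
    using side_range[of \<alpha> i] node_coord_bound[of \<alpha> "i - 1"] by (cases i; auto)+
qed

text \<open>Piecewise linear interpolation of the node coordinates, written with hat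
  functions.\<close>

definition arc_curve :: "nat \<Rightarrow> nc_arc \<Rightarrow> real \<Rightarrow> real" where
  "arc_curve n \<alpha> y = (\<Sum>i\<le>n. node_coord \<alpha> i * max 0 (1 - \<bar>y - real i\<bar>))"

lemma arc_curve_node: "j \<le> n \<Longrightarrow> arc_curve n \<alpha> (real j) = node_coord \<alpha> j"
proof -
  assume j: "j \<le> n"
  have "max 0 (1 - \<bar>real j - real i\<bar>) = (if i = j then 1 else 0)" for i by auto
  then have "arc_curve n \<alpha> (real j) = (\<Sum>i\<le>n. if i = j then node_coord \<alpha> i else 0)"
    unfolding arc_curve_def by (intro sum.cong) auto
  then show ?thesis using j by simp
qed

lemma draws_arc_curve: "\<alpha> \<in> nc_arcs n \<Longrightarrow> draws (arc_curve n \<alpha>) \<alpha>"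
proof -
  assume \<alpha>: "\<alpha> \<in> nc_arcs n"
  have "continuous_on A (arc_curve n \<alpha>)" for A
    unfolding arc_curve_def by (intro continuous_intros)
  then show ?thesis
    using \<alpha> node_coord_sign[of \<alpha>]
    by (auto simp: draws_def arc_curve_node nc_arcs_def side_def)
qed

text \<open>At \<open>B\<close> one arc starts and the other passes by, so the sides differ. Where
  the sides agree above \<open>B\<close> they are nonzero, as the tops are distinct, and both
  coordinates add the same number to a quarter of those below: strict order is inherited.\<close>

lemma node_coord_less:
  assumes ends: "bot_end \<alpha> \<noteq> bot_end \<beta>" "top_end \<alpha> \<noteq> top_end \<beta>"
    and B: "B = max (bot_end \<alpha>) (bot_end \<beta>)" and T: "T = min (top_end \<alpha>) (top_end \<beta>)" and BT: "B < T"
    and le: "\<And>i. B \<le> i \<Longrightarrow> i \<le> T \<Longrightarrow> side \<alpha> i \<le> side \<beta> i"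
    and i: "B \<le> i" "i \<le> T"
  shows "node_coord \<alpha> i < node_coord \<beta> i"
proof -
  have less: "node_coord \<alpha> j < node_coord \<beta> j" if "B \<le> j" "j \<le> T" "side \<alpha> j \<noteq> side \<beta> j" for j
    using le[OF that(1,2)] that(3) side_range[of \<alpha> j] side_range[of \<beta> j]
      node_coord_sign[of \<alpha> j] node_coord_sign[of \<beta> j] by force
  show ?thesis
    using i
  proof (induction i rule: dec_induct)
    case base
    have "side \<alpha> B \<noteq> side \<beta> B" using B T BT ends by (auto simp: side_def max_def split: if_splits)
    then show ?case using less BT by simp
  next
    case (step j)
    show ?case
    proof (cases "side \<alpha> (Suc j) = side \<beta> (Suc j)")
      case False
      then show ?thesis using step by (intro less) auto
    next
      case True
      have "side \<alpha> (Suc j) \<noteq> 0"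
      proof
        assume "side \<alpha> (Suc j) = 0"
        then have "Suc j = top_end \<alpha>" "Suc j = top_end \<beta>"
          using True step B T side_endpoint[of \<alpha> "Suc j"] side_endpoint[of \<beta> "Suc j"] by auto
        then show False using ends by simp
      qed
      then show ?thesis using True step by simp
    qed
  qed
qed

lemma arc_curve_less:
  assumes mem: "\<alpha> \<in> nc_arcs n" "\<beta> \<in> nc_arcs n" and ends: "bot_end \<alpha> \<noteq> bot_end \<beta>" "top_end \<alpha> \<noteq> top_end \<beta>"
    and B: "B = max (bot_end \<alpha>) (bot_end \<beta>)" and T: "T = min (top_end \<alpha>) (top_end \<beta>)"
    and le: "\<And>i. B \<le> i \<Longrightarrow> i \<le> T \<Longrightarrow> side \<alpha> i \<le> side \<beta> i"
    and y: "real B < y" "y < real T"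
  shows "arc_curve n \<alpha> y < arc_curve n \<beta> y"
proof -
  have "real B < real T" using y by linarith
  then have BT: "B < T" by simp
  note less = node_coord_less[OF ends B T BT le]
  have Tn: "T \<le> n" using T mem by (auto simp: nc_arcs_def)
  let ?h = "\<lambda>i. max 0 (1 - \<bar>y - real i\<bar>)"
  \<comment> \<open>The hats of nodes outside \<open>B\<close> to \<open>T\<close> vanish at
    \<open>y\<close>, all other terms are nonnegative, and the one at the node \<open>k\<close> just
    below or at \<open>y\<close> is positive.\<close>
  define k where "k = nat \<lfloor>y\<rfloor>"
  have k: "real k \<le> y" "y < real k + 1" using y(1) by (auto simp: k_def)
  have kBT: "B \<le> k" "k < T" using k y by linarith+
  have "0 < (\<Sum>i\<le>n. (node_coord \<beta> i - node_coord \<alpha> i) * ?h i)"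
  proof (rule sum_pos2[of _ k])
    show "0 < (node_coord \<beta> k - node_coord \<alpha> k) * ?h k" using less[of k] kBT k by simp
    show "0 \<le> (node_coord \<beta> i - node_coord \<alpha> i) * ?h i" for i
    proof (cases "B \<le> i \<and> i \<le> T")
      case True
      then show ?thesis using less[of i] by simp
    next
      case False
      then have "real i + 1 \<le> real B \<or> real T + 1 \<le> real i" by auto
      then have "?h i = 0" using y by (auto simp: max_def)
      then show ?thesis by simp
    qed
  qed (use kBT Tn in auto)
  also have "\<dots> = arc_curve n \<beta> y - arc_curve n \<alpha> y"
    by (simp add: arc_curve_def sum_subtractf left_diff_distrib)
  finally show ?thesis by simp
qed

text \<open>A common end or a change of order would produce an overlap, so (C1) holds and one of any
  two arcs is weakly left of the other at all common nodes; \<open>arc_curve_less\<close> makes this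
  strict.\<close>

lemma orthogonal_diagram:
  assumes S: "S \<subseteq> nc_arcs n" "orthogonal S"
  shows "noncrossing_arc_diagram n S (arc_curve n)"
  unfolding noncrossing_arc_diagram_def
proof (intro conjI ballI impI)
  show "S \<subseteq> nc_arcs n" by fact
  show "draws (arc_curve n \<alpha>) \<alpha>" if "\<alpha> \<in> S" for \<alpha> using that S(1) by (intro draws_arc_curve) auto
  fix \<alpha> \<beta> assume \<alpha>\<beta>: "\<alpha> \<in> S" "\<beta> \<in> S" "\<alpha> \<noteq> \<beta>"
  have mem: "\<alpha> \<in> nc_arcs n" "\<beta> \<in> nc_arcs n" using \<alpha>\<beta> S(1) by auto
  have no: "\<not> overlap \<alpha> \<beta> c d" "\<not> overlap \<beta> \<alpha> c d" for c d using \<alpha>\<beta> S(2) by (auto simp: orthogonal_def)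
  show bot: "bot_end \<alpha> \<noteq> bot_end \<beta>" using overlap_if_same_bottom[OF mem] no by blast
  show top: "top_end \<alpha> \<noteq> top_end \<beta>" using overlap_if_same_top[OF mem] no by blast
  define B where "B = max (bot_end \<alpha>) (bot_end \<beta>)"
  define T where "T = min (top_end \<alpha>) (top_end \<beta>)"
  fix y assume "y \<in> interior_heights \<alpha> \<inter> interior_heights \<beta>"
  then have y: "real B < y" "y < real T" by (auto simp: interior_heights_def B_def T_def)
  consider "\<And>i. B \<le> i \<Longrightarrow> i \<le> T \<Longrightarrow> side \<alpha> i \<le> side \<beta> i" | "\<And>i. B \<le> i \<Longrightarrow> i \<le> T \<Longrightarrow> side \<beta> i \<le> side \<alpha> i"
  proof -
    have "\<not> (side \<alpha> i < side \<beta> i \<and> side \<beta> j < side \<alpha> j)" if "B \<le> i" "i \<le> T" "B \<le> j" "j \<le> T" for i j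
      using overlap_if_crossing[of \<alpha> i \<beta> j] overlap_if_crossing[of \<beta> j \<alpha> i] no that
      by (cases i j rule: linorder_cases) (auto simp: B_def T_def)
    then show ?thesis using that by (meson not_le)
  qed
  then show "arc_curve n \<alpha> y \<noteq> arc_curve n \<beta> y"
  proof cases
    case 1
    then show ?thesis using arc_curve_less[OF mem bot top B_def T_def _ y] by fastforce
  next
    case 2
    have "B = max (bot_end \<beta>) (bot_end \<alpha>)" "T = min (top_end \<beta>) (top_end \<alpha>)" by (auto simp: B_def T_def)
    then show ?thesis using arc_curve_less[OF mem(2,1) bot[symmetric] top[symmetric] _ _ 2 y] by fastforce
  qed
qed

lemma noncrossing_arc_complex_eq: "noncrossing_arc_complex n = {S. S \<subseteq> nc_arcs n \<and> orthogonal S}"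
proof (intro equalityI subsetI)
  fix A assume "A \<in> noncrossing_arc_complex n"
  then obtain S D where D: "noncrossing_arc_diagram n S D" "A \<subseteq> S" by (auto simp: noncrossing_arc_complex_def)
  have "orthogonal S" by (rule diagram_orthogonal[OF D(1)])
  then have "orthogonal A" using D(2) unfolding orthogonal_def by blast
  moreover have "A \<subseteq> nc_arcs n" using D by (auto simp: noncrossing_arc_diagram_def)
  ultimately show "A \<in> {S. S \<subseteq> nc_arcs n \<and> orthogonal S}" by blast
next
  fix A assume "A \<in> {S. S \<subseteq> nc_arcs n \<and> orthogonal S}"
  then show "A \<in> noncrossing_arc_complex n"
    using orthogonal_diagram[of A n] by (auto simp: noncrossing_arc_complex_def)
qed

text \<open>The inverse of \<tau> is the isomorphism, since the map required runs from the image
  complex to \<Delta>.\<close>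

lemma complex_isomorphic_image:
  assumes inj: "inj_on \<tau> (\<Union>\<Delta>)"
  shows "complex_isomorphic ((`) \<tau> ` \<Delta>) \<Delta>"
  unfolding complex_isomorphic_def
proof (intro exI conjI allI impI)
  let ?f = "inv_into (\<Union>\<Delta>) \<tau>"
  have U: "\<Union>((`) \<tau> ` \<Delta>) = \<tau> ` \<Union>\<Delta>" by blast
  show "bij_betw ?f (\<Union>((`) \<tau> ` \<Delta>)) (\<Union>\<Delta>)"
    unfolding U using inj by (intro bij_betw_inv_into) (simp add: inj_on_imp_bij_betw)
  fix A assume A: "A \<subseteq> \<Union>((`) \<tau> ` \<Delta>)"
  then have A': "\<tau> ` ?f ` A = A" unfolding U by (rule image_inv_into_cancel[OF refl])
  have inv: "?f ` \<tau> ` S = S" if "S \<in> \<Delta>" for S using inj that by (intro inv_into_image_cancel) auto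
  show "A \<in> (`) \<tau> ` \<Delta> \<longleftrightarrow> ?f ` A \<in> \<Delta>"
  proof
    assume "A \<in> (`) \<tau> ` \<Delta>"
    then show "?f ` A \<in> \<Delta>" using inv by auto
  next
    assume "?f ` A \<in> \<Delta>"
    then show "A \<in> (`) \<tau> ` \<Delta>" using A' by (metis imageI)
  qed
qed

theorem theorem4p2p2:
  fixes n :: nat
  assumes "n \<ge> 1"
  shows "complex_isomorphic
    (canonical_join_complex (tors TYPE('k::field) n))
    (noncrossing_arc_complex n)"
proof -
  have "\<Union>(noncrossing_arc_complex n) \<subseteq> nc_arcs n" by (auto simp: noncrossing_arc_complex_eq)
  then have "inj_on (arc_torsion n :: nc_arc \<Rightarrow> 'k RA_module set) (\<Union>(noncrossing_arc_complex n))"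
    by (rule inj_on_subset[OF inj_on_arc_torsion])
  \<comment> \<open>Both complexes are now expressed by orthogonal sets of arcs, one of them
    transported along \<open>arc_torsion\<close>.\<close>
  then show ?thesis
    unfolding canonical_join_complex_tors noncrossing_arc_complex_eq by (rule complex_isomorphic_image)
qed

end
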